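(* Let $K$ be a field of characteristic zero and let $\mathfrak{g}$ be a (finite-dimensional) semisimple Lie algebra over $K$. Then $\operatorname{ad} \mathfrak{g} = \{\operatorname{ad} x \mid x \in \mathfrak{g}\}$ is a rank-critical subspace of $\operatorname{End}(\mathfrak{g})$.
   Context: For a finite-dimensional $K$-vector space $V$ and a linear subspace $\mathcal{A}\subseteq \operatorname{End}(V)$ (the $K$-linear maps $V \to V$), the (generic) rank $\operatorname{rk} \mathcal{A}$ is the highest rank of an element of $\mathcal{A}$. The space $\mathcal{A}$ is called rank-critical if every linear subspace $\mathcal{B}$ of $\operatorname{End}(V)$ that properly contains $\mathcal{A}$ satisfies $\operatorname{rk} \mathcal{B} > \operatorname{rk} \mathcal{A}$. Here $\operatorname{End}(\mathfrak{g})$ denotes all $K$-linear maps $\mathfrak{g}\to\mathfrak{g}$. *)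

theory Defs
  imports Complex_Main "HOL-Library.Function_Algebras"
begin

section \<open>Linear spaces of endomorphisms\<close>

locale endomorphism_space = finite_dimensional_vector_space scale Basis
  for scale :: "'k::field \<Rightarrow> 'v::ab_group_add \<Rightarrow> 'v" and Basis :: "'v set"
begin

definition endos :: "('v \<Rightarrow> 'v) set" where
  "endos = {f. Vector_Spaces.linear scale scale f}"

definition map_scale :: "'k \<Rightarrow> ('v \<Rightarrow> 'v) \<Rightarrow> 'v \<Rightarrow> 'v" where
  "map_scale c f = (\<lambda>x. scale c (f x))"

lemma vector_space_map_scale: "vector_space map_scale"
  by unfold_locales (auto simp: map_scale_def fun_eq_iff scale_right_distrib scale_left_distrib)

definition endo_subspace :: "('v \<Rightarrow> 'v) set \<Rightarrow> bool" where
  "endo_subspace A \<longleftrightarrow> A \<subseteq> endos \<and> module.subspace map_scale A"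

definition map_rank :: "('v \<Rightarrow> 'v) \<Rightarrow> nat" where
  "map_rank f = dim (range f)"

text \<open>The ranks are bounded by the dimension, so the maximum is over a finite set.\<close>

definition generic_rank :: "('v \<Rightarrow> 'v) set \<Rightarrow> nat" where
  "generic_rank A = Max (map_rank ` A)"

definition rank_critical :: "('v \<Rightarrow> 'v) set \<Rightarrow> bool" where
  "rank_critical A \<longleftrightarrow>
     endo_subspace A \<and> (\<forall>B. endo_subspace B \<and> A \<subset> B \<longrightarrow> generic_rank B > generic_rank A)"

end

section \<open>Semisimple Lie algebras\<close>

locale lie_algebra = vector_space scale
  for scale :: "'k::field \<Rightarrow> 'g::ab_group_add \<Rightarrow> 'g" +
  fixes bracket :: "'g \<Rightarrow> 'g \<Rightarrow> 'g"
  assumes bracket_add_left: "bracket (x + y) z = bracket x z + bracket y z"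
    and bracket_add_right: "bracket x (y + z) = bracket x y + bracket x z"
    and bracket_scale_left: "bracket (scale c x) y = scale c (bracket x y)"
    and bracket_scale_right: "bracket x (scale c y) = scale c (bracket x y)"
    and bracket_self: "bracket x x = 0"
    and jacobi: "bracket x (bracket y z) + bracket y (bracket z x) + bracket z (bracket x y) = 0"
begin

definition ad :: "'g \<Rightarrow> 'g \<Rightarrow> 'g" where
  "ad x = (\<lambda>y. bracket x y)"

definition lie_ideal :: "'g set \<Rightarrow> bool" where
  "lie_ideal I \<longleftrightarrow> subspace I \<and> (\<forall>x. \<forall>y\<in>I. bracket x y \<in> I)"

definition derived :: "'g set \<Rightarrow> 'g set" where
  "derived S = span {bracket x y |x y. x \<in> S \<and> y \<in> S}"

definition solvable :: "'g set \<Rightarrow> bool" where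
  "solvable S \<longleftrightarrow> (\<exists>n. (derived ^^ n) S = {0})"

end

text \<open>
  In finite dimension the solvable ideals have a largest member, the radical, so the
  assumption below says that the radical is zero.
\<close>

locale semisimple_lie_algebra = lie_algebra +
  assumes solvable_ideal_trivial: "lie_ideal I \<Longrightarrow> solvable I \<Longrightarrow> I = {0}"

end

theory Submission
  imports Defs "HOL-Algebra.Algebraic_Closure_Type"
begin

text \<open>
  Let \<open>B\<close> lie in a space containing \<open>ad g\<close> of the same generic rank. Perturbing \<open>ad y\<close>, for \<open>ad y\<close> of
  maximal rank, to \<open>ad y + t B\<close> shows that \<open>B\<close> maps the centraliser of \<open>y\<close> into \<open>[y, g]\<close>. Fix a
  regular \<open>x\<close>, whose centraliser \<open>H\<close> is abelian and complements \<open>[x, g]\<close>, and subtract an inner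
  derivation so that \<open>B x = 0\<close>. Then \<open>\<beta>(u, v) = \<kappa>(B u, v)\<close>, with \<open>\<kappa>\<close> the Killing form, is
  alternating. Write \<open>S\<close> for the inverse of \<open>ad x\<close> on \<open>[x, g]\<close>. For \<open>y \<in> H\<close> the centraliser of
  \<open>x + t u\<close> contains \<open>y - t S [u, y] + t\<^sup>2 S [u, S [u, y]] - \<dots>\<close>, and comparing powers of \<open>t\<close> gives
  \<open>\<beta>(y, u) = \<beta>(S [u, y], u) = \<beta>(S [u, S [u, y]], u) = 0\<close> for all \<open>u\<close>. Over the
  algebraic closure the second identity forces \<open>\<beta>\<close> to pair only opposite root spaces (these are
  one-dimensional, and the only multiples of a root are its negative and itself), and the third one
  says that \<open>\<beta>\<close> is a cocycle. So \<open>B\<close> is a derivation, hence inner.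
\<close>

section \<open>Polynomials in an operator\<close>

text \<open>The root decomposition lives over the closure, while maximality of rank is known only
  over \<open>K\<close>. Hence everything drawn from the rank is phrased as multilinear identities
  in \<open>\<beta>\<close>, \<open>S\<close> and \<open>x\<close>, which survive extension of
  scalars. As \<open>K\<close> carries no topology, expansions in \<open>t\<close> are replaced by
  linear relations between values at infinitely many \<open>t\<close>. \<open>\<beta>\<close> is
  alternating because a \<open>y\<close> of maximal rank centralises itself: \<open>B y\<close> lies
  in \<open>[y, g]\<close>, which is \<open>\<kappa>\<close>-orthogonal to \<open>y\<close>, and
  \<open>x + t u\<close> has maximal rank for all but finitely many \<open>t\<close>. That
  \<open>x\<close> centralises itself also makes \<open>B x = 0\<close> attainable. Maximal rank
  does not suffice for \<open>H\<close> to complement \<open>[x, g]\<close>, since a regular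
  nilpotent element may have maximal rank too. So \<open>x\<close> is chosen, among the elements of
  maximal rank, with smallest Fitting null component, and that component is shown to be abelian.
  This and the nondegeneracy of \<open>\<kappa>\<close> both rest on Cartan's criterion together
  with Engel's theorem.\<close>

text \<open>A copy of the library locale: constants defined in the latter would be duplicated by its
  many interpretations.\<close>

locale vs_operators = vector_space scale
  for scale :: "'a::field \<Rightarrow> 'b::ab_group_add \<Rightarrow> 'b" (infixr "*s" 75)
begin

abbreviation lin :: "('b \<Rightarrow> 'b) \<Rightarrow> bool" where
  "lin f \<equiv> Vector_Spaces.linear scale scale f"

lemma linI:
  assumes "\<And>x y. f (x + y) = f x + f y" "\<And>c x. f (c *s x) = c *s f x"
  shows "lin f"
  using assms by (simp add: Vector_Spaces.linear_iff vector_space_axioms)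

lemma lin_add: "lin f \<Longrightarrow> f (x + y) = f x + f y"
  and lin_scale: "lin f \<Longrightarrow> f (c *s x) = c *s f x"
  by (simp_all add: Vector_Spaces.linear_iff)

lemma lin_0: "lin f \<Longrightarrow> f 0 = 0"
  using lin_scale[of f 0 0] by simp

lemma lin_neg: "lin f \<Longrightarrow> f (- x) = - f x"
  using lin_scale[of f "-1" x] by simp

lemma lin_diff: "lin f \<Longrightarrow> f (x - y) = f x - f y"
  using lin_add[of f x "- y"] lin_neg[of f y] by simp

lemma lin_sum: "lin f \<Longrightarrow> f (sum g A) = (\<Sum>a\<in>A. f (g a))"
  by (induction A rule: infinite_finite_induct) (auto simp: lin_0 lin_add)

lemmas lin_simps = lin_0 lin_add lin_scale lin_neg lin_diff lin_sum

lemma lin_comp: "lin f \<Longrightarrow> lin g \<Longrightarrow> lin (\<lambda>x. f (g x))"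
  by (rule linI) (simp_all add: lin_simps)

lemma lin_funpow: "lin f \<Longrightarrow> lin (f ^^ n)"
  by (induction n) (auto intro!: linI simp: lin_simps)

lemma lin_span_mono:
  assumes "lin f" "\<And>b. b \<in> B \<Longrightarrow> f b \<in> W" "subspace W" "v \<in> span B"
  shows "f v \<in> W"
  using assms(4)
  by (induction rule: span_induct_alt)
     (use assms in \<open>auto simp: lin_simps intro!: subspace_0 subspace_add subspace_scale\<close>)

lemma lin_subspace_image: "lin f \<Longrightarrow> subspace W \<Longrightarrow> subspace (f ` W)"
  by (metis module_hom.subspace_image module_hom_iff_linear)

lemma lin_eq_0_span:
  assumes "lin f" "\<And>b. b \<in> B \<Longrightarrow> f b = 0" "v \<in> span B"
  shows "f v = 0"
  using lin_span_mono[OF assms(1), of B "{0}" v] assms by auto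

lemma lin_inj_onI:
  assumes "lin f" "subspace W" "\<And>v. v \<in> W \<Longrightarrow> f v = 0 \<Longrightarrow> v = 0"
  shows "inj_on f W"
proof (rule inj_onI)
  fix x y assume "x \<in> W" "y \<in> W" "f x = f y"
  then have "x - y \<in> W" "f (x - y) = 0" using assms by (auto simp: lin_simps subspace_diff)
  then show "x = y" using assms(3) by force
qed

definition poly_op :: "('b \<Rightarrow> 'b) \<Rightarrow> 'a poly \<Rightarrow> 'b \<Rightarrow> 'b" where
  "poly_op f p = fold_coeffs (\<lambda>a g v. a *s v + f (g v)) p (\<lambda>v. 0)"

lemma poly_op_0 [simp]: "poly_op f 0 v = 0"
  by (simp add: poly_op_def)

lemma poly_op_pCons: "lin f \<Longrightarrow> poly_op f (pCons a p) v = a *s v + f (poly_op f p v)"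
  by (cases "p = 0 \<and> a = 0") (auto simp: poly_op_def lin_simps)

lemma poly_op_1: "lin f \<Longrightarrow> poly_op f 1 v = v"
  by (simp add: one_pCons poly_op_pCons lin_simps)

lemma poly_op_add:
  assumes "lin f" shows "poly_op f (p + q) v = poly_op f p v + poly_op f q v"
proof (induction p arbitrary: q)
  case (pCons a p)
  show ?case
    by (cases q, simp add: poly_op_pCons assms pCons.IH lin_simps scale_left_distrib)
qed simp

lemma poly_op_smult: "lin f \<Longrightarrow> poly_op f (smult c p) v = c *s poly_op f p v"
  by (induction p) (simp_all add: poly_op_pCons lin_simps scale_right_distrib)

lemma poly_op_uminus: "lin f \<Longrightarrow> poly_op f (- p) v = - poly_op f p v"
  using poly_op_smult[of f "-1" p v] by simp

lemma poly_op_diff: "lin f \<Longrightarrow> poly_op f (p - q) v = poly_op f p v - poly_op f q v"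
  using poly_op_add[of f p "- q" v] by (simp add: poly_op_uminus)

lemma poly_op_lin: "lin f \<Longrightarrow> lin (poly_op f p)"
  by (induction p) (auto intro!: linI simp: poly_op_pCons lin_simps scale_right_distrib scale_left_commute)

lemma poly_op_mult: "lin f \<Longrightarrow> poly_op f (p * q) v = poly_op f p (poly_op f q v)"
  by (induction p) (simp_all add: poly_op_pCons poly_op_add poly_op_smult)

lemma poly_op_sum: "lin f \<Longrightarrow> poly_op f (\<Sum>i\<in>A. p i) v = (\<Sum>i\<in>A. poly_op f (p i) v)"
  by (induction A rule: infinite_finite_induct) (auto simp: poly_op_add)

lemma poly_op_subspace:
  assumes "lin f" "subspace W" "\<And>w. w \<in> W \<Longrightarrow> f w \<in> W" "v \<in> W"
  shows "poly_op f p v \<in> W"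
  using assms(4)
  by (induction p arbitrary: v)
     (auto simp: poly_op_pCons assms subspace_0 intro!: subspace_add subspace_scale)

lemma poly_op_commute:
  assumes "lin f" "lin g" "\<And>v. g (f v) = f (g v)"
  shows "g (poly_op f p v) = poly_op f p (g v)"
  by (induction p) (simp_all add: poly_op_pCons assms lin_simps)

lemma poly_op_eigen:
  assumes "lin f" "f v = c *s v"
  shows "poly_op f p v = poly p c *s v"
  by (induction p) (simp_all add: poly_op_pCons assms lin_simps scale_left_distrib mult.commute)

lemma poly_op_monom: "lin f \<Longrightarrow> poly_op f (Polynomial.monom c n) v = c *s (f ^^ n) v"
  by (induction n) (simp_all add: monom_0 monom_Suc poly_op_pCons lin_simps)

lemma poly_op_linear: "lin f \<Longrightarrow> poly_op f [:-c, 1:] v = f v - c *s v"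
  by (simp add: poly_op_pCons lin_simps)

lemma poly_op_linear_power:
  "lin f \<Longrightarrow> poly_op f ([:-c, 1:] ^ k) v = ((\<lambda>v. f v - c *s v) ^^ k) v"
  by (induction k) (simp_all add: poly_op_1 poly_op_mult poly_op_linear del: mult_pCons_left)

lemma poly_op_dvd:
  assumes "lin f" "p dvd q" "poly_op f p v = 0" shows "poly_op f q v = 0"
proof -
  obtain r where "q = r * p" using assms(2) by (metis dvdE mult.commute)
  then show ?thesis using assms by (simp add: poly_op_mult lin_0[OF poly_op_lin])
qed

text \<open>If no nonzero polynomial killed \<open>v\<close>, the iterates of \<open>v\<close> up to
  exponent \<open>card B\<close> would be \<open>card B + 1\<close> independent vectors in a span of
  \<open>card B\<close>.\<close>

lemma poly_op_annihilates_vector: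
  assumes "lin f" "finite B" "\<And>w. w \<in> span B \<Longrightarrow> f w \<in> span B" "v \<in> span B"
  shows "\<exists>p. p \<noteq> 0 \<and> poly_op f p v = 0"
proof (rule ccontr)
  assume "\<nexists>p. p \<noteq> 0 \<and> poly_op f p v = 0"
  then have nz: "poly_op f p v = 0 \<Longrightarrow> p = 0" for p by auto
  define S where "S = (\<lambda>i. (f ^^ i) v) ` {..card B}"
  have inj: "inj (\<lambda>i. (f ^^ i) v)"
  proof (rule injI)
    fix i j assume "(f ^^ i) v = (f ^^ j) v"
    then have "poly_op f (Polynomial.monom 1 i - Polynomial.monom 1 j) v = 0"
      by (simp add: poly_op_diff assms poly_op_monom)
    then have "Polynomial.monom (1::'a) i = Polynomial.monom 1 j" using nz by force
    then show "i = j" by (metis degree_monom_eq one_neq_zero)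
  qed
  have "independent S"
  proof (rule independent_if_scalars_zero)
    fix u x assume u: "(\<Sum>x\<in>S. u x *s x) = 0" and x: "x \<in> S"
    let ?p = "\<Sum>i\<le>card B. Polynomial.monom (u ((f ^^ i) v)) i"
    have "poly_op f ?p v = (\<Sum>i\<le>card B. u ((f ^^ i) v) *s (f ^^ i) v)"
      by (simp add: poly_op_sum poly_op_monom assms)
    also have "\<dots> = (\<Sum>x\<in>S. u x *s x)"
      unfolding S_def by (subst sum.reindex) (auto intro: inj_on_subset[OF inj])
    finally have "?p = 0" using u nz by simp
    moreover obtain i where i: "i \<le> card B" "x = (f ^^ i) v" using x by (auto simp: S_def)
    have "Polynomial.coeff ?p i = u x"
      unfolding coeff_sum coeff_monom using i by simp
    ultimately show "u x = 0" by (metis Polynomial.coeff_0)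
  qed (simp add: S_def)
  moreover have "(f ^^ i) v \<in> span B" for i by (induction i) (auto simp: assms)
  then have "S \<subseteq> span B" by (auto simp: S_def)
  ultimately have "card S \<le> card B" using independent_span_bound[OF assms(2)] by auto
  moreover have "card S = Suc (card B)"
    unfolding S_def by (subst card_image) (auto intro: inj_on_subset[OF inj])
  ultimately show False by simp
qed

lemma poly_op_annihilates:
  assumes "lin f" "finite B" "\<And>w. w \<in> span B \<Longrightarrow> f w \<in> span B"
  shows "\<exists>p. p \<noteq> 0 \<and> (\<forall>v\<in>span B. poly_op f p v = 0)"
proof -
  have "\<forall>b\<in>B. \<exists>p. p \<noteq> 0 \<and> poly_op f p b = 0"
    using poly_op_annihilates_vector[OF assms] span_base by blast
  then obtain p where p: "\<And>b. b \<in> B \<Longrightarrow> p b \<noteq> 0 \<and> poly_op f (p b) b = 0" by metis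
  have "poly_op f (\<Prod>b\<in>B. p b) v = 0" if "v \<in> span B" for v
    by (rule lin_eq_0_span[OF poly_op_lin[OF assms(1)] _ that])
       (use p assms in \<open>auto intro: poly_op_dvd dvd_prodI\<close>)
  then show ?thesis using p assms(2) by (intro exI[of _ "\<Prod>b\<in>B. p b"]) auto
qed

subsection \<open>Generalised eigenspaces\<close>

text \<open>The exponent \<open>k\<close> is left unbounded, since the ambient space may be
  infinite-dimensional; phrasing it by \<open>poly_op\<close> lets divisibility and Bezout arguments
  act on vectors.\<close>

definition gen_eigenspace :: "('b \<Rightarrow> 'b) \<Rightarrow> 'a \<Rightarrow> 'b set" where
  "gen_eigenspace f c = {v. \<exists>k. poly_op f ([:-c, 1:] ^ k) v = 0}"

lemma subspace_gen_eigenspace: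
  assumes "lin f" shows "subspace (gen_eigenspace f c)"
proof (rule subspaceI)
  show "0 \<in> gen_eigenspace f c"
    by (auto simp: gen_eigenspace_def lin_0[OF poly_op_lin[OF assms]])
next
  fix x y assume "x \<in> gen_eigenspace f c" "y \<in> gen_eigenspace f c"
  then obtain k l where "poly_op f ([:-c, 1:] ^ k) x = 0" "poly_op f ([:-c, 1:] ^ l) y = 0"
    by (auto simp: gen_eigenspace_def)
  then have "poly_op f ([:-c, 1:] ^ (k + l)) (x + y) = 0"
    using poly_op_dvd[OF assms, of "[:-c, 1:] ^ k" "[:-c, 1:] ^ (k + l)" x]
      poly_op_dvd[OF assms, of "[:-c, 1:] ^ l" "[:-c, 1:] ^ (k + l)" y]
    by (simp add: lin_add[OF poly_op_lin[OF assms]] le_imp_power_dvd)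
  then show "x + y \<in> gen_eigenspace f c" by (auto simp: gen_eigenspace_def)
next
  fix a x assume "x \<in> gen_eigenspace f c"
  then show "a *s x \<in> gen_eigenspace f c"
    by (auto simp: gen_eigenspace_def lin_scale[OF poly_op_lin[OF assms]])
qed

lemma gen_eigenspaceI_step:
  assumes "lin f" "f v - c *s v \<in> gen_eigenspace f c"
  shows "v \<in> gen_eigenspace f c"
proof -
  obtain k where "poly_op f ([:-c, 1:] ^ k) (f v - c *s v) = 0"
    using assms(2) by (auto simp: gen_eigenspace_def)
  then have "poly_op f ([:-c, 1:] ^ Suc k) v = 0"
    by (simp only: power_Suc2 poly_op_mult[OF assms(1)] poly_op_linear[OF assms(1)])
  then show ?thesis by (auto simp only: gen_eigenspace_def)
qed

lemma gen_eigenspace_step: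
  assumes "lin f" "v \<in> gen_eigenspace f c"
  shows "f v - c *s v \<in> gen_eigenspace f c"
proof -
  obtain k where k: "poly_op f ([:-c, 1:] ^ k) v = 0" using assms(2) by (auto simp: gen_eigenspace_def)
  have "poly_op f ([:-c, 1:] ^ k) (f v - c *s v) = poly_op f ([:-c, 1:] ^ Suc k) v"
    by (simp only: power_Suc2 poly_op_mult[OF assms(1)] poly_op_linear[OF assms(1)])
  also have "\<dots> = 0" using k by (simp add: poly_op_mult[OF assms(1)] lin_0[OF poly_op_lin[OF assms(1)]]
        del: mult_pCons_left)
  finally show ?thesis by (auto simp only: gen_eigenspace_def)
qed

lemma gen_eigenspace_0_iff: "lin f \<Longrightarrow> v \<in> gen_eigenspace f 0 \<longleftrightarrow> (\<exists>k. (f ^^ k) v = 0)"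
  unfolding gen_eigenspace_def by (simp only: mem_Collect_eq poly_op_linear_power) simp

text \<open>Carries a hypothesis about the iterates of exponent at least 1 over to a replica, which
  is a polynomial in the operator without constant term.\<close>

lemma poly_op_in_powers_span:
  assumes "lin f" "poly q 0 = 0"
  shows "poly_op f q v \<in> span {(f ^^ k) v | k. k \<ge> 1}"
proof -
  let ?S = "{(f ^^ k) v | k. k \<ge> 1}"
  obtain q' where q: "q = pCons 0 q'" using assms(2) by (cases q) auto
  have st: "f w \<in> span ?S" if "w \<in> span ?S" for w
    using assms(1) _ subspace_span that
  proof (rule lin_span_mono)
    fix b assume "b \<in> ?S"
    then obtain k where "b = (f ^^ k) v" "k \<ge> 1" by auto
    then have "f b = (f ^^ Suc k) v" by simp
    then show "f b \<in> span ?S" by (intro span_base) (auto simp del: funpow.simps)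
  qed
  let ?W = "{w. f w \<in> span ?S}"
  have W: "subspace ?W"
    by (rule subspaceI) (auto simp: lin_simps[OF assms(1)] span_zero span_add span_scale)
  have "f v = (f ^^ 1) v" by simp
  then have v: "v \<in> ?W" using span_base[of "f v" ?S] by blast
  have "poly_op f q' v \<in> ?W"
    by (rule poly_op_subspace[OF assms(1) W _ v]) (use st in auto)
  then show ?thesis by (simp add: q poly_op_pCons assms(1))
qed

text \<open>After scaling \<open>m\<close> to value 1 at \<open>c\<close>, \<open>1 - m\<close> is
  divisible by \<open>X - c\<close>, so the truncated geometric series in \<open>1 - m\<close>
  inverts \<open>m\<close> modulo \<open>(X - c)^N\<close>.\<close>

lemma poly_inverse_mod_linear_power:
  fixes m :: "'c::field poly"
  assumes "poly m c \<noteq> 0"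
  shows "\<exists>r. [:-c, 1:] ^ N dvd r * m - 1"
proof -
  let ?m = "smult (1 / poly m c) m"
  have "[:-c, 1:] dvd 1 - ?m" using assms by (simp add: poly_eq_0_iff_dvd[symmetric])
  then have "[:-c, 1:] ^ N dvd (1 - ?m) ^ N" by (rule dvd_power_same)
  moreover have "1 - (1 - ?m) ^ N = ?m * (\<Sum>i<N. (1 - ?m) ^ i)"
    using one_diff_power_eq[of "1 - ?m" N] by simp
  then have "smult (1 / poly m c) (\<Sum>i<N. (1 - ?m) ^ i) * m - 1 = - ((1 - ?m) ^ N)"
    by (simp add: algebra_simps)
  ultimately show ?thesis by (metis dvd_minus_iff)
qed

lemma poly_interpolation:
  fixes \<phi> :: "'c::field \<Rightarrow> 'c"
  assumes "finite D"
  shows "\<exists>q. \<forall>d\<in>D. [:-d, 1:] ^ N dvd q - [:\<phi> d:]"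
  using assms
proof (induction D)
  case (insert d D)
  then obtain q where q: "\<And>e. e \<in> D \<Longrightarrow> [:-e, 1:] ^ N dvd q - [:\<phi> e:]" by auto
  let ?M = "(\<Prod>e\<in>D. [:-e, 1:] ^ N)"
  have "poly ?M d \<noteq> 0" using insert by (auto simp: poly_prod)
  then obtain r where r: "[:-d, 1:] ^ N dvd r * ?M - 1" using poly_inverse_mod_linear_power by blast
  \<comment> \<open>\<open>r\<close> inverts \<open>?M\<close> at the new node \<open>d\<close>, so
    the correction replaces the residue there, while the factor \<open>?M\<close> leaves the old
    nodes alone.\<close>
  let ?q = "q + r * ?M * ([:\<phi> d:] - q)"
  have "?q - [:\<phi> d:] = (r * ?M - 1) * ([:\<phi> d:] - q)" by (simp add: algebra_simps)
  then have "[:-d, 1:] ^ N dvd ?q - [:\<phi> d:]" using r by (metis dvd_mult2)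
  moreover have "[:-e, 1:] ^ N dvd ?q - [:\<phi> e:]" if "e \<in> D" for e
  proof -
    have "[:-e, 1:] ^ N dvd r * ?M * ([:\<phi> d:] - q)"
      using that insert.hyps by (intro dvd_mult2 dvd_mult dvd_prodI) auto
    moreover have "?q - [:\<phi> e:] = (q - [:\<phi> e:]) + r * ?M * ([:\<phi> d:] - q)" by simp
    ultimately show ?thesis using q[OF that] by (metis dvd_add)
  qed
  ultimately show ?case by blast
qed auto

text \<open>Write \<open>p = (X - c)^m q\<close> with \<open>q\<close> nonzero at \<open>c\<close>.
  Modulo the power of \<open>X - c\<close> that kills \<open>v\<close>, \<open>q\<close> is
  invertible, so \<open>(X - c)^m\<close> agrees on \<open>v\<close> with a multiple of
  \<open>p\<close>.\<close>

lemma gen_eigenspace_bounded: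
  assumes "lin f" "p \<noteq> 0" "poly_op f p v = 0" "v \<in> gen_eigenspace f c"
  shows "poly_op f ([:-c, 1:] ^ order c p) v = 0"
proof -
  obtain q where q: "p = [:-c, 1:] ^ order c p * q" "\<not> [:-c, 1:] dvd q"
    using order_decomp[OF assms(2)] by blast
  obtain k where k: "poly_op f ([:-c, 1:] ^ k) v = 0" using assms by (auto simp: gen_eigenspace_def)
  obtain r where r: "[:-c, 1:] ^ k dvd r * q - 1"
    using poly_inverse_mod_linear_power q(2) by (metis poly_eq_0_iff_dvd)
  let ?g = "[:-c, 1:] ^ order c p"
  have "[:-c, 1:] ^ k dvd ?g * (r * q - 1)" using r by simp
  then have "poly_op f (?g * (r * q - 1)) v = 0" using poly_op_dvd assms k by blast
  moreover have "?g * (r * q - 1) = r * p - ?g" by (subst (2) q(1)) (simp add: algebra_simps)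
  moreover have "poly_op f (r * p) v = 0" using poly_op_dvd[OF assms(1) _ assms(3)] by auto
  ultimately show ?thesis by (simp add: poly_op_diff assms)
qed

lemma gen_eigenspace_trivial:
  assumes "lin f" "p \<noteq> 0" "poly_op f p v = 0" "v \<in> gen_eigenspace f c" "poly p c \<noteq> 0"
  shows "v = 0"
  using gen_eigenspace_bounded[OF assms(1-4)] assms by (simp add: order_0I poly_op_1)

text \<open>Hermite interpolation realises any function of the eigenvalues as a polynomial in the operator.\<close>

lemma poly_op_replica:
  fixes \<phi> :: "'a \<Rightarrow> 'a"
  assumes "lin f" "p \<noteq> 0"
  shows "\<exists>q. poly q 0 = \<phi> 0 \<and>
    (\<forall>v c. poly_op f p v = 0 \<longrightarrow> v \<in> gen_eigenspace f c \<longrightarrow> poly_op f q v = \<phi> c *s v)"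
proof -
  \<comment> \<open>The successor keeps the exponent positive even for constant \<open>p\<close>;
    together with the extra node 0 in the next line this forces
    \<open>poly q 0 = \<phi> 0\<close>.\<close>
  let ?N = "Suc (Polynomial.degree p)"
  have "finite (insert 0 {c. poly p c = 0})" using poly_roots_finite[OF assms(2)] by simp
  then obtain q where q: "\<And>d. d \<in> insert 0 {c. poly p c = 0} \<Longrightarrow> [:-d, 1:] ^ ?N dvd q - [:\<phi> d:]"
    using poly_interpolation by metis
  have "[:-0, 1:] dvd q - [:\<phi> 0:]" using q[of 0] by (metis dvd_trans dvd_power insertI1 zero_less_Suc)
  then have "poly (q - [:\<phi> 0:]) 0 = 0" by (metis poly_eq_0_iff_dvd)
  moreover have "poly_op f q v = \<phi> c *s v"
    if v: "poly_op f p v = 0" "v \<in> gen_eigenspace f c" for v c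
  proof (cases "poly p c = 0")
    case True
    have "order c p \<le> ?N" using order_degree[OF assms(2)] le_SucI by blast
    then have "[:-c, 1:] ^ order c p dvd q - [:\<phi> c:]"
      using q[of c] True le_imp_power_dvd dvd_trans by blast
    then have "poly_op f (q - [:\<phi> c:]) v = 0"
      using poly_op_dvd gen_eigenspace_bounded assms v by blast
    then show ?thesis by (simp add: poly_op_diff poly_op_pCons assms lin_0)
  next
    case False
    then have "v = 0" using gen_eigenspace_trivial assms v by blast
    then show ?thesis by (simp add: lin_0[OF poly_op_lin[OF assms(1)]])
  qed
  ultimately show ?thesis by (intro exI[of _ q]) auto
qed

end

text \<open>Induction on the roots. For the new root \<open>d\<close>, \<open>(f - d) v\<close> is a
  sum of generalised eigenvectors. On those for \<open>c \<noteq> d\<close> the map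
  \<open>f - d\<close> is invertible, so \<open>(f - d) v = (f - d) w + g\<close> with
  \<open>g\<close> belonging to \<open>d\<close>, and then \<open>v - w\<close> belongs to
  \<open>d\<close> as well.\<close>

lemma (in vs_operators) span_gen_eigenspaces_prod:
  assumes f: "lin f" and W: "subspace W" "\<And>w. w \<in> W \<Longrightarrow> f w \<in> W"
  shows "v \<in> W \<Longrightarrow> poly_op f (\<Prod>x\<in>#A. [:-x, 1:]) v = 0 \<Longrightarrow>
    v \<in> span (W \<inter> (\<Union>c. gen_eigenspace f c))"
proof (induction A arbitrary: v)
  case empty
  then show ?case using f by (simp add: poly_op_1 span_zero)
next
  case (add d A)
  let ?E = "W \<inter> (\<Union>c. gen_eigenspace f c)"
  let ?u = "f v - d *s v"
  have uW: "?u \<in> W" using add.prems W by (simp add: subspace_diff subspace_scale)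
  have "poly_op f (\<Prod>x\<in>#A. [:-x, 1:]) ?u = 0"
    using add.prems(2) by (simp add: poly_op_mult[OF f, symmetric] poly_op_linear[OF f, symmetric]
        mult.commute del: mult_pCons_left mult_pCons_right)
  then have "?u \<in> span ?E" using add.IH uW by blast
  then have "\<exists>w\<in>span ?E. \<exists>g\<in>W \<inter> gen_eigenspace f d. ?u = (f w - d *s w) + g"
  proof (induction rule: span_induct_alt)
    case base
    then show ?case
      by (intro bexI[of _ 0]) (auto simp: lin_0[OF f] span_zero subspace_0 W subspace_gen_eigenspace[OF f])
  next
    case (step a x y)
    obtain w g where wg: "w \<in> span ?E" "g \<in> W \<inter> gen_eigenspace f d" "y = (f w - d *s w) + g"
      using step.IH by blast
    obtain c where c: "x \<in> W" "x \<in> gen_eigenspace f c" using step.hyps by auto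
    show ?case
    proof (cases "c = d")
      case True
      have "a *s x + g \<in> W \<inter> gen_eigenspace f d"
        using c wg True W by (auto intro!: subspace_add subspace_scale subspace_gen_eigenspace[OF f])
      then show ?thesis using wg by (intro bexI[of _ w] bexI[of _ "a *s x + g"]) auto
    next
      case False
      obtain k where k: "poly_op f ([:-c, 1:] ^ k) x = 0" using c by (auto simp: gen_eigenspace_def)
      \<comment> \<open>The polynomial \<open>r\<close> inverts \<open>X - d\<close> modulo
        \<open>(X - c)^k\<close>, so \<open>?x\<close> is a preimage of \<open>x\<close> under
        \<open>f - d\<close>.\<close>
      obtain r where r: "[:-c, 1:] ^ k dvd r * [:-d, 1:] - 1"
        using poly_inverse_mod_linear_power[of "[:-d, 1:]" c] False by auto
      let ?x = "poly_op f r x"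
      have "poly_op f (r * [:-d, 1:] - 1) x = 0" using poly_op_dvd f r k by blast
      moreover have "poly_op f (r * [:-d, 1:] - 1) x = f ?x - d *s ?x - x"
        by (simp add: poly_op_diff[OF f] poly_op_1[OF f] mult.commute[of r] poly_op_mult[OF f] poly_op_linear[OF f]
            del: mult_pCons_left mult_pCons_right)
      ultimately have x: "x = f ?x - d *s ?x" by simp
      have "?x \<in> W" using poly_op_subspace f W c by blast
      moreover have "poly_op f ([:-c, 1:] ^ k) ?x = 0"
        by (simp add: poly_op_mult[OF f, symmetric] mult.commute del: mult_pCons_left mult_pCons_right)
           (simp add: poly_op_mult[OF f] k lin_0[OF poly_op_lin[OF f]])
      ultimately have "?x \<in> ?E" by (auto simp: gen_eigenspace_def)
      then have "a *s ?x + w \<in> span ?E" using wg span_base[of ?x ?E] by (intro span_add span_scale)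
      moreover have "a *s x + y = (f (a *s ?x + w) - d *s (a *s ?x + w)) + g"
        by (subst x) (simp add: wg lin_simps[OF f] scale_right_distrib scale_right_diff_distrib mult.commute)
      ultimately show ?thesis using wg by blast
    qed
  qed
  then obtain w g where wg: "w \<in> span ?E" "g \<in> W" "g \<in> gen_eigenspace f d" "?u = (f w - d *s w) + g" by auto
  have "span ?E \<subseteq> W" using W by (intro span_minimal) auto
  then have "v - w \<in> W" using wg W add.prems by (auto intro: subspace_diff)
  moreover obtain k where k: "poly_op f ([:-d, 1:] ^ k) g = 0" using wg by (auto simp: gen_eigenspace_def)
  have "poly_op f [:-d, 1:] (v - w) = g"
    using wg(4) by (simp add: poly_op_linear[OF f] lin_simps[OF f] scale_right_diff_distrib algebra_simps)
  then have "poly_op f ([:-d, 1:] ^ Suc k) (v - w) = 0"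
    using k by (simp only: power_Suc2 poly_op_mult[OF f])
  then have "v - w \<in> gen_eigenspace f d" unfolding gen_eigenspace_def by blast
  ultimately have "v - w \<in> span ?E" by (intro span_base) blast
  then have "(v - w) + w \<in> span ?E" using wg(1) by (rule span_add)
  then show ?case by simp
qed

lemma span_gen_eigenspaces:
  fixes scale :: "'k::alg_closed_field \<Rightarrow> 'v::ab_group_add \<Rightarrow> 'v"
  assumes "vector_space scale" and f: "Vector_Spaces.linear scale scale f"
    and W: "module.subspace scale W" "\<And>w. w \<in> W \<Longrightarrow> f w \<in> W"
    and p: "p \<noteq> 0" "\<And>w. w \<in> W \<Longrightarrow> vs_operators.poly_op scale f p w = 0"
  shows "W \<subseteq> module.span scale (W \<inter> (\<Union>c. vs_operators.gen_eigenspace scale f c))"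
proof
  interpret vs_operators scale using assms(1) by (simp add: vs_operators_def)
  fix v assume v: "v \<in> W"
  obtain A where "p = smult (lead_coeff p) (\<Prod>x\<in>#A. [:-x, 1:])"
    using alg_closed_imp_factorization[OF p(1)] by blast
  then have "poly_op f p v = scale (lead_coeff p) (poly_op f (\<Prod>x\<in>#A. [:-x, 1:]) v)"
    by (metis poly_op_smult f)
  then have "poly_op f (\<Prod>x\<in>#A. [:-x, 1:]) v = 0" using p v by auto
  then show "v \<in> span (W \<inter> (\<Union>c. gen_eigenspace f c))"
    using span_gen_eigenspaces_prod f W v by blast
qed


section \<open>Traces\<close>

context vs_operators
begin

text \<open>Trace of the restriction to \<open>span B\<close>, as the ambient space need not be
  finite-dimensional. Since \<open>representation\<close> is 0 outside the span, the value is
  meaningful only when \<open>f\<close> maps \<open>B\<close> into \<open>span B\<close>.\<close>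

definition tr :: "'b set \<Rightarrow> ('b \<Rightarrow> 'b) \<Rightarrow> 'a" where
  "tr B f = (\<Sum>b\<in>B. representation B (f b) b)"

lemma tr_cong: "(\<And>b. b \<in> B \<Longrightarrow> f b = g b) \<Longrightarrow> tr B f = tr B g"
  by (simp add: tr_def)

lemma tr_add:
  assumes "independent B" "\<And>b. b \<in> B \<Longrightarrow> f b \<in> span B" "\<And>b. b \<in> B \<Longrightarrow> g b \<in> span B"
  shows "tr B (\<lambda>v. f v + g v) = tr B f + tr B g"
  using assms by (simp add: tr_def representation_add sum.distrib)

lemma tr_scale:
  assumes "independent B" "\<And>b. b \<in> B \<Longrightarrow> f b \<in> span B"
  shows "tr B (\<lambda>v. c *s f v) = c * tr B f"
  using assms by (simp add: tr_def representation_scale sum_distrib_left)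

lemma tr_0: "tr B (\<lambda>v. 0) = 0"
  by (simp add: tr_def representation_zero)

lemma tr_diff:
  assumes "independent B" "\<And>b. b \<in> B \<Longrightarrow> f b \<in> span B" "\<And>b. b \<in> B \<Longrightarrow> g b \<in> span B"
  shows "tr B (\<lambda>v. f v - g v) = tr B f - tr B g"
  using assms by (simp add: tr_def representation_diff sum_subtractf)

lemma tr_diagonal:
  assumes "independent B" "\<And>b. b \<in> B \<Longrightarrow> f b = c b *s b"
  shows "tr B f = sum c B"
  using assms by (simp add: tr_def representation_scale representation_basis span_base)

lemma sum_rep_eq:
  "independent B \<Longrightarrow> finite B \<Longrightarrow> v \<in> span B \<Longrightarrow> (\<Sum>b\<in>B. representation B v b *s b) = v"
  using sum_representation_eq by blast

lemma representation_image:
  assumes "independent B" "finite B" "lin f" "\<And>c. c \<in> C \<Longrightarrow> f c \<in> span B"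
    "independent C" "finite C" "v \<in> span C"
  shows "representation B (f v) b = (\<Sum>c\<in>C. representation C v c * representation B (f c) b)"
proof -
  have "f v = f (\<Sum>c\<in>C. representation C v c *s c)" using sum_rep_eq assms by simp
  also have "\<dots> = (\<Sum>c\<in>C. representation C v c *s f c)" by (simp add: lin_simps assms(3))
  finally show ?thesis using assms
    by (simp add: representation_sum representation_scale span_scale)
qed

lemma tr_comm:
  assumes "independent B" "finite B" "lin f" "lin g"
    "\<And>v. v \<in> span B \<Longrightarrow> f v \<in> span B" "\<And>v. v \<in> span B \<Longrightarrow> g v \<in> span B"
  shows "tr B (\<lambda>v. f (g v)) = tr B (\<lambda>v. g (f v))"
proof -
  have "tr B (\<lambda>v. f (g v)) = (\<Sum>b\<in>B. \<Sum>c\<in>B. representation B (g b) c * representation B (f c) b)"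
    unfolding tr_def using assms by (intro sum.cong representation_image) (auto simp: span_base)
  also have "\<dots> = (\<Sum>b\<in>B. \<Sum>c\<in>B. representation B (f b) c * representation B (g c) b)"
    by (subst sum.swap) (simp add: mult.commute)
  also have "\<dots> = tr B (\<lambda>v. g (f v))"
    unfolding tr_def using assms
    by (intro sum.cong representation_image[symmetric]) (auto simp: span_base)
  finally show ?thesis .
qed

text \<open>The computation of \<open>tr_comm\<close> once more, with the identity, read between the
  two bases, as the second map.\<close>

lemma tr_basis_independent:
  assumes "independent B" "finite B" "independent C" "finite C" "span B = span C"
    "lin f" "\<And>v. v \<in> span B \<Longrightarrow> f v \<in> span B"
  shows "tr B f = tr C f"
proof -
  have "tr B f = (\<Sum>b\<in>B. \<Sum>c\<in>C. representation C b c * representation B (f c) b)"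
    unfolding tr_def using assms span_base
    by (intro sum.cong representation_image) auto
  also have "\<dots> = (\<Sum>c\<in>C. \<Sum>b\<in>B. representation B (f c) b * representation C b c)"
    by (subst sum.swap) (simp add: mult.commute)
  also have "\<dots> = tr C f"
    unfolding tr_def using assms span_base linI[of "\<lambda>x. x"]
    by (intro sum.cong representation_image[symmetric, where f = "\<lambda>x. x"]) auto
  finally show ?thesis .
qed

text \<open>Extend a basis \<open>C\<close> of the image \<open>U\<close> to one of the whole span.
  The added vectors are mapped into \<open>span C\<close> and contribute nothing, so the trace is
  that of \<open>f\<close> on \<open>U\<close>, which is smaller.\<close>

lemma tr_nilpotent:
  assumes "independent B" "finite B" "lin f" "\<And>v. v \<in> span B \<Longrightarrow> f v \<in> span B"
    "\<And>v. v \<in> span B \<Longrightarrow> \<exists>k. (f ^^ k) v = 0"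
  shows "tr B f = 0"
  using assms(1,2,4,5)
proof (induction "card B" arbitrary: B rule: less_induct)
  case less
  note B = less.prems
  define U where "U = f ` span B"
  have "subspace U"
    unfolding U_def using assms(3) subspace_span by (rule lin_subspace_image)
  moreover have "U \<subseteq> span B" using B(3) by (auto simp: U_def)
  ultimately have U: "subspace U" "U \<subseteq> span B" .
  obtain C where C: "C \<subseteq> U" "independent C" "U \<subseteq> span C" "card C = dim U" using basis_exists by blast
  have spC: "span C = U" using C U by (simp add: span_subspace)
  obtain D where D: "C \<subseteq> D" "D \<subseteq> span B" "independent D" "span B \<subseteq> span D"
    using maximal_independent_subset_extend[of C "span B"] C U by (metis dual_order.trans)
  have finD: "finite D" using independent_span_bound[OF B(2) D(3,2)] by auto
  have spD: "span D = span B" using D by (simp add: span_subspace)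
  have card: "card D = card B"
    using spD D(3) B(1) by (metis dim_span_eq_card_independent)
  have fC: "f v \<in> span C" if "v \<in> span B" for v using that spC by (auto simp: U_def)
  show ?case
  proof (cases "C = D")
    case True
    then have *: "f ` span B = span B" using spC spD by (simp add: U_def)
    have surj: "(f ^^ k) ` span B = span B" for k
    proof (induction k)
      case (Suc k)
      have "(f ^^ Suc k) ` span B = f ` ((f ^^ k) ` span B)" by auto
      then show ?case using Suc * by simp
    qed simp
    have "\<forall>b\<in>B. \<exists>k. (f ^^ k) b = 0" using B(4) span_base by blast
    then obtain k where k: "\<And>b. b \<in> B \<Longrightarrow> (f ^^ k b) b = 0" by metis
    \<comment> \<open>The sum of the individual exponents serves as a common one; since
      \<open>f\<close> is onto here, this vanishing power is onto too.\<close>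
    have "(f ^^ sum k B) b = 0" if "b \<in> B" for b
    proof -
      have "sum k B = (sum k B - k b) + k b" using that B(2) by (simp add: member_le_sum)
      then have "(f ^^ sum k B) b = (f ^^ (sum k B - k b)) ((f ^^ k b) b)"
        by (metis comp_apply funpow_add)
      then show ?thesis using k that by (simp add: lin_0 lin_funpow assms(3))
    qed
    then have "(f ^^ sum k B) v = 0" if "v \<in> span B" for v
      using lin_eq_0_span[OF lin_funpow[OF assms(3)]] that by blast
    then have "span B \<subseteq> {0}" using surj[of "sum k B"] by auto
    then have "B = {}" using B(1) span_base dependent_zero by blast
    then show ?thesis by (simp add: tr_def)
  next
    case False
    then have lt: "card C < card B" using D finD card by (metis psubsetI psubset_card_mono)
    have finC: "finite C" using finD D finite_subset by blast
    have nz: "b \<notin> C \<Longrightarrow> representation C v b = 0" for v b using representation_ne_zero by metis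
    have CB: "v \<in> span C \<Longrightarrow> v \<in> span B" for v using spC U by blast
    have "tr B f = tr D f" using tr_basis_independent B D finD spD assms(3) by blast
    also have "\<dots> = (\<Sum>b\<in>D. representation C (f b) b)"
      unfolding tr_def using D fC spD span_base
      by (intro sum.cong refl, subst representation_extend[OF D(3) _ D(1)]) blast+
    also have "\<dots> = tr C f"
      unfolding tr_def using D finD by (intro sum.mono_neutral_right) (auto intro: nz)
    also have "\<dots> = 0"
      using less.hyps[OF lt C(2) finC] fC CB B(4) by blast
    finally show ?thesis .
  qed
qed

end

section \<open>Lie algebras with finite-dimensional derived algebra\<close>

text \<open>Brackets take values in the span of a finite set, while the ambient type may be
  infinite-dimensional: the scalar extension of a Lie algebra has no type of its own and lives
  in a function space.\<close>

locale fd_lie_algebra = vs_operators scale + lie_algebra scale bracket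
  for scale :: "'a::field \<Rightarrow> 'b::ab_group_add \<Rightarrow> 'b" (infixr "*s" 75)
    and bracket :: "'b \<Rightarrow> 'b \<Rightarrow> 'b" (infixl "\<bullet>" 70) +
  fixes Bs :: "'b set"
  assumes finite_Bs: "finite Bs" and independent_Bs: "independent Bs"
    and bracket_in_span: "x \<bullet> y \<in> span Bs"
begin

lemma lin_bracket: "lin (bracket x)"
  by (rule linI) (simp_all add: bracket_add_right bracket_scale_right)

lemma lin_bracket_left: "lin (\<lambda>x. x \<bullet> y)"
  by (rule linI) (simp_all add: bracket_add_left bracket_scale_left)

lemmas bracket_simps =
  lin_simps[OF lin_bracket] lin_simps[OF lin_bracket_left]

lemma bracket_anti: "y \<bullet> x = - (x \<bullet> y)"
proof -
  have "0 = (x + y) \<bullet> (x + y)" by (simp only: bracket_self)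
  also have "\<dots> = y \<bullet> x + x \<bullet> y" unfolding bracket_add_left bracket_add_right by (simp add: bracket_self)
  finally show ?thesis by (simp add: eq_neg_iff_add_eq_0)
qed

lemma bracket_leibniz: "x \<bullet> (y \<bullet> z) = (x \<bullet> y) \<bullet> z + y \<bullet> (x \<bullet> z)"
proof -
  have "x \<bullet> (y \<bullet> z) = - (y \<bullet> (z \<bullet> x)) - z \<bullet> (x \<bullet> y)"
    using jacobi[of x y z] by (metis add.assoc add_eq_0_iff2 diff_conv_add_uminus minus_add_distrib)
  also have "\<dots> = (x \<bullet> y) \<bullet> z + y \<bullet> (x \<bullet> z)"
    by (simp add: bracket_anti[of z x] bracket_anti[of z "x \<bullet> y"] bracket_simps)
  finally show ?thesis .
qed

lemma bracket_bracket_left: "(x \<bullet> y) \<bullet> z = x \<bullet> (y \<bullet> z) - y \<bullet> (x \<bullet> z)"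
  by (simp add: bracket_leibniz[of x y z])

definition killing :: "'b \<Rightarrow> 'b \<Rightarrow> 'a" where
  "killing x y = tr Bs (\<lambda>v. x \<bullet> (y \<bullet> v))"

lemma killing_sym: "killing x y = killing y x"
  unfolding killing_def
  by (rule tr_comm[OF independent_Bs finite_Bs lin_bracket lin_bracket bracket_in_span bracket_in_span])

lemma killing_add_left: "killing (x + y) z = killing x z + killing y z"
  unfolding killing_def by (simp only: bracket_simps tr_add[OF independent_Bs bracket_in_span bracket_in_span])

lemma killing_scale_left: "killing (c *s x) z = c * killing x z"
  unfolding killing_def by (simp only: bracket_simps tr_scale[OF independent_Bs bracket_in_span])

lemma killing_add_right: "killing z (x + y) = killing z x + killing z y"
  by (metis killing_sym killing_add_left)

lemma killing_scale_right: "killing z (c *s x) = c * killing z x"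
  by (metis killing_sym killing_scale_left)

lemma killing_0: "killing 0 z = 0" "killing z 0 = 0"
  using killing_scale_left[of 0 0 z] killing_scale_right[of z 0 0] by simp_all

lemma killing_neg: "killing (- x) z = - killing x z" "killing z (- x) = - killing z x"
  using killing_scale_left[of "-1" x z] killing_scale_right[of z "-1" x] by simp_all

lemma killing_diff: "killing (x - y) z = killing x z - killing y z" "killing z (x - y) = killing z x - killing z y"
  using killing_add_left[of x "- y" z] killing_add_right[of z x "- y"] by (simp_all add: killing_neg)

lemma killing_sum: "killing (sum f A) z = (\<Sum>a\<in>A. killing (f a) z)" "killing z (sum f A) = (\<Sum>a\<in>A. killing z (f a))"
  by (induction A rule: infinite_finite_induct) (simp_all add: killing_0 killing_add_left killing_add_right)

lemmas killing_simps = killing_0 killing_add_left killing_add_right killing_scale_left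
  killing_scale_right killing_neg killing_diff killing_sum

lemma killing_eq_0_span:
  assumes "\<And>b. b \<in> S \<Longrightarrow> killing a b = 0" "v \<in> span S"
  shows "killing a v = 0"
  using assms(2,1) by (induction v rule: span_induct_alt) (simp_all add: killing_simps)

lemma killing_invariant: "killing (x \<bullet> y) z = killing x (y \<bullet> z)"
proof -
  have "killing (x \<bullet> y) z = tr Bs (\<lambda>v. x \<bullet> (y \<bullet> (z \<bullet> v))) - tr Bs (\<lambda>v. y \<bullet> (x \<bullet> (z \<bullet> v)))"
    unfolding killing_def
    by (simp only: bracket_bracket_left tr_diff[OF independent_Bs bracket_in_span bracket_in_span])
  also have "tr Bs (\<lambda>v. y \<bullet> (x \<bullet> (z \<bullet> v))) = tr Bs (\<lambda>v. x \<bullet> (z \<bullet> (y \<bullet> v)))"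
    by (rule tr_comm[OF independent_Bs finite_Bs lin_bracket lin_comp[OF lin_bracket lin_bracket]
          bracket_in_span bracket_in_span])
  also have "tr Bs (\<lambda>v. x \<bullet> (y \<bullet> (z \<bullet> v))) - \<dots> = killing x (y \<bullet> z)"
    unfolding killing_def
    by (simp only: bracket_bracket_left bracket_simps tr_diff[OF independent_Bs bracket_in_span bracket_in_span])
  finally show ?thesis .
qed

text \<open>\<open>(ad x - c - d) [a, b] = [(ad x - c) a, b] + [a, (ad x - d) b]\<close>, so
  induction on the sum of the two exponents applies.\<close>

lemma gen_eigenspace_bracket:
  assumes "a \<in> gen_eigenspace (bracket x) c" "b \<in> gen_eigenspace (bracket x) d"
  shows "a \<bullet> b \<in> gen_eigenspace (bracket x) (c + d)"
proof -
  let ?X = "bracket x" and ?F = "\<lambda>c v. x \<bullet> v - c *s v"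
  have "(?F c ^^ k) a = 0 \<Longrightarrow> (?F d ^^ l) b = 0 \<Longrightarrow> a \<bullet> b \<in> gen_eigenspace ?X (c + d)" for k l a b
  proof (induction "k + l" arbitrary: k l a b)
    case 0
    then show ?case by (simp add: bracket_simps subspace_0 subspace_gen_eigenspace lin_bracket)
  next
    case (Suc n)
    show ?case
    proof (cases "k = 0 \<or> l = 0")
      case True
      then have "a \<bullet> b = 0" using Suc.prems by (auto simp: bracket_simps)
      then show ?thesis by (simp add: subspace_0 subspace_gen_eigenspace lin_bracket)
    next
      case False
      then obtain k' l' where kl: "k = Suc k'" "l = Suc l'" by (metis not0_implies_Suc)
      have "?F c a \<bullet> b \<in> gen_eigenspace ?X (c + d)"
        using Suc.hyps(1)[of k' l "?F c a" b] Suc.hyps(2) Suc.prems kl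
        by (simp add: funpow_Suc_right del: funpow.simps)
      moreover have "a \<bullet> ?F d b \<in> gen_eigenspace ?X (c + d)"
        using Suc.hyps(1)[of k l' a "?F d b"] Suc.hyps(2) Suc.prems kl
        by (simp add: funpow_Suc_right del: funpow.simps)
      ultimately have "?F c a \<bullet> b + a \<bullet> ?F d b \<in> gen_eigenspace ?X (c + d)"
        by (intro subspace_add subspace_gen_eigenspace lin_bracket)
      also have "?F c a \<bullet> b + a \<bullet> ?F d b = x \<bullet> (a \<bullet> b) - (c + d) *s (a \<bullet> b)"
        by (simp add: bracket_simps bracket_leibniz[of x a b] scale_left_distrib)
      finally show ?thesis by (rule gen_eigenspaceI_step[OF lin_bracket])
    qed
  qed
  then show ?thesis
    using assms by (auto simp: gen_eigenspace_def[of _ c] gen_eigenspace_def[of _ d] poly_op_linear_power lin_bracket)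
qed

lemma trace_of_nilpotent:
  "lin f \<Longrightarrow> (\<And>v. v \<in> span Bs \<Longrightarrow> f v \<in> span Bs) \<Longrightarrow> (\<And>v. v \<in> span Bs \<Longrightarrow> \<exists>k. (f ^^ k) v = 0) \<Longrightarrow> tr Bs f = 0"
  by (rule tr_nilpotent[OF independent_Bs finite_Bs])

text \<open>\<open>ad z\<close> and \<open>ad h\<close> commute, so their product inherits
  nilpotency from \<open>ad z\<close>.\<close>

lemma killing_nilpotent_commuting:
  assumes "\<And>v. v \<in> span Bs \<Longrightarrow> \<exists>k. (bracket z ^^ k) v = 0" "z \<bullet> h = 0"
  shows "killing z h = 0"
  unfolding killing_def
proof (rule trace_of_nilpotent)
  fix v assume v: "v \<in> span Bs"
  have comm: "h \<bullet> (z \<bullet> w) = z \<bullet> (h \<bullet> w)" for w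
    using bracket_leibniz[of z h w] assms(2) by (simp add: bracket_simps)
  have pw: "h \<bullet> (bracket z ^^ k) w = (bracket z ^^ k) (h \<bullet> w)" for k w
    by (induction k) (simp_all add: comm)
  have pw': "(bracket h ^^ k) (z \<bullet> w) = z \<bullet> (bracket h ^^ k) w" for k w
    by (induction k) (simp_all add: comm)
  have "((\<lambda>v. z \<bullet> (h \<bullet> v)) ^^ k) v = (bracket h ^^ k) ((bracket z ^^ k) v)" for k
    by (induction k) (simp_all add: pw' comm)
  then show "\<exists>k. ((\<lambda>v. z \<bullet> (h \<bullet> v)) ^^ k) v = 0"
    using assms(1)[OF v] by (metis lin_funpow lin_0 lin_bracket)
qed (auto intro: lin_comp lin_bracket bracket_in_span)

end

text \<open>The scalars form a rational vector space, in which a functional detects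
  \<open>d\<close>. Rational values matter in Cartan's criterion, where a vanishing sum of squares
  must vanish termwise.\<close>

lemma rational_functional:
  fixes d :: "'c::field_char_0"
  assumes "d \<noteq> 0"
  obtains \<phi> :: "'c \<Rightarrow> rat" where "\<And>a b. \<phi> (a + b) = \<phi> a + \<phi> b"
    "\<And>q a. \<phi> (of_rat q * a) = q * \<phi> a" "\<phi> d = 1"
proof -
  let ?s = "\<lambda>(q::rat) (a::'c). of_rat q * a"
  interpret Q: vector_space_pair ?s "(*)"
    by unfold_locales (auto simp: algebra_simps of_rat_add of_rat_mult)
  have "Q.vs1.independent {d}" using assms by simp
  then obtain \<phi> where "Vector_Spaces.linear ?s (*) \<phi>" "\<phi> d = 1"
    using Q.linear_independent_extend[of "{d}" "\<lambda>_. 1"] by auto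
  then show ?thesis using that[of \<phi>] by (simp add: Vector_Spaces.linear_iff)
qed

section \<open>Replicas of inner derivations\<close>

locale ac_lie_algebra = fd_lie_algebra scale bracket Bs
  for scale :: "'a::{alg_closed_field, field_char_0} \<Rightarrow> 'b::ab_group_add \<Rightarrow> 'b" (infixr "*s" 75)
    and bracket :: "'b \<Rightarrow> 'b \<Rightarrow> 'b" (infixl "\<bullet>" 70) and Bs
begin

lemma span_gen_eigen:
  assumes "lin f" "\<And>v. v \<in> span Bs \<Longrightarrow> f v \<in> span Bs"
    "subspace W" "W \<subseteq> span Bs" "\<And>w. w \<in> W \<Longrightarrow> f w \<in> W"
  shows "W \<subseteq> span (W \<inter> (\<Union>c. gen_eigenspace f c))"
proof -
  obtain p where "p \<noteq> 0" "\<And>v. v \<in> span Bs \<Longrightarrow> poly_op f p v = 0"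
    using poly_op_annihilates[OF assms(1) finite_Bs assms(2)] by blast
  then show ?thesis
    using span_gen_eigenspaces[OF vector_space_axioms assms(1,3,5)] assms(4) by blast
qed

text \<open>A replica multiplies the generalised eigenspace for \<open>c\<close> by
  \<open>\<phi> c\<close>. Brackets add eigenvalues, so additivity of \<open>\<phi>\<close> is the
  Leibniz rule on generalised eigenvectors, and bilinearity does the rest.\<close>

lemma replica_derivation:
  fixes \<phi> :: "'a \<Rightarrow> 'a"
  assumes \<phi>: "\<And>c d. \<phi> (c + d) = \<phi> c + \<phi> d"
  obtains q where "poly q 0 = 0"
    "\<And>v c. v \<in> span Bs \<Longrightarrow> v \<in> gen_eigenspace (bracket x) c \<Longrightarrow> poly_op (bracket x) q v = \<phi> c *s v"
    "\<And>a b. a \<in> span Bs \<Longrightarrow> b \<in> span Bs \<Longrightarrow>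
      poly_op (bracket x) q (a \<bullet> b) = poly_op (bracket x) q a \<bullet> b + a \<bullet> poly_op (bracket x) q b"
proof -
  obtain p where p: "p \<noteq> 0" "\<And>v. v \<in> span Bs \<Longrightarrow> poly_op (bracket x) p v = 0"
    using poly_op_annihilates[OF lin_bracket finite_Bs bracket_in_span] by blast
  obtain q where q: "poly q 0 = \<phi> 0"
    "\<And>v c. poly_op (bracket x) p v = 0 \<Longrightarrow> v \<in> gen_eigenspace (bracket x) c \<Longrightarrow> poly_op (bracket x) q v = \<phi> c *s v"
    using poly_op_replica[OF lin_bracket p(1)] by metis
  let ?y = "poly_op (bracket x) q" and ?S = "span Bs \<inter> (\<Union>c. gen_eigenspace (bracket x) c)"
  have y: "lin ?y" by (rule poly_op_lin[OF lin_bracket])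
  have S: "span Bs \<subseteq> span ?S" by (rule span_gen_eigen) (auto intro: lin_bracket bracket_in_span)
  have base: "?y (a \<bullet> b) = ?y a \<bullet> b + a \<bullet> ?y b" if "a \<in> ?S" "b \<in> ?S" for a b
  proof -
    obtain c d where cd: "a \<in> gen_eigenspace (bracket x) c" "b \<in> gen_eigenspace (bracket x) d"
      using \<open>a \<in> ?S\<close> \<open>b \<in> ?S\<close> by auto
    then show ?thesis
      using that gen_eigenspace_bracket[OF cd] p(2) bracket_in_span[of a b]
      by (simp add: q(2)[of _ c] q(2)[of _ d] q(2)[of _ "c + d"] \<phi> bracket_simps scale_left_distrib)
  qed
  have "?y (a \<bullet> b) - ?y a \<bullet> b - a \<bullet> ?y b = 0" if a: "a \<in> ?S" and b: "b \<in> span ?S" for a b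
  proof (rule lin_eq_0_span[OF _ _ b, where f = "\<lambda>b. ?y (a \<bullet> b) - ?y a \<bullet> b - a \<bullet> ?y b"])
    show "lin (\<lambda>b. ?y (a \<bullet> b) - ?y a \<bullet> b - a \<bullet> ?y b)"
      by (rule linI) (simp_all add: lin_simps[OF y] bracket_simps scale_right_diff_distrib)
  qed (use base[OF a] in simp)
  then have "?y (a \<bullet> b) - ?y a \<bullet> b - a \<bullet> ?y b = 0" if a: "a \<in> span ?S" and b: "b \<in> span ?S" for a b
  proof (intro lin_eq_0_span[OF _ _ a, where f = "\<lambda>a. ?y (a \<bullet> b) - ?y a \<bullet> b - a \<bullet> ?y b"])
    show "lin (\<lambda>a. ?y (a \<bullet> b) - ?y a \<bullet> b - a \<bullet> ?y b)"
      by (rule linI) (simp_all add: lin_simps[OF y] bracket_simps scale_right_diff_distrib)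
  qed (use b in simp)
  then have "?y (a \<bullet> b) - ?y a \<bullet> b - a \<bullet> ?y b = 0" if "a \<in> span Bs" "b \<in> span Bs" for a b
    using that S by blast
  then have "?y (a \<bullet> b) = ?y a \<bullet> b + a \<bullet> ?y b" if "a \<in> span Bs" "b \<in> span Bs" for a b
    using that by (simp add: diff_diff_eq)
  moreover have "\<phi> 0 = 0" using \<phi>[of 0 0] by simp
  ultimately show ?thesis using q p that by auto
qed

text \<open>Cartan's criterion: test \<open>ad x\<close> against its replicas \<open>y\<close> for the rational functionals of the
  spectrum; \<open>tr (ad x \<circ> y)\<close> vanishes by hypothesis and is a sum of squares after applying the functional.\<close>

lemma cartan_nilpotency:
  assumes x: "x \<in> span {a \<bullet> b | a b. (a, b) \<in> M}"
    and M: "\<And>a b. (a, b) \<in> M \<Longrightarrow> b \<in> span Bs"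
    and \<kappa>: "\<And>a b k. (a, b) \<in> M \<Longrightarrow> k \<ge> 1 \<Longrightarrow> killing a ((bracket x ^^ k) b) = 0"
    and v: "v \<in> span Bs"
  shows "\<exists>k. (bracket x ^^ k) v = 0"
proof -
  let ?X = "bracket x" and ?S = "span Bs \<inter> (\<Union>c. gen_eigenspace (bracket x) c)"
  obtain C where C: "C \<subseteq> ?S" "independent C" "?S \<subseteq> span C"
    by (rule basis_exists[of ?S])
  have S: "span Bs \<subseteq> span ?S" by (rule span_gen_eigen) (auto intro: lin_bracket bracket_in_span)
  have spC: "span C = span Bs"
  proof (rule antisym)
    show "span C \<subseteq> span Bs" using C(1) by (intro span_minimal) auto
    have "span ?S \<subseteq> span C" using C(3) by (intro span_minimal) auto
    then show "span Bs \<subseteq> span C" using S by (rule order_trans[rotated])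
  qed
  have finC: "finite C" using independent_span_bound[OF finite_Bs C(2)] C(1) by auto
  obtain ev where ev: "\<And>b. b \<in> C \<Longrightarrow> b \<in> gen_eigenspace ?X (ev b)"
  proof -
    have "\<forall>b\<in>C. \<exists>c. b \<in> gen_eigenspace ?X c" using C(1) by auto
    then show ?thesis using that bchoice[of C "\<lambda>b c. b \<in> gen_eigenspace ?X c"] by auto
  qed
  have CB: "b \<in> C \<Longrightarrow> b \<in> span Bs" for b using C(1) by auto
  have ev0: "ev d = 0" if d: "d \<in> C" for d
  proof (rule ccontr)
    assume "ev d \<noteq> 0"
    then obtain \<phi> :: "'a \<Rightarrow> rat" where \<phi>: "\<And>a b. \<phi> (a + b) = \<phi> a + \<phi> b"
      "\<And>q a. \<phi> (of_rat q * a) = q * \<phi> a" "\<phi> (ev d) = 1" using rational_functional by blast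
    obtain q where q: "poly q 0 = 0"
      "\<And>v c. v \<in> span Bs \<Longrightarrow> v \<in> gen_eigenspace ?X c \<Longrightarrow> poly_op ?X q v = of_rat (\<phi> c) *s v"
      "\<And>a b. a \<in> span Bs \<Longrightarrow> b \<in> span Bs \<Longrightarrow> poly_op ?X q (a \<bullet> b) = poly_op ?X q a \<bullet> b + a \<bullet> poly_op ?X q b"
      by (rule replica_derivation[of "\<lambda>c. of_rat (\<phi> c)" x]) (use \<phi>(1) in \<open>auto simp: of_rat_add\<close>)
    \<comment> \<open>The replica for the identity function: \<open>s\<close> below is the
      semisimple part of \<open>ad x\<close>.\<close>
    obtain r where r: "poly r 0 = 0"
      "\<And>v c. v \<in> span Bs \<Longrightarrow> v \<in> gen_eigenspace ?X c \<Longrightarrow> poly_op ?X r v = c *s v"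
      by (rule replica_derivation[of "\<lambda>c. c" x]) auto
    define y where "y = poly_op ?X q"
    define s where "s = poly_op ?X r"
    have y: "lin y" and s: "lin s" by (auto simp: y_def s_def poly_op_lin lin_bracket)
    have yB: "y v \<in> span Bs" and sB: "s v \<in> span Bs" if "v \<in> span Bs" for v
      unfolding y_def s_def by (rule poly_op_subspace[OF lin_bracket subspace_span bracket_in_span that])+
    \<comment> \<open>\<open>tr (ad [a, b] y) = tr (ad a [ad b, y]) = - \<kappa>(a, y b)\<close>
      because \<open>y\<close> is a derivation, and \<open>y b\<close> is a combination of the
      \<open>(ad x)^k b\<close> with \<open>k \<ge> 1\<close>.\<close>
    have gen0: "tr Bs (\<lambda>v. (a \<bullet> b) \<bullet> y v) = 0" if ab: "(a, b) \<in> M" for a b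
    proof -
      have "tr Bs (\<lambda>v. (a \<bullet> b) \<bullet> y v) = tr Bs (\<lambda>v. a \<bullet> (b \<bullet> y v)) - tr Bs (\<lambda>v. b \<bullet> (a \<bullet> y v))"
        by (simp only: bracket_bracket_left tr_diff[OF independent_Bs bracket_in_span bracket_in_span])
      also have "tr Bs (\<lambda>v. b \<bullet> (a \<bullet> y v)) = tr Bs (\<lambda>v. a \<bullet> y (b \<bullet> v))"
        by (rule tr_comm[OF independent_Bs finite_Bs lin_bracket lin_comp[OF lin_bracket y]
              bracket_in_span bracket_in_span])
      also have "tr Bs (\<lambda>v. a \<bullet> (b \<bullet> y v)) - \<dots> = tr Bs (\<lambda>v. a \<bullet> (b \<bullet> y v) - a \<bullet> y (b \<bullet> v))"
        by (simp only: tr_diff[OF independent_Bs bracket_in_span bracket_in_span])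
      also have "\<dots> = tr Bs (\<lambda>v. (- 1) *s (a \<bullet> (y b \<bullet> v)))"
        by (rule tr_cong) (simp add: q(3)[folded y_def] M[OF ab] span_base bracket_simps)
      also have "\<dots> = - killing a (y b)"
        unfolding killing_def by (subst tr_scale[OF independent_Bs bracket_in_span]) simp
      also have "killing a (y b) = 0"
        by (rule killing_eq_0_span[OF _ poly_op_in_powers_span[OF lin_bracket q(1), of x b, folded y_def]])
           (use \<kappa>[OF ab] in auto)
      finally show ?thesis by simp
    qed
    have "tr Bs (\<lambda>v. z \<bullet> y v) = 0" if "z \<in> span {a \<bullet> b | a b. (a, b) \<in> M}" for z
      using that
    proof (induction rule: span_induct_alt)
      case (step c u z)
      have "tr Bs (\<lambda>v. (c *s u + z) \<bullet> y v) = c * tr Bs (\<lambda>v. u \<bullet> y v) + tr Bs (\<lambda>v. z \<bullet> y v)"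
        by (simp only: bracket_simps tr_add[OF independent_Bs span_scale[OF bracket_in_span] bracket_in_span]
            tr_scale[OF independent_Bs bracket_in_span])
      then show ?case using step gen0 by auto
    qed (simp add: bracket_simps tr_0)
    then have "0 = tr Bs (\<lambda>v. x \<bullet> y v)" using x by simp
    also have "\<dots> = tr C (\<lambda>v. x \<bullet> y v)"
      by (rule tr_basis_independent[OF independent_Bs finite_Bs C(2) finC spC[symmetric]
            lin_comp[OF lin_bracket y] bracket_in_span])
    \<comment> \<open>In the basis \<open>C\<close> of generalised eigenvectors \<open>s y\<close>
      is diagonal, and the remainder is nilpotent.\<close>
    also have "\<dots> = tr C (\<lambda>v. s (y v) + (x \<bullet> y v - s (y v)))" by simp
    also have "\<dots> = tr C (\<lambda>v. s (y v)) + tr C (\<lambda>v. x \<bullet> y v - s (y v))"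
      by (rule tr_add[OF C(2)]) (auto simp: spC span_base CB yB sB bracket_in_span intro: span_diff)
    also have "tr C (\<lambda>v. x \<bullet> y v - s (y v)) = 0"
    proof (rule tr_nilpotent[OF C(2) finC])
      let ?n = "\<lambda>v. x \<bullet> y v - s (y v)"
      show n: "lin ?n"
        by (rule linI) (simp_all add: lin_simps[OF y] lin_simps[OF s] bracket_simps scale_right_diff_distrib)
      show "?n v \<in> span C" if "v \<in> span C" for v
        using that by (simp add: spC yB sB bracket_in_span span_diff)
      \<comment> \<open>On the generalised eigenspace for \<open>c\<close> the remainder acts as
        \<open>\<phi> c\<close> times \<open>ad x - c\<close>.\<close>
      have nk: "(?n ^^ k) b = (of_rat (\<phi> c)) ^ k *s ((\<lambda>v. x \<bullet> v - c *s v) ^^ k) b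
          \<and> ((\<lambda>v. x \<bullet> v - c *s v) ^^ k) b \<in> span Bs \<inter> gen_eigenspace ?X c"
        if "b \<in> span Bs" "b \<in> gen_eigenspace ?X c" for b c k
      proof (induction k)
        case (Suc k)
        let ?b = "((\<lambda>v. x \<bullet> v - c *s v) ^^ k) b"
        have b: "?b \<in> span Bs" "?b \<in> gen_eigenspace ?X c" using Suc by auto
        have "y ?b = of_rat (\<phi> c) *s ?b" "s ?b = c *s ?b"
          using q(2)[OF b] r(2)[OF b] by (simp_all add: y_def s_def)
        then have "?n ?b = of_rat (\<phi> c) *s (x \<bullet> ?b - c *s ?b)"
          by (simp add: bracket_simps lin_scale[OF s] scale_right_diff_distrib)
        then have "?n (of_rat (\<phi> c) ^ k *s ?b) = of_rat (\<phi> c) ^ Suc k *s (x \<bullet> ?b - c *s ?b)"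
          by (simp add: lin_scale[OF n] mult.commute)
        then show ?case using Suc gen_eigenspace_step[OF lin_bracket b(2)] b(1)
          by (simp add: span_diff span_scale bracket_in_span)
      qed (use that in auto)
      have "C \<subseteq> gen_eigenspace ?n 0"
      proof
        fix b assume b: "b \<in> C"
        obtain k where "((\<lambda>v. x \<bullet> v - ev b *s v) ^^ k) b = 0"
          using ev[OF b] by (auto simp: gen_eigenspace_def poly_op_linear_power lin_bracket)
        then have "(?n ^^ k) b = 0" using nk[OF CB[OF b] ev[OF b], of k] by simp
        then show "b \<in> gen_eigenspace ?n 0" using gen_eigenspace_0_iff[OF n] by blast
      qed
      then have "span C \<subseteq> gen_eigenspace ?n 0" by (rule span_minimal) (rule subspace_gen_eigenspace[OF n])
      then show "\<exists>k. (?n ^^ k) v = 0" if "v \<in> span C" for v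
        using that gen_eigenspace_0_iff[OF n] by blast
    qed
    also have "tr C (\<lambda>v. s (y v)) = (\<Sum>b\<in>C. of_rat (\<phi> (ev b)) * ev b)"
      using q(2)[OF CB ev] r(2)[OF CB ev]
      by (intro tr_diagonal[OF C(2)]) (simp add: y_def[symmetric] s_def[symmetric] lin_scale[OF s])
    finally have "0 = \<phi> (\<Sum>b\<in>C. of_rat (\<phi> (ev b)) * ev b)" using \<phi>(2)[of 0 0] by simp
    also have "\<dots> = (\<Sum>b\<in>C. \<phi> (ev b) ^ 2)"
    proof -
      have "\<phi> (sum g C) = (\<Sum>b\<in>C. \<phi> (g b))" for g
        using \<phi>(2)[of 0 0] by (induction C rule: infinite_finite_induct) (auto simp: \<phi>(1))
      then show ?thesis by (simp add: \<phi>(2) power2_eq_square)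
    qed
    finally have "\<phi> (ev d) ^ 2 = 0" using finC d by (metis (mono_tags, lifting) sum_nonneg_eq_0_iff zero_le_power2)
    then show False using \<phi>(3) by simp
  qed
  have "C \<subseteq> gen_eigenspace ?X 0"
  proof
    fix b assume "b \<in> C"
    then show "b \<in> gen_eigenspace ?X 0" using ev[of b] ev0[of b] by simp
  qed
  then have "span C \<subseteq> gen_eigenspace ?X 0" by (rule span_minimal) (rule subspace_gen_eigenspace[OF lin_bracket])
  then show ?thesis using v spC gen_eigenspace_0_iff[OF lin_bracket] by blast
qed

end

section \<open>Nondegenerate Killing form\<close>

text \<open>Nondegeneracy is given as data, a dual basis, rather than as injectivity: embedding the
  same dual basis proves it for the scalar extension.\<close>

locale nd_lie_algebra = fd_lie_algebra scale bracket Bs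
  for scale :: "'a::field \<Rightarrow> 'b::ab_group_add \<Rightarrow> 'b" (infixr "*s" 75)
    and bracket :: "'b \<Rightarrow> 'b \<Rightarrow> 'b" (infixl "\<bullet>" 70) and Bs +
  fixes dual :: "'b \<Rightarrow> 'b"
  assumes dual_in_span: "b \<in> Bs \<Longrightarrow> dual b \<in> span Bs"
    and killing_dual: "b \<in> Bs \<Longrightarrow> c \<in> Bs \<Longrightarrow> killing (dual b) c = (if b = c then 1 else 0)"
begin

lemma killing_dual_coord:
  assumes "v \<in> span Bs" "b \<in> Bs"
  shows "killing (dual b) v = representation Bs v b"
proof -
  have "killing (dual b) v = killing (dual b) (\<Sum>c\<in>Bs. representation Bs v c *s c)"
    using sum_rep_eq[OF independent_Bs finite_Bs assms(1)] by simp
  also have "\<dots> = (\<Sum>c\<in>Bs. representation Bs v c * killing (dual b) c)" by (simp add: killing_simps)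
  also have "\<dots> = (\<Sum>c\<in>Bs. if c = b then representation Bs v c else 0)"
    using assms(2) by (intro sum.cong) (auto simp: killing_dual)
  also have "\<dots> = representation Bs v b" using assms finite_Bs by simp
  finally show ?thesis .
qed

lemma killing_nondegenerate:
  assumes "v \<in> span Bs" "\<And>w. w \<in> span Bs \<Longrightarrow> killing v w = 0"
  shows "v = 0"
proof -
  have "representation Bs v b = 0" if "b \<in> Bs" for b
    using killing_dual_coord[OF assms(1) that] assms(2)[OF dual_in_span[OF that]] by (simp add: killing_sym)
  then show ?thesis using sum_rep_eq[OF independent_Bs finite_Bs assms(1)] by simp
qed

lemma killing_represents:
  fixes f :: "'b \<Rightarrow> 'a"
  assumes "\<And>u v. u \<in> span Bs \<Longrightarrow> v \<in> span Bs \<Longrightarrow> f (u + v) = f u + f v"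
    "\<And>c v. v \<in> span Bs \<Longrightarrow> f (c *s v) = c * f v"
  obtains d where "d \<in> span Bs" "\<And>v. v \<in> span Bs \<Longrightarrow> killing d v = f v"
proof
  let ?d = "\<Sum>b\<in>Bs. f b *s dual b"
  show "?d \<in> span Bs" by (intro span_sum span_scale dual_in_span)
  fix v assume v: "v \<in> span Bs"
  have f0: "f 0 = 0" using assms(2)[of 0 0] span_zero by simp
  have fsum: "f (\<Sum>b\<in>A. g b) = (\<Sum>b\<in>A. f (g b))" if "\<And>b. b \<in> A \<Longrightarrow> g b \<in> span Bs" for A and g :: "'b \<Rightarrow> 'b"
    using that by (induction A rule: infinite_finite_induct) (auto simp: f0 assms(1) span_sum)
  have "killing ?d v = (\<Sum>b\<in>Bs. f b * representation Bs v b)"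
    using v by (simp add: killing_simps killing_dual_coord)
  also have "\<dots> = (\<Sum>b\<in>Bs. f (representation Bs v b *s b))"
    by (intro sum.cong) (auto simp: assms(2) span_base)
  also have "\<dots> = f (\<Sum>b\<in>Bs. representation Bs v b *s b)" by (simp add: fsum span_base span_scale)
  also have "\<dots> = f v" using sum_rep_eq[OF independent_Bs finite_Bs v] by simp
  finally show "killing ?d v = f v" .
qed

lemma centre_trivial:
  assumes "z \<in> span Bs" "\<And>v. v \<in> span Bs \<Longrightarrow> z \<bullet> v = 0"
  shows "z = 0"
proof (rule killing_nondegenerate[OF assms(1)])
  fix w show "killing z w = 0"
    unfolding killing_def by (subst tr_cong[of _ _ "\<lambda>_. 0"]) (simp_all add: assms(2) bracket_in_span tr_0)
qed

text \<open>Choose \<open>d\<close> with \<open>\<kappa>(d, y) = tr (D ad y)\<close>. Then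
  \<open>E = D - ad d\<close> is a derivation with \<open>tr (E ad y) = 0\<close> for all
  \<open>y\<close>, and \<open>\<kappa>(E a, b) = tr ([E, ad a] ad b) = tr (E ad [a, b]) =
  0\<close>.\<close>

lemma derivation_inner:
  assumes D: "lin D" "\<And>v. v \<in> span Bs \<Longrightarrow> D v \<in> span Bs"
    "\<And>a b. a \<in> span Bs \<Longrightarrow> b \<in> span Bs \<Longrightarrow> D (a \<bullet> b) = D a \<bullet> b + a \<bullet> D b"
  obtains d where "d \<in> span Bs" "\<And>v. v \<in> span Bs \<Longrightarrow> D v = d \<bullet> v"
proof -
  define f where "f = (\<lambda>y. tr Bs (\<lambda>v. D (y \<bullet> v)))"
  have DB: "D (a \<bullet> b) \<in> span Bs" for a b by (intro D(2) bracket_in_span)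
  obtain d where d: "d \<in> span Bs" "\<And>v. v \<in> span Bs \<Longrightarrow> killing d v = f v"
  proof (rule killing_represents[of f])
    show "f (u + v) = f u + f v" for u v
      unfolding f_def by (simp only: bracket_simps lin_simps[OF D(1)] tr_add[OF independent_Bs DB DB])
    show "f (c *s v) = c * f v" for c v
      unfolding f_def by (simp only: bracket_simps lin_simps[OF D(1)] tr_scale[OF independent_Bs DB])
  qed blast
  let ?E = "\<lambda>v. D v - d \<bullet> v"
  have E: "lin ?E" by (rule linI) (simp_all add: lin_simps[OF D(1)] bracket_simps scale_right_diff_distrib)
  have EB: "v \<in> span Bs \<Longrightarrow> ?E v \<in> span Bs" for v by (intro span_diff D(2) bracket_in_span)
  have Eder: "?E (a \<bullet> b) = ?E a \<bullet> b + a \<bullet> ?E b" if "a \<in> span Bs" "b \<in> span Bs" for a b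
    using that by (simp add: D(3) bracket_leibniz[of d a b] bracket_simps)
  have Etr: "tr Bs (\<lambda>v. ?E (y \<bullet> v)) = 0" if "y \<in> span Bs" for y
    using d(2)[OF that] unfolding f_def killing_def
    by (simp only: tr_diff[OF independent_Bs DB bracket_in_span]) simp
  have "?E a = 0" if a: "a \<in> span Bs" for a
  proof (rule killing_nondegenerate[OF EB[OF a]])
    fix b assume b: "b \<in> span Bs"
    have EE: "?E (u \<bullet> v) \<in> span Bs" for u v by (intro EB bracket_in_span)
    have "killing (?E a) b = tr Bs (\<lambda>v. ?E (a \<bullet> (b \<bullet> v)) - a \<bullet> ?E (b \<bullet> v))"
      unfolding killing_def by (rule tr_cong) (simp add: Eder a bracket_in_span)
    also have "\<dots> = tr Bs (\<lambda>v. ?E (a \<bullet> (b \<bullet> v))) - tr Bs (\<lambda>v. a \<bullet> ?E (b \<bullet> v))"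
      by (rule tr_diff[OF independent_Bs EE bracket_in_span])
    also have "tr Bs (\<lambda>v. a \<bullet> ?E (b \<bullet> v)) = tr Bs (\<lambda>v. ?E (b \<bullet> (a \<bullet> v)))"
      by (rule tr_comm[OF independent_Bs finite_Bs lin_bracket lin_comp[OF E lin_bracket] bracket_in_span EE])
    also have "tr Bs (\<lambda>v. ?E (a \<bullet> (b \<bullet> v))) - \<dots> = tr Bs (\<lambda>v. ?E ((a \<bullet> b) \<bullet> v))"
      by (subst tr_diff[OF independent_Bs EE EE, symmetric])
         (simp only: bracket_bracket_left lin_diff[OF E])
    also have "\<dots> = 0" by (rule Etr[OF bracket_in_span])
    finally show "killing (?E a) b = 0" .
  qed
  then show ?thesis using d(1) that[of d] by simp
qed

end

section \<open>Root decomposition\<close>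

lemma funpow_last_nonzero:
  fixes f :: "'c::zero \<Rightarrow> 'c"
  shows "(f ^^ j) v = 0 \<Longrightarrow> v \<noteq> 0 \<Longrightarrow> \<exists>k. (f ^^ Suc k) v = 0 \<and> (f ^^ k) v \<noteq> 0"
  by (induction j) auto

lemma int_product_4:
  fixes a b :: int
  assumes "a * b = 4"
  shows "a \<in> {1, 2, 4, -1, -2, -4}"
proof -
  have "a dvd 4" using assms by (metis dvd_triv_left)
  then have "\<bar>a\<bar> \<le> 4" using dvd_imp_le_int[of 4 a] by simp
  then have "a = -4 \<or> a = -3 \<or> a = -2 \<or> a = -1 \<or> a = 0 \<or> a = 1 \<or> a = 2 \<or> a = 3 \<or> a = 4"
    by presburger
  then show ?thesis using \<open>a dvd 4\<close> by auto
qed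

text \<open>\<open>E\<close> is the projection onto the centraliser of the regular element \<open>x\<close>, and \<open>S\<close> inverts
  \<open>ad x\<close> on the complement; a weight is represented by an element of that centraliser through
  the Killing form. The conditions \<open>\<beta>2\<close> and \<open>\<beta>3\<close> are polarised.\<close>

locale root_setting = ac_lie_algebra scale bracket Bs + nd_lie_algebra scale bracket Bs dual
  for scale :: "'a::{alg_closed_field, field_char_0} \<Rightarrow> 'b::ab_group_add \<Rightarrow> 'b" (infixr "*s" 75)
    and bracket :: "'b \<Rightarrow> 'b \<Rightarrow> 'b" (infixl "\<bullet>" 70) and Bs dual +
  fixes x :: 'b and S E :: "'b \<Rightarrow> 'b" and \<beta> :: "'b \<Rightarrow> 'b \<Rightarrow> 'a"
  assumes x_in: "x \<in> span Bs" and lin_S: "lin S"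
    and S_in: "v \<in> span Bs \<Longrightarrow> S v \<in> span Bs"
    and E_def: "E v = v - S (x \<bullet> v)"
    and XE: "v \<in> span Bs \<Longrightarrow> x \<bullet> E v = 0"
    and SX: "v \<in> span Bs \<Longrightarrow> S (x \<bullet> v) = x \<bullet> S v"
    and E_abelian: "a \<in> span Bs \<Longrightarrow> b \<in> span Bs \<Longrightarrow> E a \<bullet> E b = 0"
    and \<beta>_add: "\<beta> (u + v) w = \<beta> u w + \<beta> v w" and \<beta>_scale: "\<beta> (c *s u) w = c * \<beta> u w"
    and \<beta>_anti: "\<beta> u v = - \<beta> v u"
    and \<beta>1: "a \<in> span Bs \<Longrightarrow> v \<in> span Bs \<Longrightarrow> \<beta> (E a) v = 0"
    and \<beta>2: "a \<in> span Bs \<Longrightarrow> u \<in> span Bs \<Longrightarrow> v \<in> span Bs \<Longrightarrow> \<beta> (S (u \<bullet> E a)) v + \<beta> (S (v \<bullet> E a)) u = 0"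
    and \<beta>3: "a \<in> span Bs \<Longrightarrow> u \<in> span Bs \<Longrightarrow> v \<in> span Bs \<Longrightarrow> w \<in> span Bs \<Longrightarrow>
      \<beta> (S (u \<bullet> S (v \<bullet> E a))) w + \<beta> (S (v \<bullet> S (u \<bullet> E a))) w +
      \<beta> (S (u \<bullet> S (w \<bullet> E a))) v + \<beta> (S (w \<bullet> S (u \<bullet> E a))) v +
      \<beta> (S (v \<bullet> S (w \<bullet> E a))) u + \<beta> (S (w \<bullet> S (v \<bullet> E a))) u = 0"
begin

section \<open>The centraliser \<open>H\<close> of \<open>x\<close>: nondegeneracy and
  diagonalisable action\<close>

definition H :: "'b set" where "H = {v \<in> span Bs. x \<bullet> v = 0}"

lemma \<beta>_add_right: "\<beta> w (u + v) = \<beta> w u + \<beta> w v"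
  using \<beta>_add \<beta>_anti by (metis minus_add_distrib)

lemma \<beta>_scale_right: "\<beta> w (c *s u) = c * \<beta> w u"
  using \<beta>_scale \<beta>_anti by (metis mult_minus_right)

lemma \<beta>_0: "\<beta> 0 w = 0" "\<beta> w 0 = 0"
  using \<beta>_scale[of 0 0 w] \<beta>_scale_right[of w 0 0] by simp_all

lemma \<beta>_neg: "\<beta> (- u) w = - \<beta> u w" "\<beta> w (- u) = - \<beta> w u"
  using \<beta>_scale[of "-1" u w] \<beta>_scale_right[of w "-1" u] by simp_all

lemmas \<beta>_simps = \<beta>_add \<beta>_scale \<beta>_add_right \<beta>_scale_right \<beta>_0 \<beta>_neg

lemma \<beta>_self: "\<beta> u u = 0"
  using \<beta>_anti[of u u] by (simp add: eq_neg_iff_add_eq_0 flip: mult_2)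

lemma lin_E: "lin E"
  by (rule linI) (simp_all add: E_def lin_simps[OF lin_S] bracket_simps scale_right_diff_distrib)

lemma E_in: "v \<in> span Bs \<Longrightarrow> E v \<in> span Bs"
  unfolding E_def by (intro span_diff S_in bracket_in_span)

lemma subspace_H: "subspace H"
  by (rule subspaceI) (auto simp: H_def bracket_simps span_zero span_add span_scale)

lemma H_in: "h \<in> H \<Longrightarrow> h \<in> span Bs" and xH: "h \<in> H \<Longrightarrow> x \<bullet> h = 0"
  by (auto simp: H_def)

lemma E_in_H: "v \<in> span Bs \<Longrightarrow> E v \<in> H"
  by (simp add: H_def E_in XE)

lemma E_H: "h \<in> H \<Longrightarrow> E h = h"
  by (simp add: E_def xH lin_0[OF lin_S])

lemma H_abelian: "h \<in> H \<Longrightarrow> h' \<in> H \<Longrightarrow> h \<bullet> h' = 0"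
  using E_abelian[of h h'] by (simp add: E_H H_in)

lemma x_H: "x \<in> H"
  by (simp add: H_def x_in bracket_self)

text \<open>The complement \<open>[x, g]\<close> is \<open>\<kappa>\<close>-orthogonal to
  \<open>H\<close>, since \<open>\<kappa>(t, [x, v]) = \<kappa>([t, x], v)\<close>. So
  \<open>t\<close> is orthogonal to everything.\<close>

lemma H_killing_nondegenerate:
  assumes "t \<in> H" "\<And>h. h \<in> H \<Longrightarrow> killing t h = 0"
  shows "t = 0"
proof (rule killing_nondegenerate)
  fix w assume w: "w \<in> span Bs"
  have "killing t (x \<bullet> S w) = killing (t \<bullet> x) (S w)" by (simp add: killing_invariant)
  also have "t \<bullet> x = 0" using H_abelian assms(1) x_H by blast
  finally have "killing t (x \<bullet> S w) = 0" by (simp add: killing_simps)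
  moreover have "w = E w + x \<bullet> S w" using SX[OF w] by (simp add: E_def)
  ultimately show "killing t w = 0"
    using assms(2)[OF E_in_H[OF w]] by (metis add_0 killing_add_right)
qed (use assms H_in in auto)

text \<open>The semisimple part of \<open>ad h\<close> is a replica, hence a derivation, hence some
  \<open>ad d\<close>. As a polynomial in \<open>ad h\<close> it commutes with \<open>ad H\<close>,
  so \<open>d\<close> lies in \<open>H\<close>. The nilpotency of \<open>ad (h - d)\<close> makes
  \<open>h - d\<close> orthogonal to \<open>H\<close>, so \<open>h = d\<close>.\<close>

lemma H_semisimple:
  assumes h: "h \<in> H" and v: "v \<in> span Bs" "v \<in> gen_eigenspace (bracket h) c"
  shows "h \<bullet> v = c *s v"
proof -
  obtain r where r:
    "\<And>v c. v \<in> span Bs \<Longrightarrow> v \<in> gen_eigenspace (bracket h) c \<Longrightarrow> poly_op (bracket h) r v = c *s v"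
    "\<And>a b. a \<in> span Bs \<Longrightarrow> b \<in> span Bs \<Longrightarrow>
      poly_op (bracket h) r (a \<bullet> b) = poly_op (bracket h) r a \<bullet> b + a \<bullet> poly_op (bracket h) r b"
    by (rule replica_derivation[of "\<lambda>c. c" h]) auto
  define s where "s = poly_op (bracket h) r"
  have s: "lin s" "v \<in> span Bs \<Longrightarrow> s v \<in> span Bs" for v
    unfolding s_def by (rule poly_op_lin[OF lin_bracket])
      (rule poly_op_subspace[OF lin_bracket subspace_span bracket_in_span])
  obtain d where d: "d \<in> span Bs" "\<And>v. v \<in> span Bs \<Longrightarrow> s v = d \<bullet> v"
    by (rule derivation_inner[OF s r(2)[folded s_def]]) blast+
  have comm: "h' \<bullet> d = 0" if h': "h' \<in> H" for h'
  proof (rule centre_trivial[OF bracket_in_span])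
    fix w assume w: "w \<in> span Bs"
    have "h' \<bullet> (h \<bullet> u) = h \<bullet> (h' \<bullet> u)" for u
      using bracket_leibniz[of h' h u] H_abelian[OF h' h] by (simp add: bracket_simps)
    then have "h' \<bullet> s w = s (h' \<bullet> w)"
      unfolding s_def by (rule poly_op_commute[OF lin_bracket lin_bracket])
    then show "(h' \<bullet> d) \<bullet> w = 0" using w by (simp add: d bracket_in_span bracket_bracket_left)
  qed
  have dH: "d \<in> H" using comm[OF x_H] d(1) by (simp add: H_def)
  define n where "n = h - d"
  have n: "n \<in> H" unfolding n_def by (intro subspace_diff subspace_H h dH)
  let ?S = "span Bs \<inter> (\<Union>c. gen_eigenspace (bracket h) c)"
  have "?S \<subseteq> gen_eigenspace (bracket n) 0"
  proof
    fix w assume "w \<in> ?S"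
    then obtain c where w: "w \<in> span Bs" "w \<in> gen_eigenspace (bracket h) c" by auto
    have *: "(bracket n ^^ k) w = ((\<lambda>v. h \<bullet> v - c *s v) ^^ k) w
        \<and> ((\<lambda>v. h \<bullet> v - c *s v) ^^ k) w \<in> span Bs \<inter> gen_eigenspace (bracket h) c" for k
    proof (induction k)
      case (Suc k)
      then show ?case
        using d(2) r(1)[folded s_def] gen_eigenspace_step[OF lin_bracket]
        by (auto simp: n_def bracket_simps bracket_in_span span_scale intro!: span_diff)
    qed (use w in auto)
    obtain k where "((\<lambda>v. h \<bullet> v - c *s v) ^^ k) w = 0"
      using w(2) by (auto simp: gen_eigenspace_def poly_op_linear_power lin_bracket)
    then show "w \<in> gen_eigenspace (bracket n) 0"
      using * gen_eigenspace_0_iff[OF lin_bracket] by metis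
  qed
  then have "span ?S \<subseteq> gen_eigenspace (bracket n) 0"
    by (rule span_minimal) (rule subspace_gen_eigenspace[OF lin_bracket])
  moreover have "span Bs \<subseteq> span ?S" by (rule span_gen_eigen) (auto intro: lin_bracket bracket_in_span)
  ultimately have "\<exists>k. (bracket n ^^ k) w = 0" if "w \<in> span Bs" for w
    using that gen_eigenspace_0_iff[OF lin_bracket] by blast
  then have "killing n h' = 0" if "h' \<in> H" for h'
    by (rule killing_nilpotent_commuting) (use H_abelian n that in auto)
  then have "n = 0" by (rule H_killing_nondegenerate[OF n])
  then have "h \<bullet> v = s v" using d(2) v by (simp add: n_def)
  then show ?thesis using r(1)[OF v] by (simp add: s_def)
qed

text \<open>Each joint eigenspace of \<open>T\<close> is stable under a further commuting
  \<open>h\<close> and splits into generalised eigenspaces of \<open>h\<close>, which are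
  eigenspaces by \<open>H_semisimple\<close>.\<close>

lemma span_joint_eigenvectors:
  assumes "finite T" "T \<subseteq> H"
  shows "span Bs \<subseteq> span {v \<in> span Bs. \<forall>h\<in>T. \<exists>c. h \<bullet> v = c *s v}"
  using assms
proof (induction T)
  case empty
  then show ?case using span_superset by auto
next
  case (insert h T)
  let ?J = "\<lambda>T. {v \<in> span Bs. \<forall>h\<in>T. \<exists>c. h \<bullet> v = c *s v}"
  have "?J T \<subseteq> span (?J (insert h T))"
  proof
    fix v assume v: "v \<in> ?J T"
    then obtain c where c: "\<And>h'. h' \<in> T \<Longrightarrow> h' \<bullet> v = c h' *s v" by (auto dest!: bchoice)
    let ?W = "{w \<in> span Bs. \<forall>h'\<in>T. h' \<bullet> w = c h' *s w}"
    have W: "subspace ?W"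
      by (rule subspaceI) (auto simp: bracket_simps span_zero span_add span_scale scale_right_distrib mult.commute)
    have "?W \<subseteq> span (?W \<inter> (\<Union>c. gen_eigenspace (bracket h) c))"
    proof (rule span_gen_eigen[OF lin_bracket bracket_in_span W])
      fix w assume w: "w \<in> ?W"
      have "h' \<bullet> (h \<bullet> w) = c h' *s (h \<bullet> w)" if "h' \<in> T" for h'
      proof -
        have "h' \<bullet> h = 0" using that insert.prems H_abelian by blast
        then show ?thesis using bracket_leibniz[of h' h w] w that by (simp add: bracket_simps)
      qed
      then show "h \<bullet> w \<in> ?W" by (simp add: bracket_in_span)
    qed auto
    also have "\<dots> \<subseteq> span (?J (insert h T))"
      using H_semisimple insert.prems by (intro span_mono) blast
    finally show "v \<in> span (?J (insert h T))" using v c by blast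
  qed
  then have "span (?J T) \<subseteq> span (?J (insert h T))" by (intro span_minimal) auto
  then show ?case using insert by (meson insert_subset order_trans)
qed

section \<open>Weight spaces and their duality under \<open>\<kappa>\<close>\<close>

definition wt :: "'b \<Rightarrow> 'b set" where
  "wt t = {v \<in> span Bs. \<forall>h\<in>H. h \<bullet> v = killing t h *s v}"

lemma wtI: "v \<in> span Bs \<Longrightarrow> (\<And>h. h \<in> H \<Longrightarrow> h \<bullet> v = killing t h *s v) \<Longrightarrow> v \<in> wt t"
  and wt_in: "v \<in> wt t \<Longrightarrow> v \<in> span Bs"
  and wtD: "v \<in> wt t \<Longrightarrow> h \<in> H \<Longrightarrow> h \<bullet> v = killing t h *s v"
  by (auto simp: wt_def)

text \<open>The eigenvalue is a linear function \<open>l\<close> on \<open>H\<close>. Extending it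
  by \<open>l (E w)\<close> makes it vanish on \<open>[x, g]\<close>, which puts its representing
  vector \<open>t\<close> in \<open>H\<close>.\<close>

lemma joint_eigenvector_wt:
  assumes "v \<in> span Bs" "v \<noteq> 0" "\<And>h. h \<in> H \<Longrightarrow> \<exists>c. h \<bullet> v = c *s v"
  shows "\<exists>t\<in>H. v \<in> wt t"
proof -
  obtain l where l: "\<And>h. h \<in> H \<Longrightarrow> h \<bullet> v = l h *s v" using assms(3) by metis
  have l_eq: "l h = c" if "h \<in> H" "h \<bullet> v = c *s v" for h c using l[OF that(1)] that(2) assms(2) by simp
  obtain t where t: "t \<in> span Bs" "\<And>w. w \<in> span Bs \<Longrightarrow> killing t w = l (E w)"
  proof (rule killing_represents[of "\<lambda>w. l (E w)"])
    fix u w assume "u \<in> span Bs" "w \<in> span Bs"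
    then show "l (E (u + w)) = l (E u) + l (E w)"
      by (intro l_eq) (simp_all add: lin_add[OF lin_E] E_in_H subspace_add subspace_H bracket_simps l scale_left_distrib)
  next
    fix c w assume "w \<in> span Bs"
    then show "l (E (c *s w)) = c * l (E w)"
      by (intro l_eq) (simp_all add: lin_scale[OF lin_E] E_in_H subspace_scale subspace_H bracket_simps l)
  qed blast
  have "t \<bullet> x = 0"
  proof (rule killing_nondegenerate[OF bracket_in_span])
    fix w assume w: "w \<in> span Bs"
    have "x \<bullet> w = x \<bullet> S (x \<bullet> w)" using XE[OF w] by (simp add: E_def bracket_simps)
    then have "E (x \<bullet> w) = 0" using SX[OF bracket_in_span[of x w]] by (simp add: E_def)
    moreover have "l 0 = 0" by (rule l_eq) (simp_all add: subspace_0 subspace_H bracket_simps)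
    ultimately show "killing (t \<bullet> x) w = 0" using t(2)[OF bracket_in_span[of x w]] by (simp add: killing_invariant)
  qed
  then have "t \<in> H" using t(1) bracket_anti[of t x] by (simp add: H_def)
  moreover have "v \<in> wt t" using l t H_in E_H assms(1) by (auto simp: wt_def)
  ultimately show ?thesis by blast
qed

lemma wt_span: "span Bs \<subseteq> span (\<Union>t\<in>H. wt t)"
proof -
  \<comment> \<open>Finitely many elements suffice: the images \<open>E b\<close> span
    \<open>H\<close>, so joint eigenvectors for them are joint eigenvectors for
    \<open>H\<close>.\<close>
  let ?J = "{v \<in> span Bs. \<forall>h\<in>E ` Bs. \<exists>c. h \<bullet> v = c *s v}"
  have "?J \<subseteq> (\<Union>t\<in>H. wt t)"
  proof
    fix v assume v: "v \<in> ?J"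
    show "v \<in> (\<Union>t\<in>H. wt t)"
    proof (cases "v = 0")
      case True
      then show ?thesis using subspace_0[OF subspace_H] by (auto simp: wt_def span_zero bracket_simps)
    next
      case False
      have "\<exists>t\<in>H. v \<in> wt t"
      proof (rule joint_eigenvector_wt[OF _ False])
        fix h assume h: "h \<in> H"
        obtain c where c: "\<And>b. b \<in> Bs \<Longrightarrow> E b \<bullet> v = c b *s v" using v by (auto dest!: bchoice)
        have "h = E (\<Sum>b\<in>Bs. representation Bs h b *s b)"
          using sum_rep_eq[OF independent_Bs finite_Bs H_in[OF h]] E_H[OF h] by simp
        also have "\<dots> = (\<Sum>b\<in>Bs. representation Bs h b *s E b)" by (simp add: lin_simps[OF lin_E])
        finally have "h \<bullet> v = (\<Sum>b\<in>Bs. representation Bs h b *s E b) \<bullet> v"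
          by (rule arg_cong[where f = "\<lambda>h. h \<bullet> v"])
        also have "\<dots> = (\<Sum>b\<in>Bs. (representation Bs h b * c b) *s v)"
          by (simp add: bracket_simps c)
        finally have "h \<bullet> v = (\<Sum>b\<in>Bs. (representation Bs h b * c b) *s v)" .
        then show "\<exists>c. h \<bullet> v = c *s v" by (metis scale_sum_left)
      qed (use v in auto)
      then show ?thesis by auto
    qed
  qed
  then have "span ?J \<subseteq> span (\<Union>t\<in>H. wt t)" by (rule span_mono)
  moreover have "span Bs \<subseteq> span ?J"
    by (rule span_joint_eigenvectors) (auto simp: finite_Bs E_in_H span_base)
  ultimately show ?thesis by blast
qed

lemma wt_bracket:
  assumes "u \<in> wt s" "v \<in> wt t" shows "u \<bullet> v \<in> wt (s + t)"
proof (rule wtI[OF bracket_in_span])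
  fix h assume "h \<in> H"
  then show "h \<bullet> (u \<bullet> v) = killing (s + t) h *s (u \<bullet> v)"
    using assms bracket_leibniz[of h u v]
    by (simp add: wtD bracket_simps killing_simps scale_left_distrib)
qed

lemma wt_0: "wt 0 = H"
proof
  show "wt 0 \<subseteq> H"
  proof
    fix v assume v: "v \<in> wt 0"
    then show "v \<in> H" using wtD[OF v x_H] wt_in[OF v] by (simp add: H_def killing_simps)
  qed
  show "H \<subseteq> wt 0"
  proof
    fix v assume "v \<in> H"
    then show "v \<in> wt 0" using H_abelian by (intro wtI H_in) (simp_all add: killing_simps)
  qed
qed

lemma wt_scale: "v \<in> wt t \<Longrightarrow> c *s v \<in> wt t"
  by (auto simp: wt_def span_scale bracket_simps mult.commute)

lemma wt_killing_0:
  assumes "u \<in> wt s" "v \<in> wt t" "s \<in> H" "t \<in> H" "s + t \<noteq> 0"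
  shows "killing u v = 0"
proof -
  obtain h where h: "h \<in> H" "killing (s + t) h \<noteq> 0"
    using H_killing_nondegenerate[of "s + t"] assms subspace_add[OF subspace_H] by blast
  have "killing (u \<bullet> h) v = killing u (h \<bullet> v)" by (rule killing_invariant)
  then have "- (killing s h * killing u v) = killing t h * killing u v"
    using wtD[OF assms(1) h(1)] wtD[OF assms(2) h(1)] bracket_anti[of u h]
    by (simp add: killing_simps)
  then have "killing (s + t) h * killing u v = 0"
    unfolding killing_add_left distrib_right by (metis add.right_inverse)
  then show ?thesis using h by simp
qed

lemma root_pair:
  assumes "t \<in> H" "e \<in> wt t" "e \<noteq> 0"
  obtains f where "f \<in> wt (- t)" "killing e f = 1"
proof -
  have "\<exists>s\<in>H. \<exists>f\<in>wt s. killing e f \<noteq> 0"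
  proof (rule ccontr)
    assume "\<not> ?thesis"
    then have "killing e w = 0" if "w \<in> span Bs" for w
      using killing_eq_0_span[of "\<Union>t\<in>H. wt t" e w] wt_span that by blast
    then show False using killing_nondegenerate assms wt_in by blast
  qed
  then obtain s f where sf: "s \<in> H" "f \<in> wt s" "killing e f \<noteq> 0" by blast
  then have "s = - t" using wt_killing_0 assms by (metis add_eq_0_iff)
  then show ?thesis using that[of "(1 / killing e f) *s f"] sf by (simp add: wt_scale killing_simps)
qed

lemma wt_opposite_bracket:
  assumes "t \<in> H" "e \<in> wt t" "f \<in> wt (- t)" "killing e f = 1"
  shows "e \<bullet> f = t"
proof -
  have ef: "e \<bullet> f \<in> H" using wt_bracket[OF assms(2,3)] by (simp add: wt_0)
  have "e \<bullet> f - t = 0"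
  proof (rule H_killing_nondegenerate)
    fix h assume h: "h \<in> H"
    have "killing (e \<bullet> f) h = killing e (f \<bullet> h)" by (rule killing_invariant)
    also have "\<dots> = killing t h"
      using wtD[OF assms(3) h] bracket_anti[of f h] assms(4) by (simp add: killing_simps)
    finally show "killing (e \<bullet> f - t) h = 0" by (simp add: killing_simps)
  qed (intro subspace_diff subspace_H ef assms)
  then show ?thesis by simp
qed

section \<open>Root strings and proportional roots\<close>

lemma wt_power:
  assumes "e \<in> wt t" "v \<in> wt s" shows "(bracket e ^^ k) v \<in> wt (s + of_nat k *s t)"
proof (induction k)
  case (Suc k)
  then show ?case using wt_bracket[OF assms(1) Suc]
    by (simp add: scale_left_distrib algebra_simps)
qed (use assms in simp)

text \<open>Otherwise the weights \<open>s + k t\<close> would give infinitely many eigenvalues of a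
  single \<open>ad h\<close>, all roots of one annihilating polynomial.\<close>

lemma wt_nilpotent:
  assumes "e \<in> wt t" "v \<in> wt s" "t \<in> H" "t \<noteq> 0"
  shows "\<exists>k. (bracket e ^^ k) v = 0"
proof (rule ccontr)
  assume nz: "\<nexists>k. (bracket e ^^ k) v = 0"
  obtain h where h: "h \<in> H" "killing t h \<noteq> 0" using H_killing_nondegenerate assms by blast
  obtain p where p: "p \<noteq> 0" "\<And>v. v \<in> span Bs \<Longrightarrow> poly_op (bracket h) p v = 0"
    using poly_op_annihilates[OF lin_bracket finite_Bs bracket_in_span] by blast
  have "poly p (killing s h + of_nat k * killing t h) = 0" for k
  proof -
    have *: "(bracket e ^^ k) v \<in> wt (s + of_nat k *s t)" by (rule wt_power[OF assms(1,2)])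
    have "poly_op (bracket h) p ((bracket e ^^ k) v) = poly p (killing (s + of_nat k *s t) h) *s (bracket e ^^ k) v"
      by (rule poly_op_eigen[OF lin_bracket wtD[OF * h(1)]])
    then show ?thesis using p(2)[OF wt_in[OF *]] nz by (simp add: killing_simps)
  qed
  then have "range (\<lambda>k::nat. killing s h + of_nat k * killing t h) \<subseteq> {c. poly p c = 0}" by auto
  moreover have "inj (\<lambda>k::nat. killing s h + of_nat k * killing t h)" using h by (auto intro!: injI)
  ultimately show False using poly_roots_finite[OF p(1)] finite_subset range_inj_infinite by blast
qed

text \<open>The weight of a lowest weight vector, from applying \<open>f\<close> to the last nonzero power of \<open>e\<close>.\<close>

lemma lowest_weight:
  assumes t: "t \<in> H" "t \<noteq> 0" and e: "e \<in> wt t" and f: "f \<in> wt (- t)" and ef: "killing e f = 1"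
    and v: "v \<in> wt s" "v \<noteq> 0" "f \<bullet> v = 0"
  shows "\<exists>m. 2 * killing t s + of_nat m * killing t t = 0"
proof -
  \<comment> \<open>\<open>c k\<close> is the sum of
    \<open>\<kappa>(t, s) + i \<kappa>(t, t)\<close> over \<open>i \<le> k\<close>, which the
    commutators accumulate when \<open>f\<close> is moved past \<open>k + 1\<close> factors
    \<open>e\<close>.\<close>
  define c where "c k = of_nat (Suc k) * (2 * killing t s + of_nat k * killing t t) / 2" for k
  have fe: "f \<bullet> (e \<bullet> w) = e \<bullet> (f \<bullet> w) - t \<bullet> w" for w
    using wt_opposite_bracket[OF t(1) e f ef] bracket_bracket_left[of e f w] by simp
  have tk: "t \<bullet> (bracket e ^^ k) v = (killing t s + of_nat k * killing t t) *s (bracket e ^^ k) v" for k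
    using wtD[OF wt_power[OF e v(1)] t(1), of k] by (simp add: killing_simps killing_sym[of s t])
  have "f \<bullet> (bracket e ^^ Suc k) v = - c k *s (bracket e ^^ k) v" for k
  proof (induction k)
    case 0
    then show ?case using tk[of 0] by (simp add: fe v(3) bracket_simps c_def)
  next
    case (Suc k)
    have "f \<bullet> (bracket e ^^ Suc (Suc k)) v = e \<bullet> (- c k *s (bracket e ^^ k) v) - t \<bullet> (bracket e ^^ Suc k) v"
      using fe Suc by simp
    also have "\<dots> = (- c k - (killing t s + of_nat (Suc k) * killing t t)) *s (bracket e ^^ Suc k) v"
      by (subst tk) (simp add: bracket_simps scale_left_diff_distrib)
    also have "- c k - (killing t s + of_nat (Suc k) * killing t t) = - c (Suc k)"
      by (simp add: c_def field_simps)
    finally show ?case .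
  qed
  moreover obtain k where "(bracket e ^^ Suc k) v = 0" "(bracket e ^^ k) v \<noteq> 0"
    using wt_nilpotent[OF e v(1) t] funpow_last_nonzero v(2) by metis
  ultimately have "c k = 0" by (metis bracket_simps(1) neg_equal_0_iff_equal scale_eq_0_iff)
  then show ?thesis by (auto simp: c_def simp del: of_nat_Suc)
qed

text \<open>The last nonzero power of \<open>f\<close> on \<open>v\<close> is a lowest weight vector
  of weight \<open>s - k t\<close>; \<open>lowest_weight\<close> with its \<open>m\<close> gives the
  integer \<open>2 k - m\<close>.\<close>

lemma weight_integrality:
  assumes t: "t \<in> H" "t \<noteq> 0" and e: "e \<in> wt t" "e \<noteq> 0"
    and v: "v \<in> wt s" "v \<noteq> 0"
  shows "\<exists>z. 2 * killing t s = of_int z * killing t t"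
proof -
  obtain f where f: "f \<in> wt (- t)" "killing e f = 1" using root_pair t e by blast
  obtain k where "(bracket f ^^ Suc k) v = 0" "(bracket f ^^ k) v \<noteq> 0"
    using wt_nilpotent[OF f(1) v(1)] t subspace_neg[OF subspace_H] funpow_last_nonzero[of _ "bracket f" v] v(2)
    by (metis neg_equal_0_iff_equal)
  then obtain m where "2 * killing t (s + of_nat k *s (- t)) + of_nat m * killing t t = 0"
    using lowest_weight[OF t e(1) f wt_power[OF f(1) v(1), of k]] by auto
  then have "2 * killing t s = of_int (2 * int k - int m) * killing t t"
    by (simp add: killing_simps algebra_simps)
  then show ?thesis by blast
qed

text \<open>If \<open>\<kappa>(t, t)\<close> were 0, integrality would give
  \<open>\<kappa>(t, s) = 0\<close> for all weights \<open>s\<close>, making \<open>t\<close>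
  central.\<close>

lemma root_norm:
  assumes "t \<in> H" "t \<noteq> 0" "e \<in> wt t" "e \<noteq> 0"
  shows "killing t t \<noteq> 0"
proof
  assume 0: "killing t t = 0"
  have "t = 0"
  proof (rule centre_trivial)
    fix v assume "v \<in> span Bs"
    then have "v \<in> span (\<Union>t\<in>H. wt t)" using wt_span by blast
    then show "t \<bullet> v = 0"
    proof (rule lin_eq_0_span[OF lin_bracket, rotated])
      fix b assume "b \<in> (\<Union>t\<in>H. wt t)"
      then obtain s where b: "b \<in> wt s" by blast
      show "t \<bullet> b = 0"
      proof (cases "b = 0")
        case False
        then have "killing t s = 0" using weight_integrality[OF assms b] 0 by auto
        then show ?thesis using wtD[OF b assms(1)] by (simp add: killing_sym)
      qed (simp add: bracket_simps)
    qed
  qed (use assms H_in in auto)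
  then show False using assms by simp
qed

text \<open>Subtracting a multiple of \<open>e\<close> makes \<open>v\<close> orthogonal to
  \<open>f\<close>, and then \<open>[v, f] = 0\<close>. A nonzero lowest weight vector of weight
  \<open>t\<close> is impossible, because \<open>(2 + m) \<kappa>(t, t)\<close> is not 0.\<close>

lemma root_space_dim1:
  assumes t: "t \<in> H" "t \<noteq> 0" and e: "e \<in> wt t" "e \<noteq> 0" and v: "v \<in> wt t"
  shows "\<exists>c. v = c *s e"
proof -
  obtain f where f: "f \<in> wt (- t)" "killing e f = 1" using root_pair t e by blast
  let ?v = "v - killing v f *s e"
  have v': "?v \<in> wt t" using v e
    by (auto simp: wt_def span_diff span_scale bracket_simps scale_right_diff_distrib mult.commute)
  have "killing ?v f = 0" using f(2) by (simp add: killing_simps)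
  have fv: "?v \<bullet> f \<in> H" using wt_bracket[OF v' f(1)] by (simp add: wt_0)
  have "?v \<bullet> f = 0"
  proof (rule H_killing_nondegenerate[OF fv])
    fix h assume h: "h \<in> H"
    have "killing (?v \<bullet> f) h = killing ?v (f \<bullet> h)" by (rule killing_invariant)
    also have "\<dots> = 0" using wtD[OF f(1) h] bracket_anti[of f h] \<open>killing ?v f = 0\<close> by (simp add: killing_scale_right killing_neg)
    finally show "killing (?v \<bullet> f) h = 0" .
  qed
  then have "f \<bullet> ?v = 0" using bracket_anti[of f ?v] by simp
  then have "?v = 0"
    using lowest_weight[OF t e(1) f v'] root_norm[OF t e]
    by (metis add_eq_0_iff_both_eq_0 distrib_right mult_eq_0_iff of_nat_add of_nat_eq_0_iff of_nat_numeral zero_neq_numeral)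
  then show ?thesis by auto
qed

text \<open>\<open>[e, w]\<close> has weight \<open>3 t\<close>; if it were nonzero, integrality of
  \<open>t\<close> against \<open>3 t\<close> would read \<open>6 = 9 z\<close>. So
  \<open>[e, w] = 0\<close>. As \<open>[f, w]\<close> is a multiple of \<open>e\<close>,
  \<open>[[e, f], w] = [t, w]\<close> vanishes, whereas it equals
  \<open>2 \<kappa>(t, t) w\<close>.\<close>

lemma double_root:
  assumes t: "t \<in> H" "t \<noteq> 0" and e: "e \<in> wt t" "e \<noteq> 0" and w: "w \<in> wt (t + t)"
  shows "w = 0"
proof -
  obtain f where f: "f \<in> wt (- t)" "killing e f = 1" using root_pair t e by blast
  have k: "killing t t \<noteq> 0" by (rule root_norm[OF t e])
  let ?s = "t + (t + t)"
  have kts: "killing ?s t = 3 * killing t t" "killing ?s ?s = 9 * killing t t" by (simp_all add: killing_simps)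
  have ew: "e \<bullet> w \<in> wt ?s" by (rule wt_bracket[OF e(1) w])
  have "e \<bullet> w = 0"
  proof (rule ccontr)
    assume "e \<bullet> w \<noteq> 0"
    moreover have "?s \<in> H" using t by (intro subspace_add subspace_H)
    moreover have "?s \<noteq> 0"
    proof
      assume "?s = 0"
      then show False using kts(1) k by (simp only: killing_0) simp
    qed
    ultimately obtain z where "2 * killing ?s t = of_int z * killing ?s ?s"
      using weight_integrality ew e by blast
    then have "of_int (2 * 3) = (of_int (z * 9) :: 'a)" using k unfolding kts by simp
    then have "2 * 3 = z * 9" by (simp only: of_int_eq_iff)
    then show False by presburger
  qed
  moreover have "f \<bullet> w \<in> wt t" using wt_bracket[OF f(1) w] by simp
  then obtain c where "f \<bullet> w = c *s e" using root_space_dim1[OF t e] by blast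
  ultimately have "(e \<bullet> f) \<bullet> w = 0" by (simp add: bracket_bracket_left bracket_simps bracket_self)
  then have "killing (t + t) t *s w = 0"
    using wt_opposite_bracket[OF t(1) e(1) f] wtD[OF w t(1)] by simp
  moreover have "killing (t + t) t \<noteq> 0" using k by (simp add: killing_simps flip: mult_2)
  ultimately show ?thesis by simp
qed

text \<open>\<open>2 c\<close> and \<open>2 / c\<close> are integers with product 4. The ratios 2
  and -2 are excluded by \<open>double_root\<close>, and 1/2 and -1/2 by exchanging the roles of
  \<open>s\<close> and \<open>t\<close>.\<close>

lemma proportional_roots:
  assumes t: "t \<in> H" "t \<noteq> 0" "e \<in> wt t" "e \<noteq> 0"
    and s: "s \<in> H" "s \<noteq> 0" "v \<in> wt s" "v \<noteq> 0" and st: "s = c *s t"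
  shows "c = 1 \<or> c = -1"
proof -
  have k: "killing t t \<noteq> 0" by (rule root_norm[OF t])
  have c0: "c \<noteq> 0" using s st by auto
  have no2: False if "u \<in> H" "u \<noteq> 0" "a \<in> wt u" "a \<noteq> 0" "b \<in> wt (2 *s u)" "b \<noteq> 0" for u a b
    using double_root[of u a b] that scale_left_distrib[of 1 1 u] by simp
  have nm2: False if u: "u \<in> H" "u \<noteq> 0" "a \<in> wt u" "a \<noteq> 0" "b \<in> wt (- 2 *s u)" "b \<noteq> 0" for u a b
  proof -
    obtain f where f: "f \<in> wt (- u)" "killing a f = 1" using root_pair u by blast
    then have "f \<noteq> 0" by (auto simp: killing_simps)
    then show False using no2[of "- u" f b] u f subspace_neg[OF subspace_H] by simp
  qed
  obtain z1 where "2 * killing t s = of_int z1 * killing t t" using weight_integrality[OF t s(3,4)] by blast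
  then have z1: "2 * c = of_int z1" using k by (simp add: st killing_simps)
  obtain z2 where "2 * killing s t = of_int z2 * killing s s" using weight_integrality[OF s t(3,4)] by blast
  then have z2: "2 = of_int z2 * c" using k c0 by (simp add: st killing_simps)
  have "of_int (z1 * z2) = (of_int 4 :: 'a)" using z1 z2 by (simp flip: z1) (metis mult.commute mult.left_commute mult_2_right numeral_Bit0)
  then have "z1 * z2 = 4" by (simp only: of_int_eq_iff)
  then have "z1 \<in> {1, 2, 4, -1, -2, -4}" by (rule int_product_4)
  then consider "c = 1" | "c = -1" | "c = 2" | "c = -2" | "2 * c = 1" | "2 * c = -1"
    using z1 by (auto simp: field_simps)
  then show ?thesis
  proof cases
    case 3
    then show ?thesis using no2[OF t, of v] s st by simp
  next
    case 4
    then show ?thesis using nm2[OF t, of v] s st by simp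
  next
    case 5
    then have "t = 2 *s s" using st by simp
    then show ?thesis using no2[OF s, of e] t by simp
  next
    case 6
    then have "t = (- 2) *s s" using st by simp
    then show ?thesis using nm2[OF s, of e] t by simp
  qed auto
qed

text \<open>If \<open>x\<close> acted by 0, \<open>v\<close> would lie in the abelian
  \<open>H\<close>, so that \<open>H\<close> would act on it by 0.\<close>

lemma wt_x_nonzero:
  assumes "v \<in> wt t" "v \<noteq> 0" "t \<in> H" "t \<noteq> 0"
  shows "killing t x \<noteq> 0"
proof
  assume "killing t x = 0"
  then have v: "v \<in> H" using wtD[OF assms(1) x_H] wt_in[OF assms(1)] by (simp add: H_def)
  have "killing t h = 0" if "h \<in> H" for h
    using wtD[OF assms(1) that] H_abelian[OF that v] assms(2) by simp
  then show False using H_killing_nondegenerate assms by blast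
qed

lemma S_wt:
  assumes "v \<in> wt t" "killing t x \<noteq> 0"
  shows "S v = (1 / killing t x) *s v"
proof -
  let ?k = "killing t x"
  have v: "x \<bullet> v = ?k *s v" using wtD[OF assms(1) x_H] .
  have "x \<bullet> v = x \<bullet> S (x \<bullet> v)" using XE[OF wt_in[OF assms(1)]] by (simp add: E_def bracket_simps)
  also have "\<dots> = x \<bullet> (?k *s S v)" by (simp add: v lin_scale[OF lin_S])
  also have "\<dots> = ?k *s S (x \<bullet> v)" using SX[OF wt_in[OF assms(1)]] by (simp add: bracket_simps)
  finally have "S (?k *s v) = v" using assms(2) by (simp add: v)
  then have "?k *s S v = v" by (simp add: lin_scale[OF lin_S])
  then have "(1 / ?k) *s (?k *s S v) = (1 / ?k) *s v" by simp
  then show ?thesis using assms(2) by simp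
qed

section \<open>The form \<open>\<beta>\<close> on weight spaces\<close>

lemma \<beta>_H: "h \<in> H \<Longrightarrow> v \<in> span Bs \<Longrightarrow> \<beta> h v = 0" "h \<in> H \<Longrightarrow> v \<in> span Bs \<Longrightarrow> \<beta> v h = 0"
  using \<beta>1[of h v] E_H[of h] H_in[of h] \<beta>_anti[of v h] by auto

lemma proportional_of_ratio:
  assumes "t \<in> H" "s \<in> H" "killing t x \<noteq> 0" "killing s x \<noteq> 0"
    "\<And>y. y \<in> H \<Longrightarrow> killing t y / killing t x = killing s y / killing s x"
  shows "s = (killing s x / killing t x) *s t"
proof -
  have "s - (killing s x / killing t x) *s t = 0"
  proof (rule H_killing_nondegenerate)
    fix h assume "h \<in> H"
    then show "killing (s - (killing s x / killing t x) *s t) h = 0"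
      using assms(3,4) assms(5)[of h] by (simp add: killing_simps field_simps)
  qed (intro subspace_diff subspace_scale subspace_H assms)
  then show ?thesis by simp
qed

lemma S_bracket_H:
  assumes "v \<in> wt t" "killing t x \<noteq> 0" "y \<in> H"
  shows "S (v \<bullet> y) = - (killing t y / killing t x) *s v"
  using wtD[OF assms(1,3)] bracket_anti[of v y] S_wt[OF assms(1,2)] by (simp add: lin_simps[OF lin_S])

text \<open>\<open>\<beta>2\<close> makes \<open>\<beta> u v\<close> vanish unless \<open>s\<close>
  and \<open>t\<close> are proportional, hence \<open>s = t\<close> or \<open>s = - t\<close>. In
  the first case the root space is one-dimensional and \<open>\<beta>\<close> is
  alternating.\<close>

lemma \<beta>_wt:
  assumes "u \<in> wt t" "v \<in> wt s" "t \<in> H" "s \<in> H" "t + s \<noteq> 0"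
  shows "\<beta> u v = 0"
proof (cases "t = 0 \<or> s = 0 \<or> u = 0 \<or> v = 0")
  case True
  then show ?thesis using assms wt_in by (auto simp: wt_0 \<beta>_H \<beta>_simps)
next
  case False
  then have nz: "t \<noteq> 0" "s \<noteq> 0" "u \<noteq> 0" "v \<noteq> 0" by auto
  have tx: "killing t x \<noteq> 0" and sx: "killing s x \<noteq> 0" using wt_x_nonzero assms nz by blast+
  show ?thesis
  proof (rule ccontr)
    assume b: "\<beta> u v \<noteq> 0"
    have "killing t y / killing t x = killing s y / killing s x" if y: "y \<in> H" for y
    proof -
      have "\<beta> (S (u \<bullet> y)) v + \<beta> (S (v \<bullet> y)) u = 0"
        using \<beta>2[OF H_in[OF y] wt_in[OF assms(1)] wt_in[OF assms(2)]] E_H[OF y] by simp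
      then have "(killing t y / killing t x - killing s y / killing s x) * \<beta> u v = 0"
        by (simp only: S_bracket_H[OF assms(1) tx y] S_bracket_H[OF assms(2) sx y] \<beta>_scale \<beta>_anti[of v u])
           (simp add: algebra_simps)
      then show ?thesis using b by simp
    qed
    then have st: "s = (killing s x / killing t x) *s t"
      using proportional_of_ratio assms tx sx by blast
    then consider "killing s x / killing t x = 1" | "killing s x / killing t x = -1"
      using proportional_roots[OF assms(3) nz(1) assms(1) nz(3) assms(4) nz(2) assms(2) nz(4)] by blast
    then show False
    proof cases
      case 1
      then have "v \<in> wt t" using st assms by simp
      then obtain c where "v = c *s u" using root_space_dim1[OF assms(3) nz(1) assms(1) nz(3)] by blast
      then show False using b by (simp add: \<beta>_simps \<beta>_self)
    next
      case 2
      then have "s = - t" using st by (metis scale_minus_left scale_one)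
      then show False using assms by simp
    qed
  qed
qed

text \<open>By \<open>\<beta>_wt\<close>, \<open>\<beta>\<close> is invariant under
  \<open>ad H\<close>, and the term with \<open>[u, v]\<close> drops out since \<open>H\<close> is
  in the kernel of \<open>\<beta>\<close>.\<close>

lemma cocycle_H:
  assumes "u \<in> wt t" "v \<in> wt s" "t \<in> H" "s \<in> H" "h \<in> H"
  shows "\<beta> (u \<bullet> v) h + \<beta> (v \<bullet> h) u + \<beta> (h \<bullet> u) v = 0"
proof -
  have "\<beta> (v \<bullet> h) u + \<beta> (h \<bullet> u) v = killing (t + s) h * \<beta> u v"
    using wtD[OF assms(1,5)] wtD[OF assms(2,5)] bracket_anti[of v h] \<beta>_anti[of v u]
    by (simp add: \<beta>_simps killing_simps algebra_simps)
  also have "\<dots> = 0" using \<beta>_wt[OF assms(1-4)] by (cases "t + s = 0") (auto simp: killing_simps)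
  finally show ?thesis using \<beta>_H(2)[OF assms(5) bracket_in_span] by (simp add: add.assoc)
qed

text \<open>If the weights do not sum to 0, each term vanishes by \<open>\<beta>_wt\<close>; if one
  weight is 0, \<open>cocycle_H\<close> applies. There remain three roots with sum 0, where
  \<open>\<beta>3\<close> for a suitable \<open>y\<close> in \<open>H\<close> is a nonzero multiple
  of the claim.\<close>

lemma cocycle_wt:
  assumes u: "u \<in> wt t1" "v \<in> wt t2" "w \<in> wt t3" and t: "t1 \<in> H" "t2 \<in> H" "t3 \<in> H"
  shows "\<beta> (u \<bullet> v) w + \<beta> (v \<bullet> w) u + \<beta> (w \<bullet> u) v = 0"
proof (cases "t1 + t2 + t3 = 0")
  case False
  then have "t1 + t2 + t3 \<noteq> 0" "t2 + t3 + t1 \<noteq> 0" "t3 + t1 + t2 \<noteq> 0" by (simp_all add: algebra_simps)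
  then show ?thesis
    using \<beta>_wt[OF wt_bracket[OF u(1,2)] u(3)] \<beta>_wt[OF wt_bracket[OF u(2,3)] u(1)]
      \<beta>_wt[OF wt_bracket[OF u(3,1)] u(2)] t subspace_add[OF subspace_H] by simp
next
  case sum0: True
  consider "u = 0 \<or> v = 0 \<or> w = 0" | "t1 = 0" | "t2 = 0" | "t3 = 0"
    | "u \<noteq> 0" "v \<noteq> 0" "w \<noteq> 0" "t1 \<noteq> 0" "t2 \<noteq> 0" "t3 \<noteq> 0" by auto
  then show ?thesis
  proof cases
    case 1
    then show ?thesis by (auto simp: bracket_simps \<beta>_simps)
  next
    case 2
    then show ?thesis using cocycle_H[OF u(2,3) t(2,3), of u] u(1) by (simp add: wt_0 algebra_simps)
  next
    case 3
    then show ?thesis using cocycle_H[OF u(3,1) t(3,1), of v] u(2) by (simp add: wt_0 algebra_simps)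
  next
    case 4
    then show ?thesis using cocycle_H[OF u(1,2) t(1,2), of w] u(3) by (simp add: wt_0)
  next
    case 5
    define k1 where "k1 = killing t1 x"
    define k2 where "k2 = killing t2 x"
    define k3 where "k3 = killing t3 x"
    have k: "k1 \<noteq> 0" "k2 \<noteq> 0" "k3 \<noteq> 0"
      using wt_x_nonzero u t 5 by (auto simp: k1_def k2_def k3_def)
    have "killing (t1 + t2 + t3) x = 0" by (simp add: sum0 killing_simps)
    then have ksum: "k1 + k2 + k3 = 0" by (simp add: k1_def k2_def k3_def killing_simps)
    have S_br: "S (p \<bullet> q) = - (1 / killing r x) *s (p \<bullet> q)"
      if "p \<in> wt s1" "q \<in> wt s2" "s1 + s2 + r = 0" "killing r x \<noteq> 0" for p q s1 s2 r
    proof -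
      have "s1 + s2 = - r" using that(3) by (simp add: eq_neg_iff_add_eq_0)
      then have "p \<bullet> q \<in> wt (- r)" using wt_bracket[OF that(1,2)] by simp
      then show ?thesis using S_wt[of "p \<bullet> q" "- r"] that(4) by (simp add: killing_simps)
    qed
    show ?thesis
    proof (cases "\<forall>y\<in>H. killing t1 y / k1 = killing t2 y / k2 \<and> killing t1 y / k1 = killing t3 y / k3")
      case True
      \<comment> \<open>Equal ratios for all \<open>y\<close> would make the three roots
        proportional with factors 1 or -1, and then they could not sum to 0.\<close>
      then have "t2 = (k2 / k1) *s t1" "t3 = (k3 / k1) *s t1"
        using proportional_of_ratio t k unfolding k1_def k2_def k3_def by blast+
      then have c: "k2 / k1 = 1 \<or> k2 / k1 = -1" "k3 / k1 = 1 \<or> k3 / k1 = -1"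
        using proportional_roots t u 5 by blast+
      have "1 + k2 / k1 + k3 / k1 = 0" using ksum k by (simp add: field_simps)
      then have False using c by auto
      then show ?thesis ..
    next
      case False
      then obtain y where y: "y \<in> H"
        "\<not> (killing t1 y / k1 = killing t2 y / k2 \<and> killing t1 y / k1 = killing t3 y / k3)" by blast
      define a1 where "a1 = killing t1 y / k1"
      define a2 where "a2 = killing t2 y / k2"
      define a3 where "a3 = killing t3 y / k3"
      have "killing (t1 + t2 + t3) y = 0" by (simp add: sum0 killing_simps)
      then have asum: "k1 * a1 + k2 * a2 + k3 * a3 = 0"
        using k by (simp add: a1_def a2_def a3_def killing_simps)
      \<comment> \<open>\<open>(k1, k2, k3)\<close> is orthogonal to \<open>(1, 1, 1)\<close> and to
        \<open>(a1, a2, a3)\<close>, so it is proportional to their cross product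
        \<open>(a3 - a2, a1 - a3, a2 - a1)\<close>; \<open>\<mu>\<close> is the factor.\<close>
      define \<mu> where "\<mu> = (a3 - a2) / k1"
      have m1: "a3 - a2 = \<mu> * k1" using k by (simp add: \<mu>_def)
      have k3: "k3 = - k1 - k2" using ksum by (simp add: algebra_simps eq_neg_iff_add_eq_0)
      have "k1 * (a1 - a3) = k2 * (a3 - a2)" using asum unfolding k3 by (simp add: algebra_simps)
      then have "k1 * (a1 - a3) = k1 * (\<mu> * k2)" by (simp add: m1 mult.commute)
      then have m2: "a1 - a3 = \<mu> * k2" using k mult_left_cancel by blast
      have "a2 - a1 = - (a3 - a2) - (a1 - a3)" by simp
      then have m3: "a2 - a1 = \<mu> * k3" unfolding m1 m2 k3 by (simp add: algebra_simps)
      have "\<mu> \<noteq> 0" using y(2) m1 m2 unfolding a1_def[symmetric] a2_def[symmetric] a3_def[symmetric] by auto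
      have sums: "t1 + t2 + t3 = 0" "t2 + t1 + t3 = 0" "t1 + t3 + t2 = 0" "t3 + t1 + t2 = 0"
        "t2 + t3 + t1 = 0" "t3 + t2 + t1 = 0" using sum0 by (simp_all add: algebra_simps)
      have S1: "S (u \<bullet> y) = - a1 *s u" and S2: "S (v \<bullet> y) = - a2 *s v" and S3: "S (w \<bullet> y) = - a3 *s w"
        using S_bracket_H u k y(1) unfolding a1_def a2_def a3_def k1_def k2_def k3_def by blast+
      have "\<beta> (S (u \<bullet> S (v \<bullet> y))) w + \<beta> (S (v \<bullet> S (u \<bullet> y))) w +
        \<beta> (S (u \<bullet> S (w \<bullet> y))) v + \<beta> (S (w \<bullet> S (u \<bullet> y))) v +
        \<beta> (S (v \<bullet> S (w \<bullet> y))) u + \<beta> (S (w \<bullet> S (v \<bullet> y))) u = 0"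
        using \<beta>3[OF H_in[OF y(1)] wt_in[OF u(1)] wt_in[OF u(2)] wt_in[OF u(3)]] E_H[OF y(1)] by simp
      then have "a2 / k3 * \<beta> (u \<bullet> v) w + a1 / k3 * \<beta> (v \<bullet> u) w + a3 / k2 * \<beta> (u \<bullet> w) v
          + a1 / k2 * \<beta> (w \<bullet> u) v + a3 / k1 * \<beta> (v \<bullet> w) u + a2 / k1 * \<beta> (w \<bullet> v) u = 0"
        unfolding S1 S2 S3
        using S_br[OF u(1,2) sums(1)] S_br[OF u(2,1) sums(2)] S_br[OF u(1,3) sums(3)]
          S_br[OF u(3,1) sums(4)] S_br[OF u(2,3) sums(5)] S_br[OF u(3,2) sums(6)] k
        by (simp add: bracket_simps lin_simps[OF lin_S] \<beta>_simps k1_def k2_def k3_def)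
      moreover have "\<beta> (v \<bullet> u) w = - \<beta> (u \<bullet> v) w" "\<beta> (u \<bullet> w) v = - \<beta> (w \<bullet> u) v" "\<beta> (w \<bullet> v) u = - \<beta> (v \<bullet> w) u"
        by (subst bracket_anti, simp add: \<beta>_simps)+
      ultimately have "(a2 - a1) / k3 * \<beta> (u \<bullet> v) w + (a1 - a3) / k2 * \<beta> (w \<bullet> u) v + (a3 - a2) / k1 * \<beta> (v \<bullet> w) u = 0"
        by (simp add: diff_divide_distrib algebra_simps)
      then have "\<mu> * (\<beta> (u \<bullet> v) w + \<beta> (v \<bullet> w) u + \<beta> (w \<bullet> u) v) = 0"
        unfolding m1 m2 m3 using k by (simp add: algebra_simps)
      then show ?thesis using \<open>\<mu> \<noteq> 0\<close> by simp
    qed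
  qed
qed

lemma \<beta>_cocycle:
  assumes "a \<in> span Bs" "b \<in> span Bs" "c \<in> span Bs"
  shows "\<beta> (a \<bullet> b) c + \<beta> (b \<bullet> c) a + \<beta> (c \<bullet> a) b = 0"
proof -
  let ?W = "\<Union>t\<in>H. wt t" and ?d = "\<lambda>a b c. \<beta> (a \<bullet> b) c + \<beta> (b \<bullet> c) a + \<beta> (c \<bullet> a) b"
  have ext: "F v = 0" if "v \<in> span ?W" "\<And>w. w \<in> ?W \<Longrightarrow> F w = 0"
    "\<And>r u v. F (r *s u + v) = r * F u + F v" for F :: "'b \<Rightarrow> 'a" and v
    using that(1)
  proof (induction rule: span_induct_alt)
    case base
    show ?case using that(3)[of 1 0 0] by simp
  qed (use that in auto)
  have W: "v \<in> span ?W" if "v \<in> span Bs" for v using that wt_span by blast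
  have 1: "?d a b c = 0" if ab: "a \<in> ?W" "b \<in> ?W" for a b
  proof (rule ext[OF W[OF assms(3)], of "?d a b"])
    show "?d a b w = 0" if "w \<in> ?W" for w using ab that cocycle_wt by blast
  qed (simp add: bracket_simps \<beta>_simps algebra_simps)
  have 2: "?d a b c = 0" if a: "a \<in> ?W" for a
  proof (rule ext[OF W[OF assms(2)], of "\<lambda>b. ?d a b c"])
    show "?d a w c = 0" if "w \<in> ?W" for w using a that by (rule 1)
  qed (simp add: bracket_simps \<beta>_simps algebra_simps)
  show ?thesis
  proof (rule ext[OF W[OF assms(1)], of "\<lambda>a. ?d a b c"])
    show "?d w b c = 0" if "w \<in> ?W" for w using that by (rule 2)
  qed (simp add: bracket_simps \<beta>_simps algebra_simps)
qed

end

section \<open>Linear pencils\<close>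

locale findim_vs_operators = finite_dimensional_vector_space scale Basis + vs_operators scale
  for scale :: "'a::field_char_0 \<Rightarrow> 'b::ab_group_add \<Rightarrow> 'b" (infixr "*s" 75) and Basis :: "'b set"
begin

abbreviation coord :: "'b \<Rightarrow> 'b \<Rightarrow> 'a" where "coord \<equiv> representation Basis"

lemma coord_sum: "(\<Sum>b\<in>Basis. coord v b *s b) = v"
  using sum_rep_eq[OF independent_Basis finite_Basis] span_Basis by simp

lemma lin_coord_sum: "lin F \<Longrightarrow> (\<Sum>b\<in>Basis. coord v b *s F b) = F v"
  by (subst (2) coord_sum[symmetric]) (simp add: lin_simps)

abbreviation rank :: "('b \<Rightarrow> 'b) \<Rightarrow> nat" where "rank f \<equiv> dim (range f)"

lemma lin_pencil: "lin A \<Longrightarrow> lin B \<Longrightarrow> lin (\<lambda>v. A v + t *s B v)"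
  by (rule linI) (simp_all add: lin_simps scale_right_distrib scale_left_commute)

lemma span_image_finite:
  assumes "finite F" "inj_on p F" "v \<in> span (p ` F)"
  obtains c where "v = (\<Sum>s\<in>F. c s *s p s)"
proof -
  obtain u where "v = (\<Sum>w\<in>p ` F. u w *s w)" using assms(1,3) by (auto simp: span_finite)
  then have "v = (\<Sum>s\<in>F. u (p s) *s p s)" using assms(2) by (simp add: sum.reindex)
  then show ?thesis by (rule that)
qed

lemma independent_image_sum_0:
  assumes "independent (p ` F)" "finite F" "inj_on p F" "(\<Sum>s\<in>F. c s *s p s) = 0" "s \<in> F"
  shows "c s = 0"
proof -
  have "(\<Sum>w\<in>p ` F. c (inv_into F p w) *s w) = (\<Sum>s\<in>F. c s *s p s)"
    using assms(3) by (simp add: sum.reindex)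
  then have "c (inv_into F p (p s)) = 0"
    using independentD[OF assms(1), of "p ` F" "\<lambda>w. c (inv_into F p w)" "p s"] assms by simp
  then show ?thesis using assms by simp
qed

text \<open>A linear relation between solutions of \<open>(A + t B) p = v\<close> for different \<open>t\<close> replaces the
  expansion of \<open>(A + t B)\<^sup>-\<^sup>1 v\<close> in powers of \<open>t\<close>.\<close>

lemma pencil_relation:
  assumes A: "lin A" and B: "lin B" and P: "subspace P" "\<And>v. v \<in> P \<Longrightarrow> A v = 0 \<Longrightarrow> v = 0"
    and T: "infinite T" "0 \<notin> T" "\<And>t. t \<in> T \<Longrightarrow> p t \<in> P" "\<And>t. t \<in> T \<Longrightarrow> A (p t) + t *s B (p t) = v"
  obtains F t c where "finite F" "F \<subseteq> T" "t \<in> T" "p t = (\<Sum>s\<in>F. c s *s p s)"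
    "(\<Sum>s\<in>F. c s * (t / s)) \<noteq> 1"
    "(1 - (\<Sum>s\<in>F. c s * (t / s))) *s v = A (\<Sum>s\<in>F. (c s * (1 - t / s)) *s p s)"
proof -
  obtain C where C: "C \<subseteq> p ` T" "independent C" "p ` T \<subseteq> span C" by (rule basis_exists[of "p ` T"])
  obtain F where F: "F \<subseteq> T" "inj_on p F" "C = p ` F" using C(1) by (auto simp: subset_image_inj)
  have finF: "finite F" using finiteI_independent[OF C(2)] F finite_image_iff by blast
  obtain t where t: "t \<in> T" "t \<notin> F" using T(1) finF by (metis finite_subset subsetI)
  obtain c where c: "p t = (\<Sum>s\<in>F. c s *s p s)"
    using span_image_finite[OF finF F(2)] C(3) F(3) t(1) by blast
  define \<kappa> where "\<kappa> = (\<Sum>s\<in>F. c s * (t / s))"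
  \<comment> \<open>The equation at \<open>s\<close> eliminates \<open>B (p s)\<close>, which
    expresses \<open>A + t B\<close> at \<open>p s\<close> by \<open>A\<close> and \<open>v\<close>
    alone.\<close>
  have Ft: "A (p s) + t *s B (p s) = (1 - t / s) *s A (p s) + (t / s) *s v" if "s \<in> F" for s
  proof -
    have s: "s \<in> T" "s \<noteq> 0" using that F T(2) by auto
    have "(t / s) *s v = (t / s) *s A (p s) + t *s B (p s)"
      unfolding T(4)[OF s(1), symmetric] using s(2) by (simp add: scale_right_distrib)
    then show ?thesis by (simp add: scale_left_diff_distrib)
  qed
  have "v = A (p t) + t *s B (p t)" using T(4)[OF t(1)] by simp
  also have "\<dots> = (\<Sum>s\<in>F. c s *s (A (p s) + t *s B (p s)))"
    by (simp add: c lin_simps[OF A] lin_simps[OF B] sum.distrib scale_right_distrib scale_sum_right mult.commute)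
  also have "\<dots> = (\<Sum>s\<in>F. c s *s ((1 - t / s) *s A (p s) + (t / s) *s v))"
    by (intro sum.cong refl) (simp only: Ft)
  also have "\<dots> = A (\<Sum>s\<in>F. (c s * (1 - t / s)) *s p s) + \<kappa> *s v"
    by (simp only: lin_simps[OF A] \<kappa>_def scale_sum_left scale_right_distrib sum.distrib scale_scale)
  finally have eq: "(1 - \<kappa>) *s v = A (\<Sum>s\<in>F. (c s * (1 - t / s)) *s p s)"
    by (simp add: scale_left_diff_distrib diff_eq_eq)
  \<comment> \<open>If the coefficient of \<open>v\<close> vanished, injectivity of \<open>A\<close>
    on \<open>P\<close> and independence of the \<open>p s\<close> would give \<open>c = 0\<close>;
    the factors \<open>1 - t / s\<close> are nonzero because \<open>t\<close> is not in
    \<open>F\<close>.\<close>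
  have "\<kappa> \<noteq> 1"
  proof
    assume "\<kappa> = 1"
    then have "A (\<Sum>s\<in>F. (c s * (1 - t / s)) *s p s) = 0" using eq by simp
    moreover have "(\<Sum>s\<in>F. (c s * (1 - t / s)) *s p s) \<in> P"
      using P(1) F(1) T(3) by (intro subspace_sum subspace_scale) auto
    ultimately have "(\<Sum>s\<in>F. (c s * (1 - t / s)) *s p s) = 0" using P(2) by blast
    then have "c s * (1 - t / s) = 0" if "s \<in> F" for s
      using independent_image_sum_0[of p F "\<lambda>s. c s * (1 - t / s)"] C(2) F finF that by simp
    moreover have "1 - t / s \<noteq> 0" if "s \<in> F" for s using that t(2) F(1) T(2) by auto
    ultimately have "c s = 0" if "s \<in> F" for s using that by (metis mult_eq_0_iff)
    then have "\<kappa> = 0" by (simp add: \<kappa>_def)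
    then show False using \<open>\<kappa> = 1\<close> by simp
  qed
  then show ?thesis using that[OF finF F(1) t(1) c] eq by (simp add: \<kappa>_def)
qed

text \<open>This replaces the passage to \<open>t = 0\<close>. That the solution lies in the span of
  the \<open>p t\<close> lets linear conditions on them pass to it.\<close>

lemma pencil_solve:
  assumes "lin A" "lin B" "subspace P" "\<And>v. v \<in> P \<Longrightarrow> A v = 0 \<Longrightarrow> v = 0"
    "infinite T" "0 \<notin> T" "\<And>t. t \<in> T \<Longrightarrow> p t \<in> P" "\<And>t. t \<in> T \<Longrightarrow> A (p t) + t *s B (p t) = v"
  obtains z where "z \<in> span (p ` T)" "A z = v"
proof -
  obtain F t c where F: "finite F" "F \<subseteq> T" "(\<Sum>s\<in>F. c s * (t / s)) \<noteq> 1"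
    "(1 - (\<Sum>s\<in>F. c s * (t / s))) *s v = A (\<Sum>s\<in>F. (c s * (1 - t / s)) *s p s)"
    by (rule pencil_relation[OF assms])
  define k where "k = 1 - (\<Sum>s\<in>F. c s * (t / s))"
  define z where "z = (1 / k) *s (\<Sum>s\<in>F. (c s * (1 - t / s)) *s p s)"
  have "k \<noteq> 0" using F(3) by (simp add: k_def)
  then have "A z = v" using F(4)[folded k_def] by (simp add: z_def lin_scale[OF assms(1)] flip: F(4)[folded k_def])
  moreover have "z \<in> span (p ` T)"
    unfolding z_def using F(2) by (intro span_scale span_sum span_base) auto
  ultimately show ?thesis using that by blast
qed

text \<open>As for eigenvectors, kernel vectors belonging to distinct \<open>t\<close> are
  independent, so there are no more such \<open>t\<close> than the dimension.\<close>

lemma pencil_kernel_finite: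
  assumes A: "lin A" and B: "lin B" and P: "subspace P" "\<And>v. v \<in> P \<Longrightarrow> A v = 0 \<Longrightarrow> v = 0"
  shows "finite {t. \<exists>p\<in>P. p \<noteq> 0 \<and> A p + t *s B p = 0}"
proof (rule ccontr)
  assume inf: "\<not> ?thesis"
  let ?T = "{t. \<exists>p\<in>P. p \<noteq> 0 \<and> A p + t *s B p = 0}"
  have "\<forall>t\<in>?T. \<exists>p. p \<in> P \<and> p \<noteq> 0 \<and> A p + t *s B p = 0" by auto
  then obtain p where p: "\<And>t. t \<in> ?T \<Longrightarrow> p t \<in> P \<and> p t \<noteq> 0 \<and> A (p t) + t *s B (p t) = 0"
    using bchoice[of ?T "\<lambda>t p. p \<in> P \<and> p \<noteq> 0 \<and> A p + t *s B p = 0"] by blast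
  have T0: "0 \<notin> ?T" using P(2) by auto
  have Bp: "B (p s) = - ((1 / s) *s A (p s))" if "s \<in> ?T" for s
  proof -
    have "s \<noteq> 0" using that T0 by auto
    have "A (p s) = - (s *s B (p s))" using p[OF that] by (simp add: eq_neg_iff_add_eq_0)
    then show ?thesis using \<open>s \<noteq> 0\<close> by simp
  qed
  have "independent (p ` F) \<and> inj_on p F" if "finite F" "F \<subseteq> ?T" for F
    using that
  proof (induction F)
    case (insert t F)
    have IH: "independent (p ` F)" "inj_on p F" using insert by auto
    have tT: "t \<in> ?T" using insert.prems by auto
    have "p t \<notin> span (p ` F)"
    proof
      assume "p t \<in> span (p ` F)"
      then obtain c where c: "p t = (\<Sum>s\<in>F. c s *s p s)"
        using span_image_finite[OF insert.hyps(1) IH(2)] by blast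
      have "0 = A (p t) + t *s B (p t)" using p[OF tT] by simp
      also have "\<dots> = (\<Sum>s\<in>F. c s *s (A (p s) + t *s B (p s)))"
        by (simp add: c lin_simps[OF A] lin_simps[OF B] sum.distrib scale_right_distrib scale_sum_right mult.commute)
      also have "\<dots> = (\<Sum>s\<in>F. (c s * (1 - t / s)) *s A (p s))"
      proof (intro sum.cong refl)
        fix s assume "s \<in> F"
        then have "s \<in> ?T" using insert.prems by auto
        then show "c s *s (A (p s) + t *s B (p s)) = (c s * (1 - t / s)) *s A (p s)"
          by (simp add: Bp scale_left_diff_distrib scale_right_diff_distrib right_diff_distrib)
      qed
      also have "\<dots> = A (\<Sum>s\<in>F. (c s * (1 - t / s)) *s p s)" by (simp add: lin_simps[OF A])
      finally have "A (\<Sum>s\<in>F. (c s * (1 - t / s)) *s p s) = 0" by simp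
      moreover have "(\<Sum>s\<in>F. (c s * (1 - t / s)) *s p s) \<in> P"
        using P(1) p insert.prems by (intro subspace_sum subspace_scale) auto
      ultimately have "(\<Sum>s\<in>F. (c s * (1 - t / s)) *s p s) = 0" using P(2) by blast
      then have "c s * (1 - t / s) = 0" if "s \<in> F" for s
        using independent_image_sum_0[of p F "\<lambda>s. c s * (1 - t / s)"] IH insert.hyps that by simp
      moreover have "1 - t / s \<noteq> 0" if "s \<in> F" for s
        using that insert.hyps insert.prems T0 by auto
      ultimately have "c s = 0" if "s \<in> F" for s using that by (metis mult_eq_0_iff)
      then have "p t = 0" by (simp add: c)
      then show False using p[OF tT] by simp
    qed
    then show ?case using IH independent_insertI[of "p t" "p ` F"] by (auto intro: span_base)
  qed (simp add: independent_empty)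
  moreover obtain F where F: "finite F" "F \<subseteq> ?T" "card F = Suc (card Basis)"
    using infinite_arbitrarily_large[OF inf] by blast
  ultimately have "independent (p ` F)" "card (p ` F) = Suc (card Basis)" by (auto simp: card_image)
  then show False using independent_card_le_dim[of "p ` F" UNIV] dim_UNIV by simp
qed

section \<open>Rank along a pencil\<close>

lemma image_complement:
  assumes "lin A"
  obtains P where "subspace P" "\<And>v. v \<in> P \<Longrightarrow> A v = 0 \<Longrightarrow> v = 0" "A ` P = range A"
proof -
  interpret vector_space_pair scale scale by unfold_locales
  obtain C where C: "C \<subseteq> range A" "independent C" "range A \<subseteq> span C" by (rule basis_exists[of "range A"])
  have "\<forall>c\<in>C. \<exists>v. A v = c" using C(1) by auto
  then obtain q where q: "\<And>c. c \<in> C \<Longrightarrow> A (q c) = c" by metis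
  obtain g where g: "lin g" "\<And>c. c \<in> C \<Longrightarrow> g c = q c" using linear_independent_extend[OF C(2), of q] by blast
  have Ag: "A (g v) = v" if "v \<in> range A" for v
  proof -
    have "v \<in> span C" using that C by blast
    moreover have "lin (\<lambda>v. A (g v) - v)"
      by (rule linI) (simp_all add: lin_simps[OF assms] lin_simps[OF g(1)] scale_right_diff_distrib)
    moreover have "A (g c) - c = 0" if "c \<in> C" for c using q[OF that] g(2)[OF that] by simp
    ultimately have "A (g v) - v = 0" by (rule lin_eq_0_span[rotated 2])
    then show ?thesis by simp
  qed
  have "subspace (range A)" using lin_subspace_image[OF assms subspace_UNIV] .
  then have "subspace (g ` range A)" by (rule lin_subspace_image[OF g(1)])
  moreover have "v = 0" if v: "v \<in> g ` range A" "A v = 0" for v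
  proof -
    obtain u where u: "v = g (A u)" using v(1) by auto
    then have "A u = 0" using Ag[of "A u"] v(2) by simp
    then show ?thesis using u lin_0[OF g(1)] by simp
  qed
  moreover have "A ` g ` range A = range A" by (simp add: image_image Ag)
  ultimately show ?thesis by (rule that)
qed

lemma dim_image_inj:
  assumes "lin A" "subspace P" "\<And>v. v \<in> P \<Longrightarrow> A v = 0 \<Longrightarrow> v = 0"
  shows "dim (A ` P) = dim P"
proof -
  interpret finite_dimensional_vector_space_pair_1 scale Basis scale by unfold_locales
  show ?thesis
    using dim_image_eq[OF assms(1), of P] lin_inj_onI[OF assms] assms(2) span_eq_iff by metis
qed

text \<open>\<open>A\<close> is injective on a complement \<open>P\<close> of its kernel, and for
  all but finitely many \<open>t\<close> so is \<open>A + t B\<close>.\<close>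

lemma rank_pencil_finite:
  assumes A: "lin A" and B: "lin B"
  shows "finite {t. rank (\<lambda>v. A v + t *s B v) < rank A}"
proof -
  obtain P where P: "subspace P" "\<And>v. v \<in> P \<Longrightarrow> A v = 0 \<Longrightarrow> v = 0" "A ` P = range A"
    using image_complement[OF A] by blast
  have "rank A \<le> rank (\<lambda>v. A v + t *s B v)" if "\<not> (\<exists>p\<in>P. p \<noteq> 0 \<and> A p + t *s B p = 0)" for t
  proof -
    have "rank A = dim P" using dim_image_inj[OF A P(1,2)] P(3) by simp
    also have "\<dots> = dim ((\<lambda>v. A v + t *s B v) ` P)"
      by (rule dim_image_inj[OF lin_pencil[OF A B] P(1), symmetric]) (use that in auto)
    also have "\<dots> \<le> rank (\<lambda>v. A v + t *s B v)" by (rule dim_subset) auto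
    finally show ?thesis .
  qed
  then have "{t. rank (\<lambda>v. A v + t *s B v) < rank A} \<subseteq> {t. \<exists>p\<in>P. p \<noteq> 0 \<and> A p + t *s B p = 0}"
    by (auto simp: not_le[symmetric])
  then show ?thesis using pencil_kernel_finite[OF A B P(1,2)] finite_subset by blast
qed

lemma infinite_cofinite: "finite (T :: 'a set) \<Longrightarrow> infinite (- T)"
  using infinite_UNIV_char_0[where 'a = 'a] by (metis Compl_eq_Diff_UNIV Diff_infinite_finite)

text \<open>For almost all \<open>t\<close>, \<open>A + t B\<close> is injective on
  \<open>P\<close>, so by maximality of the rank it maps \<open>P\<close> onto its whole range. That
  range contains \<open>B y = (A + t B) (y / t)\<close>, and \<open>pencil_solve\<close> passes to
  \<open>t = 0\<close>.\<close>

lemma rank_neutral: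
  assumes A: "lin A" and B: "lin B" and r: "\<And>t. rank (\<lambda>v. A v + t *s B v) \<le> rank A" and y: "A y = 0"
  obtains z where "B y = A z"
proof -
  obtain P where P: "subspace P" "\<And>v. v \<in> P \<Longrightarrow> A v = 0 \<Longrightarrow> v = 0" "A ` P = range A"
    using image_complement[OF A] by blast
  define T where "T = - insert 0 {t. \<exists>p\<in>P. p \<noteq> 0 \<and> A p + t *s B p = 0}"
  have T: "infinite T" "0 \<notin> T"
    unfolding T_def using pencil_kernel_finite[OF A B P(1,2)]
    by (intro infinite_cofinite finite.insertI) auto
  have "\<exists>p\<in>P. A p + t *s B p = B y" if t: "t \<in> T" for t
  proof -
    let ?C = "\<lambda>v. A v + t *s B v"
    have C: "lin ?C" by (rule lin_pencil[OF A B])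
    have "dim (?C ` P) = rank A"
      using dim_image_inj[OF C P(1)] t dim_image_inj[OF A P(1,2)] P(3) by (auto simp: T_def)
    then have "dim (range ?C) \<le> dim (?C ` P)" using r by simp
    then have eq: "?C ` P = range ?C"
      using subspace_dim_equal[OF lin_subspace_image[OF C P(1)] lin_subspace_image[OF C subspace_UNIV]] by blast
    have "?C ((1 / t) *s y) = B y"
      using t y by (simp add: T_def lin_simps[OF A] lin_simps[OF B])
    then have "B y \<in> ?C ` P" unfolding eq by (rule range_eqI[OF sym])
    then show ?thesis by auto
  qed
  then obtain p where p: "\<And>t. t \<in> T \<Longrightarrow> p t \<in> P" "\<And>t. t \<in> T \<Longrightarrow> A (p t) + t *s B (p t) = B y" by metis
  obtain z where "A z = B y" by (rule pencil_solve[OF A B P(1,2) T p])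
  then show ?thesis using that by metis
qed

text \<open>The kernels of the powers grow strictly until they stabilise, hence at most
  \<open>card Basis\<close> times. The uniform exponent turns nilpotency along a pencil into a
  polynomial condition in \<open>t\<close>.\<close>

lemma nilpotency_index:
  assumes f: "lin f" and "(f ^^ k) v = 0"
  shows "(f ^^ card Basis) v = 0"
proof -
  let ?K = "\<lambda>i. {v. (f ^^ i) v = 0}"
  have K: "subspace (?K i)" for i
    by (rule subspaceI) (auto simp: lin_simps[OF lin_funpow[OF f]])
  have mono: "?K i \<subseteq> ?K (Suc i)" for i by (auto simp: lin_0[OF f])
  have "\<exists>i\<le>card Basis. ?K i = ?K (Suc i)"
  proof (rule ccontr)
    assume n: "\<not> ?thesis"
    have "i \<le> Suc (card Basis) \<Longrightarrow> i \<le> dim (?K i)" for i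
    proof (induction i)
      case (Suc i)
      then have "?K i \<subset> ?K (Suc i)" using n mono by auto
      then have "dim (?K i) < dim (?K (Suc i))" using K by (intro dim_psubset) (simp only: span_eq_iff[THEN iffD2])
      then show ?case using Suc by simp
    qed simp
    then have "Suc (card Basis) \<le> dim (?K (Suc (card Basis)))" by blast
    also have "\<dots> \<le> card Basis" using dim_subset_UNIV by (simp add: dimension_def)
    finally show False by simp
  qed
  then obtain i where i: "i \<le> card Basis" "?K i = ?K (Suc i)" by blast
  have stab: "(f ^^ (i + j)) v = 0 \<Longrightarrow> (f ^^ i) v = 0" for j
  proof (induction j)
    case (Suc j)
    have "(f ^^ Suc i) ((f ^^ j) v) = 0" using Suc.prems by (simp add: funpow_add)
    then have "(f ^^ i) ((f ^^ j) v) = 0" using i(2) by blast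
    then show ?case using Suc.IH by (simp add: funpow_add)
  qed simp
  have up: "(f ^^ a) v = 0 \<Longrightarrow> (f ^^ (b + a)) v = 0" for a b
    by (simp add: funpow_add lin_0[OF lin_funpow[OF f]])
  have "(f ^^ i) v = 0" using stab[of k] up[OF assms(2), of i] by simp
  then show ?thesis using up[of i "card Basis - i"] i(1) by simp
qed

text \<open>The top coefficient is what matters: if \<open>(A + t B)^k v\<close> vanishes for
  infinitely many \<open>t\<close>, then \<open>B^k v = 0\<close>.\<close>

lemma pencil_funpow:
  assumes A: "lin A" and B: "lin B"
  shows "\<exists>c. c k = (B ^^ k) v \<and> (\<forall>t. ((\<lambda>v. A v + t *s B v) ^^ k) v = (\<Sum>i\<le>k. t ^ i *s c i))"
proof (induction k)
  case 0
  show ?case by (intro exI[of _ "\<lambda>_. v"]) simp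
next
  case (Suc k)
  then obtain c where c: "c k = (B ^^ k) v"
    "\<And>t. ((\<lambda>v. A v + t *s B v) ^^ k) v = (\<Sum>i\<le>k. t ^ i *s c i)" by blast
  define c' where "c' i = (if i \<le> k then A (c i) else 0) + (if i = 0 then 0 else B (c (i - 1)))" for i
  have "((\<lambda>v. A v + t *s B v) ^^ Suc k) v = (\<Sum>i\<le>Suc k. t ^ i *s c' i)" for t
  proof -
    have "((\<lambda>v. A v + t *s B v) ^^ Suc k) v = (\<Sum>i\<le>k. t ^ i *s A (c i)) + (\<Sum>i\<le>k. t ^ Suc i *s B (c i))"
      by (simp add: c lin_simps[OF A] lin_simps[OF B] scale_sum_right)
    also have "(\<Sum>i\<le>k. t ^ i *s A (c i)) = (\<Sum>i\<le>Suc k. t ^ i *s (if i \<le> k then A (c i) else 0))" by simp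
    also have "(\<Sum>i\<le>k. t ^ Suc i *s B (c i)) = (\<Sum>i\<le>Suc k. t ^ i *s (if i = 0 then 0 else B (c (i - 1))))"
      by (subst sum.atMost_Suc_shift) simp
    also have "(\<Sum>i\<le>Suc k. t ^ i *s (if i \<le> k then A (c i) else 0)) + \<dots> = (\<Sum>i\<le>Suc k. t ^ i *s c' i)"
      unfolding c'_def scale_right_distrib sum.distrib ..
    finally show ?thesis .
  qed
  moreover have "c' (Suc k) = (B ^^ Suc k) v" by (simp add: c'_def c)
  ultimately show ?case by blast
qed

lemma vector_polynomial_0:
  assumes "infinite T" "\<And>t. t \<in> T \<Longrightarrow> (\<Sum>i\<le>n. t ^ i *s c i) = 0" "j \<le> n"
  shows "c j = 0"
proof -
  have "coord (c j) b = 0" for b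
  proof -
    let ?p = "\<Sum>i\<le>n. Polynomial.monom (coord (c i) b) i"
    have "poly ?p t = 0" if "t \<in> T" for t
    proof -
      have "poly ?p t = (\<Sum>i\<le>n. t ^ i * coord (c i) b)" by (simp add: poly_sum poly_monom mult.commute)
      also have "\<dots> = coord (\<Sum>i\<le>n. t ^ i *s c i) b"
        by (simp add: representation_sum representation_scale independent_Basis span_Basis)
      finally show ?thesis using assms(2)[OF that] by (simp add: representation_zero)
    qed
    then have "T \<subseteq> {t. poly ?p t = 0}" by auto
    then have "?p = 0" using assms(1) poly_roots_finite finite_subset by blast
    moreover have "Polynomial.coeff ?p j = coord (c j) b"
      unfolding coeff_sum coeff_monom using assms(3) by simp
    ultimately show ?thesis by (metis Polynomial.coeff_0)
  qed
  then show ?thesis using coord_sum[of "c j"] by simp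
qed

end

section \<open>Extension of scalars to the algebraic closure\<close>

text \<open>Resolution produces eta-expanded terms at function types, on which the pointwise simp rules
  would fire and unfold the vector space operations.\<close>

lemmas fun_ops = plus_fun_apply zero_fun_apply minus_apply uminus_apply

declare fun_ops [simp del]

lemma sum_fun_apply: "sum f A z = (\<Sum>a\<in>A. f a z)"
  by (induction A rule: infinite_finite_induct) (auto simp: fun_ops)

lemma polarise_cubic:
  fixes T :: "'b::ab_group_add \<Rightarrow> 'b \<Rightarrow> 'b \<Rightarrow> 'a::ab_group_add"
  assumes add: "\<And>a a' b c. T (a + a') b c = T a b c + T a' b c" "\<And>a b b' c. T a (b + b') c = T a b c + T a b' c"
    "\<And>a b c c'. T a b (c + c') = T a b c + T a b c'"
    and diag: "\<And>u. T u u u = 0"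
  shows "T u v w + T v u w + T u w v + T w u v + T v w u + T w v u = 0"
proof -
  let ?c = "\<lambda>u. T u u u"
  have "T u v w + T v u w + T u w v + T w u v + T v w u + T w v u =
    ?c (u + v + w) - ?c (u + v) - ?c (u + w) - ?c (v + w) + ?c u + ?c v + ?c w"
    unfolding add by (simp only: algebra_simps)
  then show ?thesis by (simp only: diag) simp
qed

locale findim_lie_algebra = findim_vs_operators scale Basis + lie_algebra scale bracket
  for scale :: "'a::field_char_0 \<Rightarrow> 'b::ab_group_add \<Rightarrow> 'b" (infixr "*s" 75)
    and Basis :: "'b set" and bracket :: "'b \<Rightarrow> 'b \<Rightarrow> 'b" (infixl "\<bullet>" 70)
begin

sublocale fd_lie_algebra scale bracket Basis
  by unfold_locales (auto simp: finite_Basis independent_Basis span_Basis)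

text \<open>The extension of scalars is modelled by coordinate functions with respect to
  \<open>Basis\<close>. Values off \<open>Basis\<close> are ignored by \<open>xmap\<close>,
  \<open>xbracket\<close> and \<open>xform\<close>; the extended algebra proper is the span of the
  embedded basis.\<close>

definition xscale :: "'a alg_closure \<Rightarrow> ('b \<Rightarrow> 'a alg_closure) \<Rightarrow> 'b \<Rightarrow> 'a alg_closure" where
  "xscale c f = (\<lambda>z. c * f z)"

definition embed :: "'b \<Rightarrow> 'b \<Rightarrow> 'a alg_closure" where
  "embed y = (\<lambda>z. if z \<in> Basis then to_ac (coord y z) else 0)"

definition xmap :: "('b \<Rightarrow> 'b) \<Rightarrow> ('b \<Rightarrow> 'a alg_closure) \<Rightarrow> 'b \<Rightarrow> 'a alg_closure" where
  "xmap F f = (\<Sum>b\<in>Basis. xscale (f b) (embed (F b)))"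

definition xbracket :: "('b \<Rightarrow> 'a alg_closure) \<Rightarrow> ('b \<Rightarrow> 'a alg_closure) \<Rightarrow> 'b \<Rightarrow> 'a alg_closure" where
  "xbracket f g = (\<Sum>b\<in>Basis. \<Sum>c\<in>Basis. xscale (f b * g c) (embed (b \<bullet> c)))"

definition xform :: "('b \<Rightarrow> 'b \<Rightarrow> 'a) \<Rightarrow> ('b \<Rightarrow> 'a alg_closure) \<Rightarrow> ('b \<Rightarrow> 'a alg_closure) \<Rightarrow> 'a alg_closure" where
  "xform \<beta> f g = (\<Sum>b\<in>Basis. \<Sum>c\<in>Basis. f b * g c * to_ac (\<beta> b c))"

lemma xscale_apply: "xscale c f z = c * f z"
  by (simp add: xscale_def)

lemma embed_simps: "embed (u + v) = embed u + embed v" "embed (c *s u) = xscale (to_ac c) (embed u)"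
    "embed 0 = 0" "embed (u - v) = embed u - embed v"
  by (auto simp: fun_ops embed_def xscale_def fun_eq_iff representation_add representation_scale
      representation_diff representation_zero independent_Basis span_Basis)

lemma embed_sum: "embed (sum f A) = (\<Sum>a\<in>A. embed (f a))"
  by (induction A rule: infinite_finite_induct) (auto simp: embed_simps)

lemma embed_basis: "b \<in> Basis \<Longrightarrow> embed b z = (if z = b then 1 else 0)"
  by (auto simp: embed_def representation_basis independent_Basis)

lemma embed_apply: "b \<in> Basis \<Longrightarrow> embed y b = to_ac (coord y b)"
  by (simp add: embed_def)

lemma inj_embed: "inj embed"
proof (rule injI)
  fix u v assume uv: "embed u = embed v"
  have "coord u b = coord v b" if "b \<in> Basis" for b
  proof -
    have "embed u b = embed v b" by (simp only: uv)
    then show ?thesis by (simp only: embed_apply[OF that] to_ac_eq_iff)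
  qed
  then have "(\<Sum>b\<in>Basis. coord u b *s b) = (\<Sum>b\<in>Basis. coord v b *s b)" by simp
  then show "u = v" by (simp only: coord_sum)
qed

sublocale X: vs_operators xscale
  by unfold_locales (auto simp: fun_ops xscale_def fun_eq_iff algebra_simps)

text \<open>The Lie algebra laws are demanded for all functions, including those not supported on
  \<open>Basis\<close>. The last premise disposes of the part off \<open>Basis\<close>, and
  linearity of the rest.\<close>

lemma xlin_eq_0:
  assumes F: "X.lin F" "\<And>b. b \<in> Basis \<Longrightarrow> F (embed b) = 0"
    "\<And>f. (\<And>b. b \<in> Basis \<Longrightarrow> f b = 0) \<Longrightarrow> F f = 0"
  shows "F f = 0"
proof -
  let ?p = "\<Sum>b\<in>Basis. xscale (f b) (embed b)"
  have p: "?p b = f b" if "b \<in> Basis" for b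
  proof -
    have "?p b = (\<Sum>c\<in>Basis. if c = b then f b else 0)"
      unfolding sum_fun_apply by (intro sum.cong) (auto simp: xscale_def embed_basis)
    then show ?thesis using that finite_Basis by simp
  qed
  have *: "F f = F (f - ?p) + F ?p" by (simp add: X.lin_add[OF F(1), symmetric])
  have 1: "F (f - ?p) = 0" by (rule F(3)) (simp add: p fun_ops)
  have 2: "F ?p = 0" unfolding X.lin_sum[OF F(1)] X.lin_scale[OF F(1)]
    by (intro sum.neutral ballI) (simp only: F(2) X.scale_zero_right)
  show ?thesis unfolding * 1 2 by (rule add_0)
qed

lemma xbracket_add_left: "xbracket (f + f') g = xbracket f g + xbracket f' g"
  and xbracket_add_right: "xbracket f (g + g') = xbracket f g + xbracket f g'"
  and xbracket_scale_left: "xbracket (xscale c f) g = xscale c (xbracket f g)"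
  and xbracket_scale_right: "xbracket f (xscale c g) = xscale c (xbracket f g)"
  by (simp_all add: fun_ops xbracket_def fun_eq_iff sum_fun_apply xscale_def algebra_simps sum.distrib sum_distrib_left)

lemma xbracket_0: "(\<And>b. b \<in> Basis \<Longrightarrow> f b = 0) \<Longrightarrow> xbracket f g = 0"
    "(\<And>b. b \<in> Basis \<Longrightarrow> f b = 0) \<Longrightarrow> xbracket g f = 0"
  by (simp_all add: xbracket_def)

lemma xbracket_self: "xbracket f f = 0"
proof
  fix z
  have "xbracket f f z = (\<Sum>b\<in>Basis. \<Sum>c\<in>Basis. f b * f c * embed (b \<bullet> c) z)"
    by (simp add: xbracket_def sum_fun_apply xscale_def)
  also have "\<dots> = (\<Sum>b\<in>Basis. \<Sum>c\<in>Basis. - (f c * f b * embed (c \<bullet> b) z))"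
  proof (intro sum.cong refl)
    fix b c show "f b * f c * embed (b \<bullet> c) z = - (f c * f b * embed (c \<bullet> b) z)"
      using embed_simps(4)[of 0 "c \<bullet> b"]
      by (simp add: bracket_anti[of b c] embed_simps(3) mult.commute fun_ops)
  qed
  also have "\<dots> = - (\<Sum>b\<in>Basis. \<Sum>c\<in>Basis. f b * f c * embed (b \<bullet> c) z)"
    by (subst sum.swap) (simp add: sum_negf)
  also have "\<dots> = - xbracket f f z" by (simp add: xbracket_def sum_fun_apply xscale_def)
  finally show "xbracket f f z = 0 z" by (simp add: fun_ops eq_neg_iff_add_eq_0 flip: mult_2)
qed

lemma xmap_embed: "lin F \<Longrightarrow> xmap F (embed y) = embed (F y)"
  by (subst lin_coord_sum[symmetric, of F])
     (simp_all add: xmap_def embed_sum embed_simps embed_apply)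

lemma xbracket_embed: "xbracket (embed u) (embed v) = embed (u \<bullet> v)"
proof -
  have "xbracket (embed u) (embed v) = (\<Sum>b\<in>Basis. xscale (to_ac (coord u b)) (xmap (bracket b) (embed v)))"
    by (simp add: fun_ops xbracket_def xmap_def embed_apply fun_eq_iff sum_fun_apply xscale_def sum_distrib_left mult.assoc)
  also have "\<dots> = embed (\<Sum>b\<in>Basis. coord u b *s (b \<bullet> v))"
    by (simp add: xmap_embed lin_bracket embed_sum embed_simps)
  also have "(\<Sum>b\<in>Basis. coord u b *s (b \<bullet> v)) = u \<bullet> v" by (rule lin_coord_sum[OF lin_bracket_left])
  finally show ?thesis .
qed

lemma xform_embed:
  assumes "\<And>u v w. \<beta> (u + v) w = \<beta> u w + \<beta> v w" "\<And>c u w. \<beta> (c *s u) w = c * \<beta> u w"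
    "\<And>u v w. \<beta> w (u + v) = \<beta> w u + \<beta> w v" "\<And>c u w. \<beta> w (c *s u) = c * \<beta> w u"
  shows "xform \<beta> (embed u) (embed v) = to_ac (\<beta> u v)"
proof -
  have sl: "\<beta> (sum g A) w = (\<Sum>a\<in>A. \<beta> (g a) w)" and sr: "\<beta> w (sum g A) = (\<Sum>a\<in>A. \<beta> w (g a))"
    for g :: "'b \<Rightarrow> 'b" and A w
    using assms(2)[of 0 0 w] assms(4)[of w 0 0]
    by (induction A rule: infinite_finite_induct; simp add: assms(1,3))+
  have "\<beta> u v = \<beta> (\<Sum>b\<in>Basis. coord u b *s b) (\<Sum>b\<in>Basis. coord v b *s b)" by (simp only: coord_sum)
  also have "\<dots> = (\<Sum>b\<in>Basis. \<Sum>c\<in>Basis. coord u b * coord v c * \<beta> b c)"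
    by (simp only: sl) (simp add: sr assms(2,4) sum_distrib_left mult.assoc mult.left_commute)
  finally show ?thesis by (simp add: xform_def embed_apply to_ac_sum)
qed

lemma jacobi_X: "xbracket f (xbracket g h) + xbracket g (xbracket h f) + xbracket h (xbracket f g) = 0"
proof -
  let ?J = "\<lambda>f g h. xbracket f (xbracket g h) + xbracket g (xbracket h f) + xbracket h (xbracket f g)"
  note s = xbracket_add_left xbracket_add_right xbracket_scale_left xbracket_scale_right
    X.scale_right_distrib xbracket_0
  have 1: "?J (embed a) (embed b) (embed c) = 0" for a b c
    by (simp add: xbracket_embed jacobi embed_simps(3) flip: embed_simps(1))
  have z: "xbracket 0 f = 0" "xbracket f 0 = 0" for f by (simp_all add: xbracket_0 fun_ops)
  have 2: "?J (embed a) (embed b) h = 0" for a b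
  proof (rule xlin_eq_0[of "?J (embed a) (embed b)"])
    show "X.lin (?J (embed a) (embed b))" by (rule X.linI) (simp_all add: s algebra_simps)
  qed (simp_all only: 1, simp add: xbracket_0 z fun_ops)
  have 3: "?J (embed a) g h = 0" for a
  proof (rule xlin_eq_0[of "\<lambda>g. ?J (embed a) g h"])
    show "X.lin (\<lambda>g. ?J (embed a) g h)" by (rule X.linI) (simp_all add: s algebra_simps)
  qed (simp_all only: 2, simp add: xbracket_0 z fun_ops)
  show ?thesis
  proof (rule xlin_eq_0[of "\<lambda>f. ?J f g h"])
    show "X.lin (\<lambda>f. ?J f g h)" by (rule X.linI) (simp_all add: s algebra_simps)
  qed (simp_all only: 3, simp add: xbracket_0 z fun_ops)
qed

lemma embed_expand: "embed y = (\<Sum>b\<in>Basis. xscale (to_ac (coord y b)) (embed b))"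
  by (subst coord_sum[symmetric, of y]) (simp only: embed_sum embed_simps)

lemma embed_in_span: "embed y \<in> X.span (embed ` Basis)"
  by (subst embed_expand) (intro X.span_sum X.span_scale X.span_base imageI)

lemma independent_embed: "X.independent (embed ` Basis)"
proof (rule X.independent_if_scalars_zero)
  fix u v assume u: "(\<Sum>v\<in>embed ` Basis. xscale (u v) v) = 0" and "v \<in> embed ` Basis"
  then obtain c where c: "c \<in> Basis" "v = embed c" by auto
  have "0 = (\<Sum>v\<in>embed ` Basis. xscale (u v) v) c" by (simp only: u zero_fun_apply)
  also have "\<dots> = (\<Sum>b\<in>Basis. u (embed b) * embed b c)"
    by (subst sum.reindex) (auto simp: sum_fun_apply xscale_def intro: inj_on_subset[OF inj_embed])
  also have "\<dots> = (\<Sum>b\<in>Basis. if b = c then u (embed c) else 0)"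
    by (intro sum.cong) (auto simp: embed_basis)
  also have "\<dots> = u v" using c finite_Basis by simp
  finally show "u v = 0" by simp
qed (simp add: finite_Basis)

sublocale X: ac_lie_algebra xscale xbracket "embed ` Basis"
proof unfold_locales
  show "xbracket f g \<in> X.span (embed ` Basis)" for f g
    unfolding xbracket_def by (intro X.span_sum X.span_scale embed_in_span)
qed (auto simp: xbracket_add_left xbracket_add_right xbracket_scale_left xbracket_scale_right
    xbracket_self jacobi_X finite_Basis independent_embed)

lemma X_representation:
  assumes "v \<in> X.span (embed ` Basis)" "b \<in> Basis"
  shows "X.representation (embed ` Basis) v (embed b) = v b"
proof -
  have "v \<in> X.span (embed ` Basis) \<and> X.representation (embed ` Basis) v (embed b) = v b"
    using assms(1)
  proof (induction rule: X.span_induct_alt)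
    case base
    show ?case
      by (intro conjI X.span_zero, simp only: X.representation_zero, simp add: fun_ops)
  next
    case (step c f g)
    then obtain d where d: "d \<in> Basis" "f = embed d" by auto
    then have f: "f \<in> X.span (embed ` Basis)" using embed_in_span by simp
    have "X.representation (embed ` Basis) f (embed b) = f b"
      using d assms(2) by (simp add: X.representation_basis independent_embed inj_eq[OF inj_embed] embed_basis)
    moreover have "xscale c f + g \<in> X.span (embed ` Basis)"
      using f step by (intro X.span_add X.span_scale) auto
    moreover have "X.representation (embed ` Basis) (xscale c f + g) (embed b)
        = c * X.representation (embed ` Basis) f (embed b) + X.representation (embed ` Basis) g (embed b)"
      using f step by (simp add: X.representation_add X.representation_scale independent_embed X.span_scale)
    moreover have "(xscale c f + g) b = c * f b + g b" by (simp add: plus_fun_apply xscale_apply)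
    ultimately show ?case using step by simp
  qed
  then show ?thesis by simp
qed

lemma X_killing: "X.killing (embed u) (embed v) = to_ac (killing u v)"
proof -
  have "X.killing (embed u) (embed v) = (\<Sum>b\<in>Basis. embed (u \<bullet> (v \<bullet> b)) b)"
    unfolding X.killing_def X.tr_def
    by (subst sum.reindex) (auto simp: xbracket_embed X_representation embed_in_span intro: inj_on_subset[OF inj_embed])
  then show ?thesis by (simp add: killing_def tr_def to_ac_sum embed_apply)
qed

lemma xbracket_funpow_embed: "(xbracket (embed x) ^^ k) (embed v) = embed ((bracket x ^^ k) v)"
  by (induction k) (simp_all add: xbracket_embed)

lemma cartan_nilpotency:
  assumes x: "x \<in> span {a \<bullet> b | a b. (a, b) \<in> M}"
    and \<kappa>: "\<And>a b k. (a, b) \<in> M \<Longrightarrow> k \<ge> 1 \<Longrightarrow> killing a ((bracket x ^^ k) b) = 0"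
  shows "\<exists>k. (bracket x ^^ k) v = 0"
proof -
  let ?M = "(\<lambda>(a, b). (embed a, embed b)) ` M"
  have "embed x \<in> X.span {xbracket a b | a b. (a, b) \<in> ?M}"
    using x
  proof (induction rule: span_induct_alt)
    case base
    show ?case by (simp only: embed_simps X.span_zero)
  next
    case (step c u w)
    then obtain a b where "(a, b) \<in> M" "u = a \<bullet> b" by auto
    then have "embed u \<in> {xbracket a b | a b. (a, b) \<in> ?M}" by (force simp: xbracket_embed[symmetric])
    then show ?case
      unfolding embed_simps by (intro X.span_add[OF X.span_scale[OF X.span_base] step.IH])
  qed
  then have "\<exists>k. (xbracket (embed x) ^^ k) (embed v) = 0"
    by (rule X.cartan_nilpotency)
       (auto simp: embed_in_span xbracket_funpow_embed X_killing \<kappa> simp del: One_nat_def)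
  then show ?thesis using inj_embed by (auto simp: xbracket_funpow_embed inj_def embed_simps(3)[symmetric] simp del: embed_simps(3))
qed

text \<open>\<open>?F v\<close> lists the pairings of \<open>v\<close> with the basis. It is
  injective by nondegeneracy, hence onto, and its inverse sends \<open>b\<close> to the dual
  vector.\<close>

lemma dual_basis_exists:
  assumes "\<And>v. (\<And>w. killing v w = 0) \<Longrightarrow> v = 0"
  obtains dual where "nd_lie_algebra scale bracket Basis dual"
proof -
  let ?F = "\<lambda>v. \<Sum>b\<in>Basis. killing v b *s b"
  have coordF: "coord (?F v) b = killing v b" if "b \<in> Basis" for v b
  proof -
    have "coord (?F v) b = (\<Sum>c\<in>Basis. killing v c * coord c b)"
      by (simp add: representation_sum representation_scale independent_Basis span_Basis)
    also have "\<dots> = (\<Sum>c\<in>Basis. if c = b then killing v b else 0)"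
      by (intro sum.cong) (auto simp: representation_basis independent_Basis)
    finally show ?thesis using that finite_Basis by simp
  qed
  have lF: "lin ?F"
    by (rule linI) (simp_all add: killing_simps scale_left_distrib sum.distrib scale_sum_right)
  moreover have "inj ?F"
    unfolding inj_on_def
  proof (intro ballI impI)
    fix u v assume uv: "?F u = ?F v"
    have "killing (u - v) b = 0" if "b \<in> Basis" for b
      using coordF[OF that, of u] coordF[OF that, of v] by (simp add: killing_diff uv)
    then have "killing (u - v) w = 0" for w
      using killing_eq_0_span[of Basis "u - v" w] span_Basis by simp
    then show "u = v" using assms[of "u - v"] by simp
  qed
  ultimately have surj: "surj ?F" by (rule linear_inj_imp_surj)
  define dual where "dual = inv_into UNIV ?F"
  have d: "?F (dual b) = b" for b unfolding dual_def by (rule surj_f_inv_f[OF surj])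
  have "nd_lie_algebra scale bracket Basis dual"
  proof unfold_locales
    fix b c assume bc: "b \<in> Basis" "c \<in> Basis"
    show "dual b \<in> span Basis" using span_Basis by simp
    show "killing (dual b) c = (if b = c then 1 else 0)"
    proof -
      have "killing (dual b) c = coord b c" using coordF[OF bc(2), of "dual b"] by (simp only: d)
      then show ?thesis using bc by (auto simp: representation_basis independent_Basis)
    qed
  qed
  then show ?thesis by (rule that)
qed

text \<open>The cocycle identity is multilinear, so it suffices to verify it after extension of scalars.\<close>

lemma cocycle:
  fixes \<beta> :: "'b \<Rightarrow> 'b \<Rightarrow> 'a"
  assumes nd: "\<And>v. (\<And>w. killing v w = 0) \<Longrightarrow> v = 0"
    and S: "lin S" and SX: "\<And>v. S (x \<bullet> v) = x \<bullet> S v" and XE: "\<And>v. x \<bullet> (v - S (x \<bullet> v)) = 0"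
    and E_abelian: "\<And>a b. (a - S (x \<bullet> a)) \<bullet> (b - S (x \<bullet> b)) = 0"
    and \<beta>_add: "\<And>u v w. \<beta> (u + v) w = \<beta> u w + \<beta> v w" and \<beta>_scale: "\<And>c u w. \<beta> (c *s u) w = c * \<beta> u w"
    and \<beta>_anti: "\<And>u v. \<beta> u v = - \<beta> v u"
    and \<beta>1: "\<And>a v. \<beta> (a - S (x \<bullet> a)) v = 0"
    and \<beta>2: "\<And>a u. \<beta> (S (u \<bullet> (a - S (x \<bullet> a)))) u = 0"
    and \<beta>3: "\<And>a u. \<beta> (S (u \<bullet> S (u \<bullet> (a - S (x \<bullet> a))))) u = 0"
  shows "\<beta> (a \<bullet> b) c + \<beta> (b \<bullet> c) a + \<beta> (c \<bullet> a) b = 0"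
proof -
  obtain dual where "nd_lie_algebra scale bracket Basis dual" using dual_basis_exists[OF nd] by blast
  then interpret K: nd_lie_algebra scale bracket Basis dual .
  have \<beta>_add': "\<beta> w (u + v) = \<beta> w u + \<beta> w v" for u v w using \<beta>_add \<beta>_anti by (metis minus_add_distrib)
  have \<beta>_scale': "\<beta> w (c *s u) = c * \<beta> w u" for c u w using \<beta>_scale \<beta>_anti by (metis mult_minus_right)
  define E where "E = (\<lambda>v. v - S (x \<bullet> v))"
  define xE where "xE = (\<lambda>v. v - xmap S (xbracket (embed x) v))"
  have xS: "X.lin (xmap S)"
    by (rule X.linI) (simp_all add: fun_ops xmap_def fun_eq_iff sum_fun_apply xscale_def algebra_simps sum.distrib sum_distrib_left)
  have xE: "X.lin xE"
    by (rule X.linI) (simp_all add: xE_def X.lin_simps[OF xS] X.bracket_simps X.scale_right_diff_distrib)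
  have Sem: "xmap S (embed v) = embed (S v)" for v by (rule xmap_embed[OF S])
  have Eem: "xE (embed v) = embed (E v)" for v by (simp add: xE_def E_def Sem xbracket_embed embed_simps)
  let ?b = "xform \<beta>" and ?G = "X.span (embed ` Basis)"
  have bem: "?b (embed u) (embed v) = to_ac (\<beta> u v)" for u v
    by (rule xform_embed[OF \<beta>_add \<beta>_scale \<beta>_add' \<beta>_scale'])
  have b1: "?b (f + f') g = ?b f g + ?b f' g" "?b g (f + f') = ?b g f + ?b g f'"
    "?b (xscale r f) g = r * ?b f g" "?b g (xscale r f) = r * ?b g f" for f f' g r
    by (simp_all add: fun_ops xform_def xscale_def algebra_simps sum.distrib sum_distrib_left)
  have banti: "?b f g = - ?b g f" for f g
    unfolding xform_def by (subst sum.swap, subst \<beta>_anti) (simp add: sum_negf mult.commute)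
  \<comment> \<open>\<open>ext\<close> and \<open>extv\<close> extend an identity from embedded
    vectors to their span, one argument at a time, for scalar and for vector values.\<close>
  have ext: "F v = 0" if "v \<in> ?G" "\<And>w. F (embed w) = 0"
    "\<And>r u v. F (xscale r u + v) = r * F u + F v" for F :: "('b \<Rightarrow> 'a alg_closure) \<Rightarrow> 'a alg_closure" and v
    using that(1)
  proof (induction rule: X.span_induct_alt)
    case base
    have "F 0 = 0" using that(3)[of 1 0 0] by simp
    then show ?case .
  qed (use that in auto)
  have extv: "F v = 0" if "v \<in> ?G" "X.lin F" "\<And>w. F (embed w) = 0" for F v
    by (rule X.lin_eq_0_span[OF that(2) _ that(1)]) (use that(3) in auto)
  note s = X.bracket_simps X.lin_simps[OF xS] X.lin_simps[OF xE] b1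
  have e1: "xbracket (embed x) (xE v) = 0" if "v \<in> ?G" for v
    by (rule extv[OF that]) (auto intro!: X.linI simp: s Eem xbracket_embed E_def XE embed_simps(3))
  have e2: "xmap S (xbracket (embed x) v) - xbracket (embed x) (xmap S v) = 0" if "v \<in> ?G" for v
    by (rule extv[OF that]) (auto intro!: X.linI simp: s Sem xbracket_embed SX X.scale_right_diff_distrib)
  have e3': "xbracket (xE (embed a)) (xE v) = 0" if "v \<in> ?G" for a v
    by (rule extv[OF that]) (auto intro!: X.linI simp: s Eem xbracket_embed E_abelian E_def embed_simps(3))
  have e3: "xbracket (xE u) (xE v) = 0" if "u \<in> ?G" "v \<in> ?G" for u v
    by (rule extv[OF that(1)]) (auto intro!: X.linI simp: s e3' that(2))
  have e4': "?b (xE (embed a)) v = 0" if "v \<in> ?G" for a v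
    by (rule ext[OF that]) (simp_all add: s Eem bem \<beta>1 E_def)
  have e4: "?b (xE u) v = 0" if "u \<in> ?G" "v \<in> ?G" for u v
    by (rule ext[OF that(1)]) (simp_all add: s e4' that(2))
  have \<beta>2': "\<beta> (S (u \<bullet> E a)) u = 0" for a u unfolding E_def by (rule \<beta>2)
  \<comment> \<open>Polarised, since only a multilinear condition can be extended one argument at a
    time.\<close>
  have p2: "\<beta> (S (u \<bullet> E a)) v + \<beta> (S (v \<bullet> E a)) u = 0" for a u v
    using \<beta>2'[of "u + v" a] \<beta>2'[of u a] \<beta>2'[of v a]
    by (simp add: \<beta>_add \<beta>_add' bracket_simps lin_simps[OF S] add.commute)
  let ?q = "\<lambda>a u v. ?b (xmap S (xbracket u (xE a))) v + ?b (xmap S (xbracket v (xE a))) u"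
  have e5a: "?q (embed a) (embed u) (embed v) = 0" for a u v
    using p2 by (simp add: Eem xbracket_embed Sem bem flip: to_ac_add)
  have e5b: "?q (embed a) (embed u) v = 0" if "v \<in> ?G" for a u v
    by (rule ext[OF that, of "?q (embed a) (embed u)"]) (simp_all only: e5a, simp add: s algebra_simps)
  have e5c: "?q (embed a) u v = 0" if "u \<in> ?G" "v \<in> ?G" for a u v
    by (rule ext[OF that(1), of "\<lambda>u. ?q (embed a) u v"]) (simp_all only: e5b[OF that(2)], simp add: s algebra_simps)
  have e5: "?q a u v = 0" if "a \<in> ?G" "u \<in> ?G" "v \<in> ?G" for a u v
    by (rule ext[OF that(1), of "\<lambda>a. ?q a u v"]) (simp_all only: e5c[OF that(2,3)], simp add: s algebra_simps)
  let ?t = "\<lambda>a u v w. ?b (xmap S (xbracket u (xmap S (xbracket v (xE a))))) w"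
  let ?c = "\<lambda>a u v w. ?t a u v w + ?t a v u w + ?t a u w v + ?t a w u v + ?t a v w u + ?t a w v u"
  have \<beta>3': "\<beta> (S (u \<bullet> S (u \<bullet> E a))) u = 0" for a u unfolding E_def by (rule \<beta>3)
  have p3: "\<beta> (S (u \<bullet> S (v \<bullet> E a))) w + \<beta> (S (v \<bullet> S (u \<bullet> E a))) w +
      \<beta> (S (u \<bullet> S (w \<bullet> E a))) v + \<beta> (S (w \<bullet> S (u \<bullet> E a))) v +
      \<beta> (S (v \<bullet> S (w \<bullet> E a))) u + \<beta> (S (w \<bullet> S (v \<bullet> E a))) u = 0" for a u v w
    by (rule polarise_cubic[of "\<lambda>u v w. \<beta> (S (u \<bullet> S (v \<bullet> E a))) w"])
       (simp_all add: \<beta>_add \<beta>_add' bracket_simps lin_simps[OF S] \<beta>3')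
  have e6a: "?c (embed a) (embed u) (embed v) (embed w) = 0" for a u v w
    using p3[of u v a w] by (simp add: Eem xbracket_embed Sem bem flip: to_ac_add)
  have e6b: "?c (embed a) (embed u) (embed v) w = 0" if "w \<in> ?G" for a u v w
    by (rule ext[OF that, of "?c (embed a) (embed u) (embed v)"]) (simp_all only: e6a, simp add: s algebra_simps)
  have e6c: "?c (embed a) (embed u) v w = 0" if "v \<in> ?G" "w \<in> ?G" for a u v w
    by (rule ext[OF that(1), of "\<lambda>v. ?c (embed a) (embed u) v w"])
       (simp_all only: e6b[OF that(2)], simp add: s algebra_simps)
  have e6d: "?c (embed a) u v w = 0" if "u \<in> ?G" "v \<in> ?G" "w \<in> ?G" for a u v w
    by (rule ext[OF that(1), of "\<lambda>u. ?c (embed a) u v w"])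
       (simp_all only: e6c[OF that(2,3)], simp add: s algebra_simps)
  have e6: "?c a u v w = 0" if "a \<in> ?G" "u \<in> ?G" "v \<in> ?G" "w \<in> ?G" for a u v w
    by (rule ext[OF that(1), of "\<lambda>a. ?c a u v w"])
       (simp_all only: e6d[OF that(2,3,4)], simp add: s algebra_simps)
  have kd: "X.killing (embed (dual b)) (embed c) = (if b = c then 1 else 0)" if "b \<in> Basis" "c \<in> Basis" for b c
    using K.killing_dual[OF that] by (simp add: X_killing)
  interpret R: root_setting xscale xbracket "embed ` Basis"
    "\<lambda>e. embed (dual (inv_into Basis embed e))" "embed x" "xmap S" xE ?b
  proof unfold_locales
    fix e f assume "e \<in> embed ` Basis" "f \<in> embed ` Basis"
    then obtain b c where "b \<in> Basis" "c \<in> Basis" "e = embed b" "f = embed c" by auto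
    then show "X.killing (embed (dual (inv_into Basis embed e))) f = (if e = f then 1 else 0)"
      using kd inj_on_subset[OF inj_embed, of Basis] by (simp add: inj_eq[OF inj_embed])
  next
    show "xmap S v \<in> ?G" for v unfolding xmap_def by (intro X.span_sum X.span_scale embed_in_span)
    show "xmap S (xbracket (embed x) v) = xbracket (embed x) (xmap S v)" if "v \<in> ?G" for v
      using e2[OF that] by simp
    show "xE v = v - xmap S (xbracket (embed x) v)" for v by (simp only: xE_def)
    show "xbracket (xE u) (xE v) = 0" if "u \<in> ?G" "v \<in> ?G" for u v using that by (rule e3)
    show "?b u v = - ?b v u" for u v by (rule banti)
    show "?b (u + v) w = ?b u w + ?b v w" for u v w by (rule b1)
    show "?b (xscale r u) w = r * ?b u w" for r u w by (rule b1)
  qed (rule embed_in_span X.lin_add[OF xS] X.lin_scale[OF xS] | (rule e1 e4 e5 e6; assumption))+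
  have "to_ac (\<beta> (a \<bullet> b) c + \<beta> (b \<bullet> c) a + \<beta> (c \<bullet> a) b) =
      to_ac (\<beta> (a \<bullet> b) c) + to_ac (\<beta> (b \<bullet> c) a) + to_ac (\<beta> (c \<bullet> a) b)" by simp
  also have "\<dots> = 0"
    using R.\<beta>_cocycle[OF embed_in_span embed_in_span embed_in_span, of a b c]
    by (simp only: xbracket_embed bem)
  finally have "\<beta> (a \<bullet> b) c + \<beta> (b \<bullet> c) a + \<beta> (c \<bullet> a) b = 0" by (simp only: to_ac_eq_0_iff)
  then show ?thesis by simp
qed

end

section \<open>Engel's theorem\<close>

context findim_lie_algebra
begin

text \<open>\<open>Q T\<close> is Engel's statement for all \<open>T\<close>-stable subquotients
  \<open>W / U\<close> of \<open>S\<close>; the pairs \<open>U \<subset> W\<close> avoid quotient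
  spaces. A subalgebra \<open>T\<close> of greatest dimension with \<open>Q T\<close> must be
  \<open>S\<close>: applied to \<open>S / T\<close>, \<open>Q T\<close> yields an \<open>s\<close>
  normalising \<open>T\<close>, and \<open>Q\<close> extends to the span of \<open>T\<close> and
  \<open>s\<close>.\<close>

lemma engel:
  assumes S: "subspace S" "\<And>a b. a \<in> S \<Longrightarrow> b \<in> S \<Longrightarrow> a \<bullet> b \<in> S"
    and nil: "\<And>s v. s \<in> S \<Longrightarrow> v \<in> S \<Longrightarrow> \<exists>k. (bracket s ^^ k) v = 0"
    and W: "subspace W" "W \<subseteq> S" "W \<noteq> {0}" "\<And>s w. s \<in> S \<Longrightarrow> w \<in> W \<Longrightarrow> s \<bullet> w \<in> W"
  obtains w where "w \<in> W" "w \<noteq> 0" "\<And>s. s \<in> S \<Longrightarrow> s \<bullet> w = 0"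
proof -
  define Q where "Q T \<longleftrightarrow> subspace T \<and> T \<subseteq> S \<and> (\<forall>a\<in>T. \<forall>b\<in>T. a \<bullet> b \<in> T) \<and>
    (\<forall>U W. subspace U \<longrightarrow> subspace W \<longrightarrow> U \<subset> W \<longrightarrow> W \<subseteq> S \<longrightarrow> (\<forall>t\<in>T. \<forall>u\<in>U. t \<bullet> u \<in> U) \<longrightarrow>
      (\<forall>t\<in>T. \<forall>w\<in>W. t \<bullet> w \<in> W) \<longrightarrow> (\<exists>w\<in>W - U. \<forall>t\<in>T. t \<bullet> w \<in> U))" for T
  have "Q {0}" using S(1) by (auto simp: Q_def bracket_simps subspace_0)
  moreover have "dim T \<le> card Basis" for T using dim_subset_UNIV[of T] by (simp add: dimension_def)
  ultimately obtain T where T: "Q T" "\<And>T'. Q T' \<Longrightarrow> dim T' \<le> dim T"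
    using ex_has_greatest_nat[of Q "{0}" dim "Suc (card Basis)"] by (auto simp: less_Suc_eq_le)
  have Tsub: "subspace T" "T \<subseteq> S" "\<And>a b. a \<in> T \<Longrightarrow> b \<in> T \<Longrightarrow> a \<bullet> b \<in> T" using T(1) by (auto simp: Q_def)
  have TE: "\<exists>w\<in>W - U. \<forall>t\<in>T. t \<bullet> w \<in> U"
    if "subspace U" "subspace W" "U \<subset> W" "W \<subseteq> S" "\<And>t u. t \<in> T \<Longrightarrow> u \<in> U \<Longrightarrow> t \<bullet> u \<in> U"
      "\<And>t w. t \<in> T \<Longrightarrow> w \<in> W \<Longrightarrow> t \<bullet> w \<in> W" for U W
    using T(1) that unfolding Q_def by blast
  have "T = S"
  proof (rule ccontr)
    assume "T \<noteq> S"
    then have "T \<subset> S" using Tsub by auto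
    then have "\<exists>w\<in>S - T. \<forall>t\<in>T. t \<bullet> w \<in> T" by (rule TE[OF Tsub(1) S(1)]) (use Tsub S(2) in auto)
    then obtain s where s: "s \<in> S" "s \<notin> T" "\<And>t. t \<in> T \<Longrightarrow> t \<bullet> s \<in> T" by blast
    let ?T = "span (insert s T)"
    have Tin: "\<exists>k t. t \<in> T \<and> a = t + k *s s" if aT: "a \<in> ?T" for a
    proof -
      have spT: "span T = T" using Tsub(1) by simp
      obtain k where "a - k *s s \<in> span T" using aT span_breakdown_eq[of a s T] by blast
      then have "a - k *s s \<in> T" by (simp only: spT)
      then show ?thesis by (intro exI[of _ k] exI[of _ "a - k *s s"]) simp
    qed
    have TT: "T \<subseteq> ?T" using span_superset by blast
    have "Q ?T"
      unfolding Q_def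
    proof (intro conjI allI impI ballI)
      show "?T \<subseteq> S" using Tsub s S(1) by (intro span_minimal) auto
      fix a b assume "a \<in> ?T" "b \<in> ?T"
      then obtain k t k' t' where ab: "t \<in> T" "a = t + k *s s" "t' \<in> T" "b = t' + k' *s s" using Tin by metis
      have "a \<bullet> b = t \<bullet> t' + k' *s (t \<bullet> s) - k *s (t' \<bullet> s)"
        using bracket_anti[of s t'] by (simp add: ab bracket_simps bracket_self)
      also have "\<dots> \<in> T" using ab s(3) Tsub by (intro subspace_add subspace_diff subspace_scale) auto
      finally show "a \<bullet> b \<in> ?T" using TT by blast
    next
      fix U W assume UW: "subspace U" "subspace W" "U \<subset> W" "W \<subseteq> S"
        "\<forall>t\<in>?T. \<forall>u\<in>U. t \<bullet> u \<in> U" "\<forall>t\<in>?T. \<forall>w\<in>W. t \<bullet> w \<in> W"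
      have sT: "s \<in> ?T" by (simp add: span_base)
      obtain w0 where w0: "w0 \<in> W" "w0 \<notin> U" "\<And>t. t \<in> T \<Longrightarrow> t \<bullet> w0 \<in> U"
        using TE[OF UW(1-4)] UW(5,6) TT by blast
      have sw: "(bracket s ^^ k) w0 \<in> W \<and> (\<forall>t\<in>T. t \<bullet> (bracket s ^^ k) w0 \<in> U)" for k
      proof (induction k)
        case (Suc k)
        let ?w = "(bracket s ^^ k) w0"
        have "t \<bullet> (s \<bullet> ?w) \<in> U" if "t \<in> T" for t
          using bracket_leibniz[of t s ?w] Suc UW(1,5) sT s(3)[OF that] that by (auto intro: subspace_add)
        then show ?case using Suc UW(6) sT by auto
      qed (use w0 in auto)
      \<comment> \<open>Vectors sent into \<open>U\<close> by \<open>T\<close> stay so under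
        \<open>s\<close>, because \<open>s\<close> normalises \<open>T\<close>. The last iterate
        outside \<open>U\<close> is sent into \<open>U\<close> by \<open>s\<close> as well.\<close>
      define k where "k = (LEAST k. (bracket s ^^ k) w0 \<in> U)"
      have "\<exists>k. (bracket s ^^ k) w0 \<in> U"
        using nil[OF s(1)] w0(1) UW(4) subspace_0[OF UW(1)] by (metis subsetD)
      then have k: "(bracket s ^^ k) w0 \<in> U" unfolding k_def by (rule LeastI_ex)
      then obtain j where j: "k = Suc j" using w0(2) by (cases k) auto
      let ?w = "(bracket s ^^ j) w0"
      have "?w \<notin> U" using not_less_Least[of j "\<lambda>k. (bracket s ^^ k) w0 \<in> U"] j by (simp add: k_def)
      moreover have "a \<bullet> ?w \<in> U" if a: "a \<in> ?T" for a
      proof -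
        obtain c t where t: "t \<in> T" "a = t + c *s s" using Tin[OF a] by blast
        have "a \<bullet> ?w = t \<bullet> ?w + c *s (bracket s ^^ k) w0" by (simp add: t j bracket_simps)
        also have "\<dots> \<in> U" using sw t(1) k UW(1) by (intro subspace_add subspace_scale) auto
        finally show ?thesis .
      qed
      ultimately show "\<exists>w\<in>W - U. \<forall>t\<in>?T. t \<bullet> w \<in> U" using sw by blast
    qed auto
    moreover have "dim T < dim ?T"
    proof (rule dim_psubset)
      have "T \<subset> ?T" using s(2) TT span_base[of s "insert s T"] by blast
      then show "span T \<subset> span ?T" by (simp only: span_span span_eq_iff[THEN iffD2, OF Tsub(1)])
    qed
    ultimately show False using T(2) by force
  qed
  have "{0} \<subset> W" using W(3) subspace_0[OF W(1)] by blast
  then have "\<exists>w\<in>W - {0}. \<forall>t\<in>T. t \<bullet> w \<in> {0}"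
    by (rule TE[OF subspace_single_0 W(1) _ W(2)]) (use W(4) \<open>T = S\<close> in \<open>auto simp: bracket_simps\<close>)
  then show ?thesis using that \<open>T = S\<close> by blast
qed

end

section \<open>Semisimple Lie algebras\<close>

locale findim_semisimple_lie_algebra = findim_lie_algebra scale Basis bracket + semisimple_lie_algebra scale bracket
  for scale :: "'a::field_char_0 \<Rightarrow> 'b::ab_group_add \<Rightarrow> 'b" (infixr "*s" 75)
    and Basis :: "'b set" and bracket :: "'b \<Rightarrow> 'b \<Rightarrow> 'b" (infixl "\<bullet>" 70)
begin

lemma abelian_ideal_trivial:
  assumes "lie_ideal I" "\<And>a b. a \<in> I \<Longrightarrow> b \<in> I \<Longrightarrow> a \<bullet> b = 0"
  shows "I = {0}"
proof (rule solvable_ideal_trivial[OF assms(1)])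
  have "span {a \<bullet> b | a b. a \<in> I \<and> b \<in> I} \<subseteq> {0}" by (rule span_minimal) (use assms(2) in auto)
  then have "(derived ^^ 1) I = {0}" using span_zero by (auto simp: derived_def)
  then show "solvable I" unfolding solvable_def by blast
qed

text \<open>The radical \<open>R\<close> of \<open>\<kappa>\<close> is an ideal, and by Cartan's
  criterion \<open>D = [R, R]\<close> consists of ad-nilpotent elements. By Engel a nonzero
  \<open>D\<close> has nonzero centre, which is an abelian ideal of the whole algebra. So
  \<open>D = 0\<close>, and \<open>R\<close> itself is an abelian ideal.\<close>

lemma killing_nondegenerate:
  assumes "\<And>w. killing v w = 0" shows "v = 0"
proof -
  define R where "R = {v. \<forall>w. killing v w = 0}"
  define D where "D = span {a \<bullet> b | a b. a \<in> R \<and> b \<in> R}"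
  have R: "subspace R" by (rule subspaceI) (auto simp: R_def killing_simps)
  have Rid: "y \<bullet> a \<in> R" if "a \<in> R" for a y
    using that bracket_anti[of y a] by (auto simp: R_def killing_invariant killing_neg)
  have D: "subspace D" by (simp add: D_def)
  have DR: "D \<subseteq> R" unfolding D_def using R Rid by (intro span_minimal) auto
  have Did: "y \<bullet> d \<in> D" if "d \<in> D" for y d
  proof (rule lin_span_mono[OF lin_bracket _ D that[unfolded D_def]])
    fix c assume "c \<in> {a \<bullet> b | a b. a \<in> R \<and> b \<in> R}"
    then obtain a b where ab: "a \<in> R" "b \<in> R" "c = a \<bullet> b" by auto
    have "(y \<bullet> a) \<bullet> b \<in> D" "a \<bullet> (y \<bullet> b) \<in> D"
      unfolding D_def using ab Rid by (auto intro!: span_base)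
    then show "y \<bullet> c \<in> D" using ab(3) bracket_leibniz[of y a b] subspace_add[OF D] by simp
  qed
  have Dnil: "\<exists>k. (bracket d ^^ k) v = 0" if "d \<in> D" for d v
    by (rule cartan_nilpotency[of d "R \<times> R"]) (use that in \<open>auto simp: D_def R_def\<close>)
  have "D = {0}"
  proof (rule ccontr)
    assume "D \<noteq> {0}"
    then obtain z where z: "z \<in> D" "z \<noteq> 0" "\<And>s. s \<in> D \<Longrightarrow> s \<bullet> z = 0"
      using engel[OF D Did Dnil D order_refl _ Did] by blast
    define Z where "Z = {z \<in> D. \<forall>d\<in>D. d \<bullet> z = 0}"
    have "y \<bullet> u \<in> Z" if u: "u \<in> Z" for y u
    proof -
      have "d \<bullet> (y \<bullet> u) = 0" if "d \<in> D" for d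
      proof -
        have "d \<bullet> y \<in> D" using Did[OF that, of y] bracket_anti[of d y] subspace_neg[OF D] by simp
        then show ?thesis using u that bracket_leibniz[of d y u] by (simp add: Z_def bracket_simps)
      qed
      then show ?thesis using u Did by (simp add: Z_def)
    qed
    moreover have "subspace Z"
      by (rule subspaceI) (auto simp: Z_def bracket_simps subspace_0 subspace_add subspace_scale D)
    ultimately have "lie_ideal Z" by (simp add: lie_ideal_def)
    then have "Z = {0}" by (rule abelian_ideal_trivial) (auto simp: Z_def)
    then show False using z by (auto simp: Z_def)
  qed
  then have "a \<bullet> b = 0" if "a \<in> R" "b \<in> R" for a b
  proof -
    have "a \<bullet> b \<in> D" unfolding D_def using that by (auto intro!: span_base)
    then show ?thesis using \<open>D = {0}\<close> by simp
  qed
  then have "R = {0}" using abelian_ideal_trivial R Rid by (simp add: lie_ideal_def)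
  then show ?thesis using assms by (auto simp: R_def)
qed

subsection \<open>Regular elements\<close>

text \<open>The Fitting null component of \<open>ad x\<close>.\<close>

definition null :: "'b \<Rightarrow> 'b set" where
  "null x = gen_eigenspace (bracket x) 0"

lemma null_iff: "v \<in> null x \<longleftrightarrow> (bracket x ^^ card Basis) v = 0"
  unfolding null_def gen_eigenspace_0_iff[OF lin_bracket] using nilpotency_index[OF lin_bracket] by blast

lemma subspace_null: "subspace (null x)"
  unfolding null_def by (rule subspace_gen_eigenspace[OF lin_bracket])

lemma null_bracket: "a \<in> null x \<Longrightarrow> b \<in> null x \<Longrightarrow> a \<bullet> b \<in> null x"
  unfolding null_def using gen_eigenspace_bracket[of a x 0 b 0] by simp

text \<open>For \<open>h\<close> in \<open>N = null x\<close> and almost all \<open>t\<close>,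
  \<open>x + t h\<close> has the rank of \<open>x\<close> and is injective on the other Fitting
  component, so its null component lies in \<open>N\<close> and by minimality equals
  \<open>N\<close>. Nilpotency of \<open>x + t h\<close> on \<open>N\<close> for infinitely many
  \<open>t\<close> gives nilpotency of \<open>h\<close> on \<open>N\<close>. So Engel applies to
  \<open>[N, N]\<close>: a nonzero \<open>z\<close> there, central in \<open>N\<close>, would be
  orthogonal to both components.\<close>

lemma regular_null_abelian:
  assumes mx: "\<And>y. rank (bracket y) \<le> rank (bracket x)"
    and mn: "\<And>y. rank (bracket y) = rank (bracket x) \<Longrightarrow> dim (null x) \<le> dim (null y)"
    and ab: "a \<in> null x" "b \<in> null x"
  shows "a \<bullet> b = 0"
proof -
  let ?X = "bracket x" and ?n = "card Basis" and ?N = "null x"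
  \<comment> \<open>The complementary Fitting component, on which \<open>ad x\<close> is
    bijective.\<close>
  define P where "P = range (?X ^^ ?n)"
  have Xn: "lin (?X ^^ k)" for k by (rule lin_funpow[OF lin_bracket])
  have P: "subspace P" unfolding P_def by (rule lin_subspace_image[OF Xn subspace_UNIV])
  have NP: "v = 0" if "v \<in> P" "(?X ^^ k) v = 0" for v k
  proof -
    obtain w where w: "v = (?X ^^ ?n) w" using \<open>v \<in> P\<close> by (auto simp: P_def)
    then have "(?X ^^ (k + ?n)) w = 0" using that(2) by (simp add: funpow_add)
    then show ?thesis using nilpotency_index[OF lin_bracket] w by blast
  qed
  have XP: "x \<bullet> v \<in> P" if "v \<in> P" for v using that by (auto simp: P_def funpow_swap1)
  have XkP: "(?X ^^ k) v \<in> P" if "v \<in> P" for v k using that XP by (induction k) auto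
  have XnP: "(?X ^^ ?n) ` P = P"
  proof (rule subspace_dim_equal)
    show "dim P \<le> dim ((?X ^^ ?n) ` P)" using dim_image_inj[OF Xn P NP] by simp
    show "(?X ^^ ?n) ` P \<subseteq> P" using XkP by blast
  qed (rule lin_subspace_image[OF Xn P] P)+
  have decomp: "\<exists>h\<in>?N. \<exists>p\<in>P. v = h + p" for v
  proof -
    have "(?X ^^ ?n) v \<in> (?X ^^ ?n) ` P" unfolding XnP by (simp add: P_def)
    then obtain p where p: "p \<in> P" "(?X ^^ ?n) v = (?X ^^ ?n) p" by auto
    then have "v - p \<in> ?N" by (simp add: null_iff lin_diff[OF Xn])
    then show ?thesis using p(1) by (metis diff_add_cancel)
  qed
  \<comment> \<open>Induction on the exponent \<open>j\<close>: commuting \<open>h\<close> past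
    \<open>ad x\<close> produces \<open>[x, h]\<close>, whose exponent is smaller.\<close>
  have NPP: "h \<bullet> p \<in> P" if "(?X ^^ j) h = 0" "p \<in> P" for h p j
    using that
  proof (induction j arbitrary: h p)
    case 0
    then show ?case using subspace_0[OF P] by (simp add: bracket_simps)
  next
    case (Suc j)
    have "(?X ^^ j) (x \<bullet> h) = 0" using Suc.prems by (simp add: funpow_swap1)
    then have IH: "(x \<bullet> h) \<bullet> q \<in> P" if "q \<in> P" for q using Suc.IH that by blast
    have *: "h \<bullet> (?X ^^ i) q - (?X ^^ i) (h \<bullet> q) \<in> P" if "q \<in> P" for q i
    proof (induction i)
      case (Suc i)
      have "h \<bullet> (?X ^^ Suc i) q - (?X ^^ Suc i) (h \<bullet> q) =
          x \<bullet> (h \<bullet> (?X ^^ i) q - (?X ^^ i) (h \<bullet> q)) - (x \<bullet> h) \<bullet> (?X ^^ i) q"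
        using bracket_leibniz[of x h "(?X ^^ i) q"] by (simp add: bracket_simps)
      then show ?case using Suc IH[OF XkP[OF that]] XP subspace_diff[OF P] by simp
    qed (simp add: subspace_0[OF P])
    obtain q where q: "q \<in> P" "p = (?X ^^ ?n) q" using Suc.prems XnP by auto
    have "(?X ^^ ?n) (h \<bullet> q) \<in> P" by (simp add: P_def)
    then show ?case using *[OF q(1), of ?n] q(2) subspace_add[OF P] by (metis diff_add_cancel)
  qed
  have Nn: "(bracket h ^^ ?n) v = 0" if h: "h \<in> ?N" and v: "v \<in> ?N" for h v
  proof -
    let ?A = "\<lambda>t v. x \<bullet> v + t *s (h \<bullet> v)"
    have A_eq: "bracket (x + t *s h) = ?A t" for t by (auto simp: bracket_simps)
    define T where "T = - ({t. \<exists>p\<in>P. p \<noteq> 0 \<and> ?A t p = 0} \<union> {t. rank (?A t) < rank ?X})"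
    have NP1: "v = 0" if "v \<in> P" "x \<bullet> v = 0" for v using NP[of v 1] that by simp
    have "finite {t. \<exists>p\<in>P. p \<noteq> 0 \<and> ?A t p = 0}"
      by (rule pencil_kernel_finite[OF lin_bracket lin_bracket P NP1])
    then have "infinite T"
      unfolding T_def
      by (rule infinite_cofinite[OF finite_UnI[OF _ rank_pencil_finite[OF lin_bracket lin_bracket]]])
    moreover have "(?A t ^^ ?n) v = 0" if t: "t \<in> T" for t
    proof -
      have "rank (?A t) = rank ?X" using t mx[of "x + t *s h"] by (simp add: T_def A_eq)
      then have le: "dim ?N \<le> dim (null (x + t *s h))" by (intro mn) (simp add: A_eq)
      have AN: "(?A t ^^ k) u \<in> ?N" if "u \<in> ?N" for u k
      proof (induction k)
        case (Suc k)
        have "x \<in> ?N" by (simp add: null_def gen_eigenspace_0_iff[OF lin_bracket] bracket_self exI[of _ 1])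
        then show ?case using Suc null_bracket h subspace_null by (auto intro!: subspace_add subspace_scale)
      qed (use that in simp)
      have hP: "h \<bullet> p \<in> P" if "p \<in> P" for p using NPP[of ?n h p] h that by (simp add: null_iff)
      have AP: "(?A t ^^ k) p \<in> P \<and> ((?A t ^^ k) p = 0 \<longrightarrow> p = 0)" if "p \<in> P" for p k
      proof (induction k)
        case (Suc k)
        let ?p = "(?A t ^^ k) p"
        have "?A t ?p \<in> P" using Suc XP hP P by (auto intro!: subspace_add subspace_scale)
        moreover have "?A t ?p = 0 \<Longrightarrow> ?p = 0" using t Suc by (auto simp: T_def)
        ultimately show ?case using Suc by auto
      qed (use that in simp)
      have "null (x + t *s h) \<subseteq> ?N"
      proof
        fix u assume "u \<in> null (x + t *s h)"
        then have u: "(?A t ^^ ?n) u = 0" by (simp add: null_iff A_eq)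
        obtain a p where ap: "a \<in> ?N" "p \<in> P" "u = a + p" using decomp by blast
        have "(?A t ^^ ?n) a = - (?A t ^^ ?n) p"
          using u lin_add[OF lin_funpow[OF lin_pencil[OF lin_bracket lin_bracket]], of ?n x t h a p]
          by (simp add: ap(3) eq_neg_iff_add_eq_0)
        then have "(?A t ^^ ?n) p = - (?A t ^^ ?n) a" by simp
        then have "(?A t ^^ ?n) p \<in> ?N" using subspace_neg[OF subspace_null AN[OF ap(1), of ?n]] by (simp only:)
        moreover have "(?A t ^^ ?n) p \<in> P" using AP[OF ap(2), of ?n] by blast
        ultimately have "(?A t ^^ ?n) p = 0" using NP[of "(?A t ^^ ?n) p" ?n] by (simp only: null_iff)
        then show "u \<in> ?N" using AP[OF ap(2), of ?n] ap by simp
      qed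
      then have "null (x + t *s h) = ?N" using le by (intro subspace_dim_equal subspace_null)
      then have "v \<in> null (x + t *s h)" using v by (simp only:)
      then show ?thesis by (simp only: null_iff A_eq)
    qed
    moreover obtain c where c: "c ?n = (bracket h ^^ ?n) v"
      "\<And>t. (?A t ^^ ?n) v = (\<Sum>i\<le>?n. t ^ i *s c i)"
      using pencil_funpow[where A = "bracket x" and B = "bracket h" and k = ?n and v = v, OF lin_bracket lin_bracket]
      by blast
    ultimately have "c ?n = 0" by (intro vector_polynomial_0[where T = T and n = ?n and c = c]) auto
    then show ?thesis using c(1) by simp
  qed
  define W where "W = span {a \<bullet> b | a b. a \<in> ?N \<and> b \<in> ?N}"
  have WN: "W \<subseteq> ?N" unfolding W_def using null_bracket subspace_null by (intro span_minimal) auto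
  have "W = {0}"
  proof (rule ccontr)
    assume Wne: "W \<noteq> {0}"
    have Wst: "s \<bullet> w \<in> W" if "s \<in> ?N" "w \<in> W" for s w
      unfolding W_def using that WN by (auto intro!: span_base)
    have Wsub: "subspace W" by (simp add: W_def)
    have nilN: "\<exists>k. (bracket s ^^ k) v = 0" if "s \<in> ?N" "v \<in> ?N" for s v
      using Nn[OF that] by blast
    obtain z where z: "z \<in> W" "z \<noteq> 0" "\<And>s. s \<in> ?N \<Longrightarrow> s \<bullet> z = 0"
      by (rule engel[OF subspace_null null_bracket nilN Wsub WN Wne Wst]) blast+
    have z0: "z \<bullet> s = 0" if "s \<in> ?N" for s using z(3)[OF that] bracket_anti[of z s] by simp
    have nil: "\<exists>k. (bracket z ^^ k) v = 0" for v
    proof (rule cartan_nilpotency[of z "?N \<times> ?N"])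
      show "z \<in> span {a \<bullet> b | a b. (a, b) \<in> ?N \<times> ?N}" using z(1) by (simp add: W_def)
      fix a b k assume "(a, b) \<in> ?N \<times> ?N" "1 \<le> (k::nat)"
      then obtain k' where "k = Suc k'" "b \<in> ?N" by (cases k) auto
      \<comment> \<open>\<open>z\<close> annihilates \<open>N\<close>, so the hypothesis of Cartan's
        criterion holds term by term.\<close>
      then have "(bracket z ^^ k) b = 0" using z0 by (simp add: funpow_Suc_right lin_0[OF lin_funpow[OF lin_bracket]] del: funpow.simps)
      then show "killing a ((bracket z ^^ k) b) = 0" by (simp add: killing_simps)
    qed
    have kN: "killing z h = 0" if "h \<in> ?N" for h
      using nil z0[OF that] by (rule killing_nilpotent_commuting)
    \<comment> \<open>The two Fitting components are \<open>\<kappa>\<close>-orthogonal: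
      \<open>ad x\<close> is moved across the form \<open>i\<close> times.\<close>
    have kP: "(?X ^^ i) u = 0 \<Longrightarrow> killing u ((?X ^^ i) q) = 0" for u q i
    proof (induction i arbitrary: u)
      case (Suc i)
      have "killing u ((?X ^^ Suc i) q) = - killing (x \<bullet> u) ((?X ^^ i) q)"
        using killing_invariant[of u x "(?X ^^ i) q"] bracket_anti[of u x] by (simp add: killing_neg)
      also have "\<dots> = 0" using Suc.IH[of "x \<bullet> u"] Suc.prems by (simp add: funpow_swap1)
      finally show ?case .
    qed (simp add: killing_simps)
    have "z = 0"
    proof (rule killing_nondegenerate)
      fix w
      obtain h p where hp: "h \<in> ?N" "p \<in> P" "w = h + p" using decomp by blast
      moreover have "killing z p = 0" using hp(2) kP[of ?n z] z(1) WN by (auto simp: P_def null_iff)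
      ultimately show "killing z w = 0" using kN by (simp add: killing_simps)
    qed
    then show False using z(2) by simp
  qed
  moreover have "a \<bullet> b \<in> W" unfolding W_def using ab by (auto intro!: span_base)
  ultimately show ?thesis by simp
qed

text \<open>\<open>x\<close> lies in its own null component, which is abelian; so that component is
  the centraliser of \<open>x\<close>, and \<open>ad x\<close> is injective on its range.\<close>

lemma regular_exists:
  obtains x where "\<And>y. rank (bracket y) \<le> rank (bracket x)"
    "\<And>v. x \<bullet> (x \<bullet> v) = 0 \<Longrightarrow> x \<bullet> v = 0"
    "\<And>a b. x \<bullet> a = 0 \<Longrightarrow> x \<bullet> b = 0 \<Longrightarrow> a \<bullet> b = 0"
proof -
  have bd: "dim A \<le> card Basis" for A using dim_subset_UNIV by (simp add: dimension_def)
  obtain x0 where x0: "\<And>y. rank (bracket y) \<le> rank (bracket x0)"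
    using ex_has_greatest_nat[of "\<lambda>_. True" 0 "\<lambda>y. rank (bracket y)" "Suc (card Basis)"] bd
    by (auto simp: less_Suc_eq_le)
  obtain x where x: "rank (bracket x) = rank (bracket x0)"
    "\<And>y. rank (bracket y) = rank (bracket x0) \<Longrightarrow> dim (null x) \<le> dim (null y)"
    using ex_has_least_nat[of "\<lambda>y. rank (bracket y) = rank (bracket x0)" x0 "\<lambda>y. dim (null y)"] by auto
  have abel: "a \<bullet> b = 0" if "a \<in> null x" "b \<in> null x" for a b
    by (rule regular_null_abelian[OF _ _ that]) (use x x0 in auto)
  have null1: "v \<in> null x" if "(bracket x ^^ k) v = 0" for v k
    using that gen_eigenspace_0_iff[OF lin_bracket] by (auto simp: null_def)
  have "x \<in> null x" using null1[of 1 x] by (simp add: bracket_self)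
  then have null2: "x \<bullet> v = 0" if "v \<in> null x" for v using abel that by blast
  show ?thesis
  proof (rule that)
    show "rank (bracket y) \<le> rank (bracket x)" for y using x0 x(1) by simp
    show "x \<bullet> v = 0" if "x \<bullet> (x \<bullet> v) = 0" for v
      using null2[OF null1[of 2 v]] that by (simp add: numeral_2_eq_2)
    show "a \<bullet> b = 0" if "x \<bullet> a = 0" "x \<bullet> b = 0" for a b
      using abel null1[of 1] that by simp
  qed
qed

subsection \<open>Rank-neutral directions are inner\<close>

text \<open>Maximality of rank enters only through its first-order consequence
  \<open>neutral\<close>, applied at \<open>x\<close> and at those \<open>x + t u\<close> that have
  maximal rank.\<close>

lemma rank_neutral_direction_inner:
  assumes B0: "lin B0"
    and neutral: "\<And>y v. (\<And>z. rank (bracket z) \<le> rank (bracket y)) \<Longrightarrow> y \<bullet> v = 0 \<Longrightarrow> \<exists>z. B0 v = y \<bullet> z"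
  obtains a where "\<And>v. B0 v = a \<bullet> v"
proof -
  obtain x where mx: "\<And>y. rank (bracket y) \<le> rank (bracket x)"
    and xx: "\<And>v. x \<bullet> (x \<bullet> v) = 0 \<Longrightarrow> x \<bullet> v = 0"
    and abel: "\<And>a b. x \<bullet> a = 0 \<Longrightarrow> x \<bullet> b = 0 \<Longrightarrow> a \<bullet> b = 0" by (rule regular_exists) blast
  \<comment> \<open>\<open>x\<close> centralises itself. Since \<open>[x, a] = - [a, x]\<close>,
    adding \<open>ad a\<close> is what makes \<open>B x\<close> vanish.\<close>
  obtain a where a: "B0 x = x \<bullet> a" using neutral[OF mx, of x] bracket_self by auto
  define B where "B = (\<lambda>v. B0 v + a \<bullet> v)"
  have B: "lin B" by (rule linI) (simp_all add: B_def lin_simps[OF B0] bracket_simps scale_right_distrib)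
  have Bx: "B x = 0" using a bracket_anti[of a x] by (simp add: B_def)
  define \<beta> where "\<beta> u v = killing (B u) v" for u v
  have \<beta>_lin: "\<beta> (u + v) w = \<beta> u w + \<beta> v w" "\<beta> (c *s u) w = c * \<beta> u w" "\<beta> (u - v) w = \<beta> u w - \<beta> v w"
    "\<beta> w (u + v) = \<beta> w u + \<beta> w v" "\<beta> w (c *s u) = c * \<beta> w u" for u v w c
    by (simp_all add: \<beta>_def lin_simps[OF B] killing_simps)
  \<comment> \<open>Both parts of \<open>B v\<close> are orthogonal to \<open>y\<close>:
    \<open>B0 v\<close> lies in \<open>[y, g]\<close>, and
    \<open>\<kappa>([a, v], y) = \<kappa>(a, [v, y])\<close>.\<close>
  have \<beta>_regular: "\<beta> v y = 0" if y: "rank (bracket y) = rank (bracket x)" "y \<bullet> v = 0" for y v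
  proof -
    have self: "killing (y \<bullet> z) y = 0" for z
      using killing_invariant[of z y y] bracket_anti[of y z] by (simp add: bracket_self killing_simps)
    obtain z where z: "B0 v = y \<bullet> z" using neutral[of y v] mx y by auto
    have "killing (a \<bullet> v) y = 0"
      using killing_invariant[of a v y] bracket_anti[of v y] y(2) by (simp add: killing_simps)
    then show ?thesis by (simp add: \<beta>_def B_def z killing_simps self)
  qed
  have \<beta>_self: "\<beta> u u = 0" for u
  proof -
    let ?T = "{t. rank (\<lambda>v. x \<bullet> v + t *s (u \<bullet> v)) < rank (bracket x)}"
    have T: "infinite (- ?T)" by (intro infinite_cofinite rank_pencil_finite lin_bracket)
    have "poly [:0, \<beta> u x, \<beta> u u:] t = 0" if "t \<in> - ?T" for t
    proof -
      have eq: "bracket (x + t *s u) = (\<lambda>v. x \<bullet> v + t *s (u \<bullet> v))" by (auto simp: bracket_simps)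
      have "rank (bracket (x + t *s u)) = rank (bracket x)"
        using that mx[of "x + t *s u"] by (simp add: eq)
      then have "\<beta> (x + t *s u) (x + t *s u) = 0" by (rule \<beta>_regular) (rule bracket_self)
      moreover have "\<beta> (x + t *s u) (x + t *s u) = t * \<beta> u x + t * (t * \<beta> u u)"
        by (simp only: \<beta>_lin) (simp add: \<beta>_def Bx killing_simps)
      moreover have "poly [:0, \<beta> u x, \<beta> u u:] t = t * \<beta> u x + t * (t * \<beta> u u)" by (simp add: distrib_left)
      ultimately show ?thesis by simp
    qed
    then have "- ?T \<subseteq> {t. poly [:0, \<beta> u x, \<beta> u u:] t = 0}" by blast
    then have "[:0, \<beta> u x, \<beta> u u:] = 0" using T poly_roots_finite finite_subset by blast
    then show ?thesis by simp
  qed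
  have \<beta>_anti: "\<beta> u v = - \<beta> v u" for u v
    using \<beta>_self[of "u + v"] \<beta>_self[of u] \<beta>_self[of v] by (simp add: \<beta>_lin eq_neg_iff_add_eq_0 add.commute)
  have \<beta>x: "\<beta> v x = 0" for v using \<beta>_anti[of v x] by (simp add: \<beta>_def Bx killing_simps)

  define R where "R = range (bracket x)"
  have R: "subspace R" unfolding R_def by (rule lin_subspace_image[OF lin_bracket subspace_UNIV])
  have XR0: "v = 0" if "v \<in> R" "x \<bullet> v = 0" for v using that xx by (auto simp: R_def)
  have XR: "bracket x ` R = R"
  proof (rule subspace_dim_equal)
    show "dim R \<le> dim (bracket x ` R)" using dim_image_inj[OF lin_bracket R XR0] by simp
    show "bracket x ` R \<subseteq> R" by (auto simp: R_def)
  qed (rule lin_subspace_image[OF lin_bracket R] R)+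
  interpret VP: vector_space_pair scale scale by unfold_locales
  have "inj_on (bracket x) R" by (rule lin_inj_onI[OF lin_bracket R XR0])
  then obtain g where g: "range g \<subseteq> R" "lin g" "\<And>v. v \<in> R \<Longrightarrow> g (x \<bullet> v) = v"
    using VP.linear_exists_left_inverse_on[OF lin_bracket R] by blast
  \<comment> \<open>\<open>g\<close> is a left inverse of \<open>ad x\<close> on \<open>R\<close>.
    The inner \<open>g (x \<bullet> v)\<close> is the \<open>R\<close>-component of
    \<open>v\<close>, and the outer \<open>g\<close> inverts \<open>ad x\<close> on it; so
    \<open>S\<close> vanishes on the centraliser.\<close>
  define S where "S v = g (g (x \<bullet> v))" for v
  have S: "lin S" by (rule linI) (simp_all add: S_def lin_simps[OF g(2)] bracket_simps)
  have SR: "S v \<in> R" for v using g(1) by (auto simp: S_def)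
  have SXR: "S (x \<bullet> p) = p" if "p \<in> R" for p
    using g(3)[OF that] g(3)[of "x \<bullet> p"] by (simp add: S_def R_def)
  have proj: "\<exists>p\<in>R. x \<bullet> v = x \<bullet> p \<and> S (x \<bullet> v) = p \<and> x \<bullet> S v = p" for v
  proof -
    have "x \<bullet> v \<in> bracket x ` R" unfolding XR by (simp add: R_def)
    then obtain p where p: "p \<in> R" "x \<bullet> v = x \<bullet> p" by auto
    then have "p \<in> bracket x ` R" unfolding XR by simp
    then obtain q where q: "q \<in> R" "p = x \<bullet> q" by auto
    have "S v = q" using p q g(3) by (simp add: S_def)
    then show ?thesis using p q SXR[OF p(1)] by auto
  qed
  have SX: "S (x \<bullet> v) = x \<bullet> S v" for v using proj[of v] by auto
  have XE: "x \<bullet> (v - S (x \<bullet> v)) = 0" for v using proj[of v] by (auto simp: bracket_simps)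

  have key: "\<beta> y u = 0 \<and> \<beta> (S (u \<bullet> y)) u = 0 \<and> \<beta> (S (u \<bullet> S (u \<bullet> y))) u = 0" if y: "x \<bullet> y = 0" for y u
  proof -
    define N where "N v = S (u \<bullet> v)" for v
    have N: "lin N" by (rule linI) (simp_all add: N_def lin_simps[OF S] bracket_simps)
    have id: "lin (\<lambda>v. v)" by (rule linI) auto
    define T where "T = - insert 0 ({t. \<exists>p\<in>UNIV. p \<noteq> 0 \<and> p + t *s N p = 0}
      \<union> {t. rank (\<lambda>v. x \<bullet> v + t *s (u \<bullet> v)) < rank (bracket x)})"
    have "finite {t. \<exists>p\<in>UNIV. p \<noteq> 0 \<and> p + t *s N p = 0}"
      by (rule pencil_kernel_finite[OF id N subspace_UNIV])
    then have T: "infinite T"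
      unfolding T_def
      by (intro infinite_cofinite finite.insertI finite_UnI rank_pencil_finite[OF lin_bracket lin_bracket])
    have T: "infinite T" "0 \<notin> T" by (rule T) (simp add: T_def)
    have inj: "p = 0" if "t \<in> T" "p + t *s N p = 0" for t p using that by (auto simp: T_def)
    \<comment> \<open>\<open>w\<close> stands for \<open>(1 + t N)^-1 (N y)\<close>, so
      \<open>y - t w\<close> is the closed form of the series centralising \<open>x + t u\<close>.
      Pairing it with \<open>x + t u\<close> gives the second equation.\<close>
    have "\<exists>w. w + t *s N w = N y \<and> \<beta> y u = t * \<beta> w u" if t: "t \<in> T" for t
    proof -
      let ?Q = "\<lambda>v. v + t *s N v"
      have Q: "lin ?Q" by (rule lin_pencil[OF id N])
      have "inj ?Q" using lin_inj_onI[OF Q subspace_UNIV] inj[OF t] by blast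
      then have "surj ?Q" by (rule linear_inj_imp_surj[OF Q])
      then obtain w where "N y = w + t *s N w" by (rule surjE)
      then have w: "w + t *s N w = N y" by simp
      have wR: "w \<in> R"
      proof -
        have "w = N y - t *s N w" using w by (simp add: algebra_simps)
        then show ?thesis unfolding N_def using SR R by (metis subspace_diff subspace_scale)
      qed
      let ?y = "y - t *s w" and ?M = "bracket (x + t *s u)"
      have M: "S (?M p) = p + t *s N p" if "p \<in> R" for p
        using SXR[OF that] by (simp add: bracket_simps lin_simps[OF S] N_def)
      have "p = 0" if "p \<in> R" "?M p = 0" for p
        using M[OF that(1)] inj[OF t, of p] that(2) lin_0[OF S] by simp
      then have "dim R = dim (?M ` R)" by (rule dim_image_inj[OF lin_bracket R, symmetric])
      moreover have eq: "?M = (\<lambda>v. x \<bullet> v + t *s (u \<bullet> v))" by (auto simp: bracket_simps)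
      have rk: "rank ?M = rank (bracket x)" using t mx[of "x + t *s u"] by (simp add: T_def eq)
      ultimately have MR: "?M ` R = range ?M"
        by (intro subspace_dim_equal lin_subspace_image lin_bracket R subspace_UNIV image_mono subset_UNIV)
           (simp only: R_def)
      have "S (?M ?y) = t *s (N y - (w + t *s N w))"
        using SXR[OF wR] y
        by (simp add: bracket_simps lin_simps[OF S] N_def scale_right_diff_distrib scale_right_distrib algebra_simps)
      then have SM: "S (?M ?y) = 0" by (simp add: w)
      \<comment> \<open>\<open>x + t u\<close> maps \<open>R\<close> onto its whole range by
        maximality of rank, so its value at \<open>?y\<close> is attained at some \<open>p\<close>
        in \<open>R\<close>; applying \<open>S\<close> forces \<open>p = 0\<close>.\<close>
      have "?M ?y \<in> ?M ` R" unfolding MR by simp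
      then obtain p where p: "p \<in> R" "?M ?y = ?M p" by auto
      then have "p + t *s N p = 0" using M[OF p(1)] SM by simp
      then have "p = 0" by (rule inj[OF t])
      then have "?M ?y = 0" using p by (simp add: bracket_simps)
      then have "\<beta> ?y (x + t *s u) = 0" by (rule \<beta>_regular[OF rk])
      then have "t * (\<beta> y u - t * \<beta> w u) = 0" by (simp only: \<beta>_lin \<beta>x) (simp add: algebra_simps)
      then show ?thesis using w T(2) t by auto
    qed
    then obtain w where w: "\<And>t. t \<in> T \<Longrightarrow> w t + t *s N (w t) = N y" "\<And>t. t \<in> T \<Longrightarrow> \<beta> y u = t * \<beta> (w t) u"
      by metis
    have \<beta>sum: "\<beta> (\<Sum>s\<in>F. c s *s w s) u = (\<Sum>s\<in>F. c s * \<beta> (w s) u)" for F c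
      by (induction F rule: infinite_finite_induct) (simp_all add: \<beta>_lin, simp_all add: \<beta>_def lin_0[OF B] killing_simps)
    obtain F t c where F: "finite F" "F \<subseteq> T" "t \<in> T" "w t = (\<Sum>s\<in>F. c s *s w s)" "(\<Sum>s\<in>F. c s * (t / s)) \<noteq> 1"
      by (rule pencil_relation[OF id N subspace_UNIV _ T, of w "N y"]) (use w(1) in auto)
    have w': "\<beta> (w s) u = \<beta> y u / s" if "s \<in> T" for s using w(2)[OF that] that T(2) by (auto simp: field_simps)
    \<comment> \<open>Substituting \<open>\<beta> (w s) u = \<beta> y u / s\<close> into the
      relation yields \<open>\<beta> y u = k \<beta> y u\<close> with a scalar
      \<open>k \<noteq> 1\<close>.\<close>
    have "\<beta> y u = t * (\<Sum>s\<in>F. c s * \<beta> (w s) u)" using w(2)[OF F(3)] by (simp only: F(4) \<beta>sum)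
    also have "\<dots> = (\<Sum>s\<in>F. (c s * (t / s)) * \<beta> y u)"
      unfolding sum_distrib_left using F(2) w' by (intro sum.cong) auto
    also have "\<dots> = (\<Sum>s\<in>F. c s * (t / s)) * \<beta> y u" by (simp only: sum_distrib_right)
    finally have y0: "\<beta> y u = 0" using F(5) by (metis mult_cancel_right1)
    let ?Z = "span (w ` T)"
    have Z0: "\<beta> z u = 0" if "z \<in> ?Z" for z
      using that
    proof (induction rule: span_induct_alt)
      case base
      show ?case by (simp add: \<beta>_def lin_0[OF B] killing_simps)
    next
      case (step c b z)
      then obtain s where "s \<in> T" "b = w s" by auto
      then have "\<beta> b u = 0" using w' y0 by simp
      then show ?case using step by (simp add: \<beta>_lin)
    qed
    obtain z where "z \<in> ?Z" "z = N y"
      by (rule pencil_solve[OF id N subspace_UNIV _ T, of w "N y"]) (use w(1) in auto)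
    then have Ny: "N y \<in> ?Z" by simp
    \<comment> \<open>For \<open>b = w s\<close>, \<open>N b = (N y - b) / s\<close>; so the span of
      the \<open>w t\<close> is stable under \<open>N\<close>, and pairing with \<open>u\<close>
      vanishes on it.\<close>
    have "N (N y) \<in> ?Z"
      using N _ subspace_span Ny
    proof (rule lin_span_mono)
      fix b assume "b \<in> w ` T"
      then obtain s where s: "s \<in> T" "b = w s" by auto
      then have "N y - b = s *s N b" using w(1)[OF s(1)] by (metis add_diff_cancel_left')
      moreover have "s \<noteq> 0" using s(1) T(2) by auto
      ultimately have "N b = (1 / s) *s (N y - b)" by simp
      then show "N b \<in> ?Z" using Ny s by (simp add: span_diff span_scale span_base)
    qed
    then show ?thesis using y0 Z0[OF Ny] Z0 by (simp add: N_def)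
  qed
  have cocycle': "\<beta> (a \<bullet> b) c + \<beta> (b \<bullet> c) a + \<beta> (c \<bullet> a) b = 0" for a b c
  proof (rule cocycle[OF killing_nondegenerate S SX XE])
    show "(a - S (x \<bullet> a)) \<bullet> (b - S (x \<bullet> b)) = 0" for a b by (rule abel[OF XE XE])
    show "\<beta> u v = - \<beta> v u" for u v by (rule \<beta>_anti)
  qed (use key[OF XE] in \<open>auto simp: \<beta>_lin\<close>)
  \<comment> \<open>Paired with \<open>d\<close>, the failure of the Leibniz rule is the cocycle sum
    for \<open>b\<close>, \<open>c\<close>, \<open>d\<close>.\<close>
  have der: "B (b \<bullet> c) = B b \<bullet> c + b \<bullet> B c" for b c
  proof -
    have "B (b \<bullet> c) - B b \<bullet> c - b \<bullet> B c = 0"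
    proof (rule killing_nondegenerate)
      fix d
      have 1: "\<beta> (c \<bullet> d) b = - killing (B b \<bullet> c) d"
        using \<beta>_anti[of "c \<bullet> d" b] by (simp add: \<beta>_def killing_invariant)
      have "\<beta> (d \<bullet> b) c = - killing (B c) (d \<bullet> b)" using \<beta>_anti[of "d \<bullet> b" c] by (simp add: \<beta>_def)
      also have "\<dots> = killing (B c) (b \<bullet> d)" using bracket_anti[of d b] by (simp add: killing_neg)
      also have "\<dots> = killing (B c \<bullet> b) d" by (simp add: killing_invariant)
      also have "\<dots> = - killing (b \<bullet> B c) d" using bracket_anti[of "B c" b] by (simp add: killing_neg)
      finally show "killing (B (b \<bullet> c) - B b \<bullet> c - b \<bullet> B c) d = 0"
        using cocycle'[of b c d] 1 by (simp add: killing_diff \<beta>_def[of "b \<bullet> c"])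
    qed
    then show ?thesis by (simp add: diff_diff_eq)
  qed
  obtain dual where "nd_lie_algebra scale bracket Basis dual"
    using dual_basis_exists[OF killing_nondegenerate] by blast
  then interpret K: nd_lie_algebra scale bracket Basis dual .
  obtain d where "\<And>v. B v = d \<bullet> v"
    by (rule K.derivation_inner[OF B]) (use der span_Basis in auto)
  then have "B0 v = (d - a) \<bullet> v" for v by (simp add: B_def bracket_simps eq_diff_eq)
  then show ?thesis by (rule that)
qed

end

theorem theorem2:
  fixes scale :: "'k::field_char_0 \<Rightarrow> 'g::ab_group_add \<Rightarrow> 'g"
    and Basis :: "'g set"
    and bracket :: "'g \<Rightarrow> 'g \<Rightarrow> 'g"
  assumes "finite_dimensional_vector_space scale Basis"
    and "semisimple_lie_algebra scale bracket"
  shows "endomorphism_space.rank_critical scale (range (lie_algebra.ad bracket))"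
proof -
  interpret E: endomorphism_space scale Basis using assms(1) by (simp add: endomorphism_space_def)
  interpret L: findim_semisimple_lie_algebra scale Basis bracket
    using assms by (simp add: findim_semisimple_lie_algebra_def findim_lie_algebra_def findim_vs_operators_def
        vs_operators_def finite_dimensional_vector_space_def semisimple_lie_algebra_def)
  interpret M: vector_space E.map_scale by (rule E.vector_space_map_scale)
  have ad: "lie_algebra.ad bracket = bracket" by (simp add: L.ad_def fun_eq_iff)
  have lin: "f \<in> E.endos \<longleftrightarrow> L.lin f" for f by (simp add: E.endos_def)
  have sub: "E.endo_subspace (range bracket)"
    unfolding E.endo_subspace_def
  proof
    show "range bracket \<subseteq> E.endos" using L.lin_bracket by (auto simp: lin)
    show "M.subspace (range bracket)"
    proof (rule M.subspaceI)
      have "bracket 0 = 0" by (simp add: fun_eq_iff fun_ops L.bracket_simps)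
      then show "0 \<in> range bracket" by (metis rangeI)
    next
      fix f g assume "f \<in> range bracket" "g \<in> range bracket"
      then obtain u v where uv: "f = bracket u" "g = bracket v" by auto
      have "f + g = bracket (u + v)" by (simp add: uv fun_eq_iff fun_ops L.bracket_simps)
      then show "f + g \<in> range bracket" by simp
    next
      fix c f assume "f \<in> range bracket"
      then obtain u where u: "f = bracket u" by auto
      have "E.map_scale c f = bracket (scale c u)" by (simp add: u fun_eq_iff E.map_scale_def L.bracket_simps)
      then show "E.map_scale c f \<in> range bracket" by simp
    qed
  qed
  have fin: "finite (E.map_rank ` A)" for A
    using E.dim_subset_UNIV[unfolded E.dimension_def] by (auto simp: E.map_rank_def intro: finite_subset[of _ "{..card Basis}"])
  have "E.generic_rank \<B> > E.generic_rank (range bracket)" if \<B>: "E.endo_subspace \<B>" "range bracket \<subset> \<B>" for \<B>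
  proof (rule ccontr)
    assume "\<not> ?thesis"
    then have le: "E.generic_rank \<B> \<le> E.generic_rank (range bracket)" by simp
    obtain f where f: "f \<in> \<B>" "f \<notin> range bracket" using \<B>(2) by blast
    have linB: "L.lin h" if "h \<in> \<B>" for h using \<B>(1) that lin by (auto simp: E.endo_subspace_def)
    have "\<exists>z. f v = bracket y z"
      if mx: "\<And>z. L.rank (bracket z) \<le> L.rank (bracket y)" and yv: "bracket y v = 0" for y v
    proof -
      \<comment> \<open>\<open>mx\<close> says that \<open>bracket y\<close> attains the generic
        rank of the inner derivations, so no element of \<open>\<B>\<close> has larger rank.\<close>
      have "E.generic_rank (range bracket) \<le> L.rank (bracket y)"
        unfolding E.generic_rank_def using fin mx by (intro Max.boundedI) (auto simp: E.map_rank_def)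
      then have r: "L.rank h \<le> L.rank (bracket y)" if "h \<in> \<B>" for h
        using Max_ge[OF fin[of \<B>], of "E.map_rank h"] that le by (simp add: E.generic_rank_def E.map_rank_def)
      have "(\<lambda>v. bracket y v + scale t (f v)) \<in> \<B>" for t
      proof -
        have "M.subspace \<B>" using \<B>(1) by (simp add: E.endo_subspace_def)
        then have "bracket y + E.map_scale t f \<in> \<B>"
          using f(1) \<B>(2) by (intro M.subspace_add M.subspace_scale) auto
        moreover have "bracket y + E.map_scale t f = (\<lambda>v. bracket y v + scale t (f v))"
          by (simp add: fun_eq_iff fun_ops E.map_scale_def)
        ultimately show ?thesis by simp
      qed
      then obtain z where "f v = bracket y z"
        using L.rank_neutral[OF L.lin_bracket linB[OF f(1)] r yv] by blast
      then show ?thesis by blast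
    qed
    then obtain a where "\<And>v. f v = bracket a v"
      using L.rank_neutral_direction_inner[OF linB[OF f(1)]] by blast
    then have "f = bracket a" by (rule ext)
    then show False using f(2) by simp
  qed
  then show ?thesis unfolding ad E.rank_critical_def using sub by blast
qed

end
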